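(* Let $M$ be a Riemannian manifold, let $S$ be a connected Lie subgroup of $\mathrm{Isom}(M)$ with Lie algebra $\mathrm{Lie}(S) = \mathfrak{s}$, and assume that $S$ acts transitively on $M$. Let $\mathfrak{s}'$ be an ideal of $\mathfrak{s}$, and let $S'$ be the connected Lie subgroup of $S$ with $\mathrm{Lie}(S') = \mathfrak{s}'$. Then all orbits of $S'$ in $M$ are isometrically congruent to each other; that is, for all $p, q \in M$ the orbits $S'.p$ and $S'.q$ are isometrically congruent.
   Context: $\mathrm{Isom}(M)$ denotes the isometry group of the Riemannian manifold $M$, and $\mathrm{Lie}(G)$ denotes the Lie algebra of a Lie group $G$. Two subsets (submanifolds) $A, B \subset M$ are isometrically congruent if there exists $g \in \mathrm{Isom}(M)$ with $g(A) = B$. For a subgroup $H \subset \mathrm{Isom}(M)$ and $p \in M$, $H.p$ denotes the orbit of $p$ under $H$. *)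

theory Defs
  imports "HOL-Analysis.Analysis" "HOL-Algebra.Group_Action"
begin

text \<open>
  Smooth manifolds with an explicit carrier set. Charts take values in a linear subspace
  \<open>model M\<close> of a Euclidean space rather than in the whole space, because
  \<^class>\<open>euclidean_space\<close> excludes dimension 0 and zero-dimensional Lie groups must be allowed.
\<close>

subsection \<open>Smooth maps on open subsets of a linear subspace\<close>

text \<open>
  \<open>k_smooth V k U f\<close>: \<open>f\<close> is of class \<open>C\<^sup>k\<close> on \<open>U\<close>, where \<open>U\<close> is a relatively open subset of
  the linear subspace \<open>V\<close>. On \<open>V\<close> the derivative \<open>D x\<close> is uniquely determined; its values off
  \<open>V\<close> are irrelevant, so only directions \<open>v \<in> V\<close> enter the recursion.
\<close>

primrec k_smooth ::
  "'e::euclidean_space set \<Rightarrow> nat \<Rightarrow> 'e set \<Rightarrow> ('e \<Rightarrow> 'f::real_normed_vector) \<Rightarrow> bool" where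
  "k_smooth V 0 U f \<longleftrightarrow> continuous_on U f"
| "k_smooth V (Suc k) U f \<longleftrightarrow>
     (\<exists>D. (\<forall>x\<in>U. (f has_derivative D x) (at x within U)) \<and>
          (\<forall>v\<in>V. k_smooth V k U (\<lambda>x. D x v)))"

definition smooth_on ::
  "'e::euclidean_space set \<Rightarrow> 'e set \<Rightarrow> ('e \<Rightarrow> 'f::real_normed_vector) \<Rightarrow> bool" where
  "smooth_on V U f \<longleftrightarrow> (\<forall>k. k_smooth V k U f)"

subsection \<open>Smooth manifolds\<close>

record ('a, 'e) manifold = "'a partial_object" +
  model :: "'e set"
  charts :: "('a set \<times> ('a \<Rightarrow> 'e)) set"

definition manifold_topology ::
  "('a, 'e::euclidean_space, 'z) manifold_scheme \<Rightarrow> 'a topology" where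
  "manifold_topology M =
     topology_generated_by {U \<inter> \<phi> -` T | U \<phi> T. (U, \<phi>) \<in> charts M \<and> open T}"

text \<open>The atlas need not be maximal; all notions below depend only on the smooth structure it
  generates.\<close>

definition smooth_manifold :: "('a, 'e::euclidean_space, 'z) manifold_scheme \<Rightarrow> bool" where
  "smooth_manifold M \<longleftrightarrow>
     subspace (model M) \<and>
     (\<Union>(U, \<phi>)\<in>charts M. U) = carrier M \<and>
     (\<forall>(U, \<phi>)\<in>charts M. inj_on \<phi> U \<and> openin (top_of_set (model M)) (\<phi> ` U)) \<and>
     (\<forall>(U, \<phi>)\<in>charts M. \<forall>(W, \<psi>)\<in>charts M.
        openin (top_of_set (model M)) (\<phi> ` (U \<inter> W)) \<and>
        smooth_on (model M) (\<phi> ` (U \<inter> W)) (\<psi> \<circ> inv_into U \<phi>)) \<and>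
     Hausdorff_space (manifold_topology M) \<and>
     second_countable (manifold_topology M)"

text \<open>Requiring the domain of each coordinate representation to be open makes smooth maps
  continuous.\<close>

definition smooth_map ::
  "('a, 'e::euclidean_space, 'y) manifold_scheme \<Rightarrow>
   ('b, 'f::euclidean_space, 'z) manifold_scheme \<Rightarrow> ('a \<Rightarrow> 'b) \<Rightarrow> bool" where
  "smooth_map M N F \<longleftrightarrow>
     F ` carrier M \<subseteq> carrier N \<and>
     (\<forall>(U, \<phi>)\<in>charts M. \<forall>(W, \<psi>)\<in>charts N.
        openin (top_of_set (model M)) (\<phi> ` (U \<inter> F -` W)) \<and>
        smooth_on (model M) (\<phi> ` (U \<inter> F -` W)) (\<psi> \<circ> F \<circ> inv_into U \<phi>))"

definition prod_manifold ::
  "('a, 'e::euclidean_space, 'y) manifold_scheme \<Rightarrow>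
   ('b, 'f::euclidean_space, 'z) manifold_scheme \<Rightarrow> ('a \<times> 'b, 'e \<times> 'f) manifold" where
  "prod_manifold M N =
     \<lparr>carrier = carrier M \<times> carrier N,
      model = model M \<times> model N,
      charts = {(U \<times> W, map_prod \<phi> \<psi>) | U \<phi> W \<psi>. (U, \<phi>) \<in> charts M \<and> (W, \<psi>) \<in> charts N}\<rparr>"

definition smooth_fun ::
  "('a, 'e::euclidean_space, 'z) manifold_scheme \<Rightarrow> ('a \<Rightarrow> real) \<Rightarrow> bool" where
  "smooth_fun M f \<longleftrightarrow>
     (\<forall>(U, \<phi>)\<in>charts M. smooth_on (model M) (\<phi> ` U) (f \<circ> inv_into U \<phi>))"

text \<open>The algebra \<open>C\<^sup>\<infinity>(M)\<close>; smooth functions are represented uniquely by extending them by 0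
  outside the carrier.\<close>

definition smooth_funs ::
  "('a, 'e::euclidean_space, 'z) manifold_scheme \<Rightarrow> ('a \<Rightarrow> real) set" where
  "smooth_funs M = {f. smooth_fun M f \<and> (\<forall>x. x \<notin> carrier M \<longrightarrow> f x = 0)}"

subsection \<open>Tangent vectors and vector fields\<close>

type_synonym 'a tangent = "('a \<Rightarrow> real) \<Rightarrow> real"

text \<open>Tangent vectors are the derivations of \<open>C\<^sup>\<infinity>(M)\<close> at a point, extended by 0 to functions
  outside \<open>C\<^sup>\<infinity>(M)\<close>.\<close>

definition tangent_space ::
  "('a, 'e::euclidean_space, 'z) manifold_scheme \<Rightarrow> 'a \<Rightarrow> 'a tangent set" where
  "tangent_space M p =
     {v. (\<forall>f. f \<notin> smooth_funs M \<longrightarrow> v f = 0) \<and>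
         (\<forall>f\<in>smooth_funs M. \<forall>h\<in>smooth_funs M.
            v (\<lambda>x. f x + h x) = v f + v h \<and>
            v (\<lambda>x. f x * h x) = f p * v h + h p * v f) \<and>
         (\<forall>f\<in>smooth_funs M. \<forall>c. v (\<lambda>x. c * f x) = c * v f)}"

text \<open>The differential of a smooth map \<open>F\<close> from \<open>M\<close> to \<open>N\<close>, sending \<open>v\<close> to \<open>f \<mapsto> v (f \<circ> F)\<close>.\<close>

definition differential ::
  "('a, 'e::euclidean_space, 'y) manifold_scheme \<Rightarrow>
   ('b, 'f::euclidean_space, 'z) manifold_scheme \<Rightarrow> ('a \<Rightarrow> 'b) \<Rightarrow> 'a tangent \<Rightarrow> 'b tangent" where
  "differential M N F v =
     (\<lambda>f. if f \<in> smooth_funs N then v (\<lambda>x. if x \<in> carrier M then f (F x) else 0) else 0)"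

text \<open>Vector fields are extended by the zero vector outside the carrier.\<close>

definition vector_fields ::
  "('a, 'e::euclidean_space, 'z) manifold_scheme \<Rightarrow> ('a \<Rightarrow> 'a tangent) set" where
  "vector_fields M =
     {X. (\<forall>p\<in>carrier M. X p \<in> tangent_space M p) \<and>
         (\<forall>p. p \<notin> carrier M \<longrightarrow> X p = (\<lambda>f. 0)) \<and>
         (\<forall>f\<in>smooth_funs M. smooth_fun M (\<lambda>p. X p f))}"

definition lie_bracket ::
  "('a \<Rightarrow> 'a tangent) \<Rightarrow> ('a \<Rightarrow> 'a tangent) \<Rightarrow> 'a \<Rightarrow> 'a tangent" where
  "lie_bracket X Y = (\<lambda>p f. X p (\<lambda>q. Y q f) - Y p (\<lambda>q. X q f))"

subsection \<open>Riemannian manifolds and isometries\<close>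

record ('a, 'e) riemannian = "('a, 'e) manifold" +
  metric :: "'a \<Rightarrow> 'a tangent \<Rightarrow> 'a tangent \<Rightarrow> real"

definition riemannian_manifold :: "('a, 'e::euclidean_space, 'z) riemannian_scheme \<Rightarrow> bool" where
  "riemannian_manifold M \<longleftrightarrow>
     smooth_manifold M \<and>
     (\<forall>p\<in>carrier M. \<forall>u\<in>tangent_space M p. \<forall>v\<in>tangent_space M p.
        (\<forall>w\<in>tangent_space M p. metric M p (\<lambda>f. u f + v f) w = metric M p u w + metric M p v w) \<and>
        (\<forall>c. metric M p (\<lambda>f. c * u f) v = c * metric M p u v) \<and>
        metric M p u v = metric M p v u \<and>
        (u \<noteq> (\<lambda>f. 0) \<longrightarrow> metric M p u u > 0)) \<and>
     (\<forall>X\<in>vector_fields M. \<forall>Y\<in>vector_fields M. smooth_fun M (\<lambda>p. metric M p (X p) (Y p)))"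

definition isometries :: "('a, 'e::euclidean_space, 'z) riemannian_scheme \<Rightarrow> ('a \<Rightarrow> 'a) set" where
  "isometries M =
     {F \<in> Bij (carrier M).
        smooth_map M M F \<and> smooth_map M M (inv_into (carrier M) F) \<and>
        (\<forall>p\<in>carrier M. \<forall>u\<in>tangent_space M p. \<forall>v\<in>tangent_space M p.
           metric M (F p) (differential M M F u) (differential M M F v) = metric M p u v)}"

definition Isom :: "('a, 'e::euclidean_space, 'z) riemannian_scheme \<Rightarrow> ('a \<Rightarrow> 'a) monoid" where
  "Isom M = (BijGroup (carrier M))\<lparr>carrier := isometries M\<rparr>"

definition isometrically_congruent ::
  "('a, 'e::euclidean_space, 'z) riemannian_scheme \<Rightarrow> 'a set \<Rightarrow> 'a set \<Rightarrow> bool" where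
  "isometrically_congruent M A B \<longleftrightarrow> (\<exists>g\<in>carrier (Isom M). g ` A = B)"

text \<open>The compact-open topology on the isometry group.\<close>

definition isom_topology ::
  "('a, 'e::euclidean_space, 'z) riemannian_scheme \<Rightarrow> ('a \<Rightarrow> 'a) topology" where
  "isom_topology M =
     topology_generated_by
       {{g \<in> isometries M. g ` K \<subseteq> T} | K T.
          compactin (manifold_topology M) K \<and> openin (manifold_topology M) T}"

subsection \<open>Lie groups\<close>

record ('a, 'e) lie = "('a, 'e) manifold" +
  grp :: "'a monoid"

definition lie_group :: "('a, 'e::euclidean_space, 'z) lie_scheme \<Rightarrow> bool" where
  "lie_group G \<longleftrightarrow>
     smooth_manifold G \<and> group (grp G) \<and> carrier (grp G) = carrier G \<and>
     smooth_map (prod_manifold G G) G (\<lambda>(x, y). x \<otimes>\<^bsub>grp G\<^esub> y) \<and>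
     smooth_map G G (\<lambda>x. inv\<^bsub>grp G\<^esub> x)"

text \<open>Lie subgroups in the sense of injectively immersed subgroups: \<open>H\<close> carries its own smooth
  structure, whose topology may be finer than the subspace topology.\<close>

definition lie_subgroup ::
  "('a, 'e::euclidean_space, 'y) lie_scheme \<Rightarrow> ('a, 'f::euclidean_space, 'z) lie_scheme \<Rightarrow> bool" where
  "lie_subgroup H G \<longleftrightarrow>
     lie_group H \<and> lie_group G \<and>
     subgroup (carrier H) (grp G) \<and> grp H = (grp G)\<lparr>carrier := carrier H\<rparr> \<and>
     smooth_map H G (\<lambda>x. x) \<and>
     (\<forall>p\<in>carrier H. inj_on (differential H G (\<lambda>x. x)) (tangent_space H p))"

definition lie_connected :: "('a, 'e::euclidean_space, 'z) lie_scheme \<Rightarrow> bool" where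
  "lie_connected G \<longleftrightarrow> connected_space (manifold_topology G)"

text \<open>The Lie algebra consists of the left-invariant vector fields, with pointwise linear
  operations and the bracket \<^const>\<open>lie_bracket\<close>.\<close>

definition Lie :: "('a, 'e::euclidean_space, 'z) lie_scheme \<Rightarrow> ('a \<Rightarrow> 'a tangent) set" where
  "Lie G =
     {X \<in> vector_fields G. \<forall>a\<in>carrier G. \<forall>p\<in>carrier G.
        differential G G (\<lambda>x. a \<otimes>\<^bsub>grp G\<^esub> x) (X p) = X (a \<otimes>\<^bsub>grp G\<^esub> p)}"

text \<open>The Lie algebra of a Lie subgroup \<open>H\<close> of \<open>G\<close>, regarded as a subset of \<open>Lie G\<close> through the
  differential of the inclusion.\<close>

definition Lie_sub ::
  "('a, 'e::euclidean_space, 'y) lie_scheme \<Rightarrow> ('a, 'f::euclidean_space, 'z) lie_scheme \<Rightarrow>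
   ('a \<Rightarrow> 'a tangent) set" where
  "Lie_sub H G =
     {X \<in> Lie G. \<exists>Y\<in>Lie H. \<forall>p\<in>carrier H. differential H G (\<lambda>x. x) (Y p) = X p}"

definition lie_ideal ::
  "('a \<Rightarrow> 'a tangent) set \<Rightarrow> ('a, 'e::euclidean_space, 'z) lie_scheme \<Rightarrow> bool" where
  "lie_ideal I G \<longleftrightarrow>
     I \<subseteq> Lie G \<and> (\<lambda>p f. 0) \<in> I \<and>
     (\<forall>X\<in>I. \<forall>Y\<in>I. (\<lambda>p f. X p f + Y p f) \<in> I) \<and>
     (\<forall>c. \<forall>X\<in>I. (\<lambda>p f. c * X p f) \<in> I) \<and>
     (\<forall>X\<in>Lie G. \<forall>Y\<in>I. lie_bracket X Y \<in> I)"

text \<open>\<open>G\<close> is the isometry group with its Lie group structure. By the Myers-Steenrod theorem such a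
  structure exists (for connected \<open>M\<close>), and it is determined by its topology.\<close>

definition isometry_lie_group ::
  "('a, 'e::euclidean_space, 'y) riemannian_scheme \<Rightarrow>
   ('a \<Rightarrow> 'a, 'f::euclidean_space, 'z) lie_scheme \<Rightarrow> bool" where
  "isometry_lie_group M G \<longleftrightarrow>
     lie_group G \<and> grp G = Isom M \<and> manifold_topology G = isom_topology M"

end

theory Submission
  imports Defs
begin

text \<open>
  The subgroup \<open>S'\<close> is normal in \<open>S\<close>; then \<open>g(S'.p) = (g S' g\<^sup>-\<^sup>1).gp = S'.gp\<close>, and transitivity
  finishes the proof.

  Normality is proved without the exponential map. In a chart at the identity, let \<open>L\<close> be the tangent
  space of \<open>S'\<close>. Along the straight line \<open>t \<mapsto> ta\<close> the part of \<open>Ad(ta)\<close> that maps \<open>L\<close> to a complement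
  of \<open>L\<close> satisfies a homogeneous linear differential equation, since \<open>L\<close> is an ideal, and vanishes at
  \<open>t = 0\<close>; so \<open>Ad(a)\<close> preserves \<open>L\<close> for small \<open>a\<close>. The inverse function theorem provides a function
  \<open>F\<close> near the identity whose zeros lie in \<open>S'\<close> and which is invariant under left translation by small
  elements of \<open>S'\<close>. If \<open>h\<^sub>t\<close> is a curve in \<open>S'\<close> starting at the identity, then \<open>F(a h\<^sub>t a\<^sup>-\<^sup>1)\<close> has
  derivative 0 because \<open>Ad(a) L \<subseteq> L\<close>, so \<open>a h\<^sub>t a\<^sup>-\<^sup>1\<close> stays in \<open>S'\<close>. A connected group is generated
  by every neighbourhood of the identity, which globalises this in both arguments.
\<close>

subsection \<open>Calculus of smooth functions\<close>

text \<open>\<open>S'\<close> is only immersed and may be dense in \<open>S\<close>, so no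
  continuous function has exactly \<open>S'\<close> as its zero set near the identity. Zeros of
  \<open>F\<close> lie in \<open>S'\<close>, but not conversely. This is why a whole curve starting
  at the identity is followed instead of testing the single point \<open>a h a^-1\<close>.

  The differential equation is homogeneous because differentiating
  \<open>Ad(xz) = Ad(x) Ad(z)\<close> puts the infinitesimal factor on the right: the ideal property
  acts first and yields a vector of \<open>L\<close>, to which \<open>Ad(ta)\<close> is applied
  again. A straight line is in general no one-parameter subgroup, so its velocity has to be moved
  back to the identity by left translation, which makes the coefficients depend on \<open>t\<close>.

  The hypothesis on \<open>\<ss>'\<close> concerns brackets of derivations of a function algebra,
  whereas the argument needs second derivatives of the multiplication. Bump functions, Hadamard's
  lemma and the symmetry of second derivatives serve to pass from one to the other.\<close>

abbreviation "smooth \<equiv> smooth_on UNIV"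

lemma k_smooth_cong:
  assumes "k_smooth V k U f" "\<And>x. x \<in> U \<Longrightarrow> f x = g x"
  shows "k_smooth V k U g"
proof (cases k)
  case 0
  then show ?thesis using assms by (simp cong: continuous_on_cong)
next
  case (Suc m)
  then obtain D where D: "\<And>x. x \<in> U \<Longrightarrow> (f has_derivative D x) (at x within U)"
    "\<And>v. v \<in> V \<Longrightarrow> k_smooth V m U (\<lambda>x. D x v)"
    using assms by auto
  have "(g has_derivative D x) (at x within U)" if "x \<in> U" for x
    using has_derivative_transform[OF that _ D(1)[OF that]] assms(2) by auto
  then show ?thesis using D Suc by auto
qed

lemma k_smooth_SucE:
  assumes "k_smooth V (Suc k) U f"
  obtains D where "\<And>x. x \<in> U \<Longrightarrow> (f has_derivative D x) (at x within U)"
    "\<And>v. v \<in> V \<Longrightarrow> k_smooth V k U (\<lambda>x. D x v)"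
  using assms by auto

lemma k_smooth_subset:
  assumes "k_smooth V k U f" "W \<subseteq> U"
  shows "k_smooth V k W f"
  using assms(1)
proof (induction k arbitrary: f)
  case 0
  then show ?case using assms(2) continuous_on_subset by auto
next
  case (Suc k)
  then obtain D where "\<And>x. x \<in> U \<Longrightarrow> (f has_derivative D x) (at x within U)"
    "\<And>v. v \<in> V \<Longrightarrow> k_smooth V k U (\<lambda>x. D x v)"
    by auto
  then show ?case using Suc.IH assms(2)
    by (auto intro!: exI[of _ D] has_derivative_subset[where s=U and t=W])
qed

lemma k_smooth_continuous:
  assumes "k_smooth V k U f" shows "continuous_on U f"
proof (cases k)
  case (Suc m)
  then show ?thesis using assms
    by (auto simp: continuous_on_eq_continuous_within intro: has_derivative_continuous)
qed (use assms in auto)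

lemma k_smooth_SucD:
  assumes "k_smooth V (Suc k) U f" shows "k_smooth V k U f"
  using assms
proof (induction k arbitrary: f)
  case 0
  then show ?case using k_smooth_continuous by (metis k_smooth.simps(1))
next
  case (Suc k)
  then show ?case by (subst k_smooth.simps(2)) (metis k_smooth.simps(2))
qed

lemma k_smooth_bounded_linear:
  assumes "bounded_linear h" "k_smooth V k U f"
  shows "k_smooth V k U (\<lambda>x. h (f x))"
  using assms(2)
proof (induction k arbitrary: f)
  case 0
  then show ?case using assms(1) by (auto intro: bounded_linear.continuous_on)
next
  case (Suc k)
  then obtain D where "\<And>x. x \<in> U \<Longrightarrow> (f has_derivative D x) (at x within U)"
    "\<And>v. v \<in> V \<Longrightarrow> k_smooth V k U (\<lambda>x. D x v)"
    by auto
  then show ?case using Suc.IH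
    by (auto intro!: exI[of _ "\<lambda>x v. h (D x v)"] intro: bounded_linear.has_derivative[OF assms(1)])
qed

lemma k_smooth_const: "k_smooth V k U (\<lambda>x. c)"
proof (induction k arbitrary: c)
  case (Suc k)
  then show ?case by (auto intro!: exI[of _ "\<lambda>x v. 0"])
qed auto

lemma k_smooth_ident: "k_smooth V k U (\<lambda>x. x)"
proof (cases k)
  case (Suc k)
  then show ?thesis by (auto intro!: exI[of _ "\<lambda>x v. v"] k_smooth_const)
qed auto

lemma k_smooth_add:
  assumes "k_smooth V k U f" "k_smooth V k U g"
  shows "k_smooth V k U (\<lambda>x. f x + g x)"
  using assms
proof (induction k arbitrary: f g)
  case (Suc k)
  obtain D where "\<And>x. x \<in> U \<Longrightarrow> (f has_derivative D x) (at x within U)"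
    "\<And>v. v \<in> V \<Longrightarrow> k_smooth V k U (\<lambda>x. D x v)"
    using k_smooth_SucE[OF Suc.prems(1)] by metis
  moreover obtain E where "\<And>x. x \<in> U \<Longrightarrow> (g has_derivative E x) (at x within U)"
    "\<And>v. v \<in> V \<Longrightarrow> k_smooth V k U (\<lambda>x. E x v)"
    using k_smooth_SucE[OF Suc.prems(2)] by metis
  ultimately show ?case using Suc.IH
    by (auto intro!: exI[of _ "\<lambda>x v. D x v + E x v"] has_derivative_add)
qed (auto intro: continuous_on_add)

lemma k_smooth_sum:
  assumes "\<And>i. i \<in> I \<Longrightarrow> k_smooth V k U (f i)"
  shows "k_smooth V k U (\<lambda>x. \<Sum>i\<in>I. f i x)"
proof (cases "finite I")
  case True
  then show ?thesis using assms
    by (induction I) (auto intro: k_smooth_const k_smooth_add)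
qed (auto intro: k_smooth_const)

lemma k_smooth_bilinear:
  assumes "bounded_bilinear B" "k_smooth V k U f" "k_smooth V k U g"
  shows "k_smooth V k U (\<lambda>x. B (f x) (g x))"
  using assms(2,3)
proof (induction k arbitrary: f g)
  case 0
  then show ?case using bounded_bilinear.continuous_on[OF assms(1)] by auto
next
  case (Suc k)
  obtain D where "\<And>x. x \<in> U \<Longrightarrow> (f has_derivative D x) (at x within U)"
    "\<And>v. v \<in> V \<Longrightarrow> k_smooth V k U (\<lambda>x. D x v)"
    using k_smooth_SucE[OF Suc.prems(1)] by metis
  moreover obtain E where "\<And>x. x \<in> U \<Longrightarrow> (g has_derivative E x) (at x within U)"
    "\<And>v. v \<in> V \<Longrightarrow> k_smooth V k U (\<lambda>x. E x v)"
    using k_smooth_SucE[OF Suc.prems(2)] by metis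
  moreover have "k_smooth V k U f" "k_smooth V k U g"
    using Suc.prems k_smooth_SucD by blast+
  ultimately show ?case using Suc.IH
    by (auto intro!: exI[of _ "\<lambda>x v. B (f x) (E x v) + B (D x v) (g x)"] k_smooth_add
         bounded_bilinear.FDERIV[OF assms(1)])
qed

lemma k_smooth_Pair:
  assumes "k_smooth V k U f" "k_smooth V k U g"
  shows "k_smooth V k U (\<lambda>x. (f x, g x))"
proof -
  have "bounded_linear (\<lambda>x. (x, 0))" "bounded_linear (\<lambda>x. (0, x))"
    by (auto intro!: bounded_linear_Pair bounded_linear_zero bounded_linear_ident)
  then have "k_smooth V k U (\<lambda>x. (f x, 0) + (0, g x))"
    using assms by (intro k_smooth_add) (auto intro: k_smooth_bounded_linear)
  then show ?thesis by simp
qed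

lemma k_smooth_compose:
  fixes f :: "'e::euclidean_space \<Rightarrow> 'f::euclidean_space"
  assumes "k_smooth UNIV k U f" "k_smooth UNIV k W g" "f ` U \<subseteq> W"
  shows "k_smooth UNIV k U (\<lambda>x. g (f x))"
  using assms
proof (induction k arbitrary: f g)
  case 0
  then show ?case by (auto intro: continuous_on_compose2)
next
  case (Suc k)
  obtain D where D: "\<And>x. x \<in> U \<Longrightarrow> (f has_derivative D x) (at x within U)"
    "\<And>v. k_smooth UNIV k U (\<lambda>x. D x v)" using k_smooth_SucE[OF Suc.prems(1)] by (metis UNIV_I)
  obtain E where E: "\<And>x. x \<in> W \<Longrightarrow> (g has_derivative E x) (at x within W)"
    "\<And>v. k_smooth UNIV k W (\<lambda>x. E x v)" using k_smooth_SucE[OF Suc.prems(2)] by (metis UNIV_I)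
  have f: "k_smooth UNIV k U f" using Suc.prems k_smooth_SucD by blast
  have *: "((\<lambda>x. g (f x)) has_derivative (\<lambda>v. E (f x) (D x v))) (at x within U)" if "x \<in> U" for x
    using diff_chain_within[OF D(1)[OF that] has_derivative_subset[OF E(1) Suc.prems(3)]]
      Suc.prems(3) that by (auto simp: o_def)
  \<comment> \<open>The direction \<open>D x v\<close> varies with \<open>x\<close>, whereas the
    induction hypothesis covers \<open>E\<close> only in a fixed direction. Expanding
    \<open>D x v\<close> in the basis separates the two dependences.\<close>
  have "k_smooth UNIV k U (\<lambda>x. E (f x) (D x v))" for v
  proof (rule k_smooth_cong)
    show "k_smooth UNIV k U (\<lambda>x. \<Sum>b\<in>Basis. (D x v \<bullet> b) *\<^sub>R E (f x) b)"
      by (intro k_smooth_sum k_smooth_bilinear[OF bounded_bilinear_scaleR]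
            k_smooth_bounded_linear[OF bounded_linear_inner_left] D(2) Suc.IH[OF f E(2) Suc.prems(3)])
    fix x assume "x \<in> U"
    then have "linear (E (f x))" using E(1) Suc.prems(3) has_derivative_linear by blast
    then show "(\<Sum>b\<in>Basis. (D x v \<bullet> b) *\<^sub>R E (f x) b) = E (f x) (D x v)"
      by (subst (2) euclidean_representation[of "D x v", symmetric])
         (simp add: linear_sum linear_scale del: euclidean_representation)
  qed
  with * show ?case
    by (subst k_smooth.simps(2)) (intro exI[of _ "\<lambda>x v. E (f x) (D x v)"], simp)
qed

section \<open>Orthogonal projection, smoothness relative to a subspace, gluing\<close>

definition proj :: "'e::euclidean_space set \<Rightarrow> 'e \<Rightarrow> 'e" where
  "proj V = (SOME P. bounded_linear P \<and> (\<forall>x. P x \<in> V) \<and> (\<forall>x\<in>V. P x = x) \<and>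
               (\<forall>x. \<forall>v\<in>V. (x - P x) \<bullet> v = 0))"

text \<open>Composing with \<open>proj V\<close> extends functions from \<open>V\<close> to the
  whole space, so that derivatives within a subspace become ordinary ones, which are unique.
  Existence comes from an orthonormal basis of \<open>V\<close>.\<close>

lemma
  assumes "subspace V"
  shows bounded_linear_proj: "bounded_linear (proj V)"
    and proj_in: "proj V x \<in> V"
    and proj_id: "x \<in> V \<Longrightarrow> proj V x = x"
    and proj_orth: "v \<in> V \<Longrightarrow> (x - proj V x) \<bullet> v = 0"
proof -
  obtain B where B: "B \<subseteq> V" "pairwise orthogonal B" "\<And>x. x \<in> B \<Longrightarrow> norm x = 1"
    "independent B" "span B = V"
    using orthonormal_basis_subspace[OF assms] by metis
  have fB: "finite B" using B(4) independent_imp_finite by blast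
  let ?P = "\<lambda>x. \<Sum>b\<in>B. (x \<bullet> b) *\<^sub>R b"
  have 1: "bounded_linear ?P"
    by (intro bounded_linear_sum bounded_linear_scaleR_const bounded_linear_inner_left)
  have 2: "?P x \<in> V" for x
    using B(1) assms by (meson subsetD subspace_scale subspace_sum)
  have 3: "(x - ?P x) \<bullet> c = 0" if "c \<in> B" for x c
  proof -
    have "?P x \<bullet> c = (\<Sum>b\<in>B. if b = c then x \<bullet> c else 0)"
      unfolding inner_sum_left
    proof (rule sum.cong)
      fix b assume "b \<in> B"
      then show "(x \<bullet> b) *\<^sub>R b \<bullet> c = (if b = c then x \<bullet> c else 0)"
        using B(2) B(3)[OF that] that by (auto simp: pairwise_def orthogonal_def dot_square_norm)
    qed simp
    then show ?thesis using fB that by (simp add: inner_diff_left)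
  qed
  have 4: "(x - ?P x) \<bullet> v = 0" if "v \<in> V" for x v
    using that unfolding B(5)[symmetric]
    by (induction rule: span_induct_alt) (auto simp: inner_add_right 3)
  have 5: "?P x = x" if "x \<in> V" for x
  proof -
    have "(x - ?P x) \<bullet> (x - ?P x) = 0"
      using 4[of "x - ?P x" x] assms that 2 by (meson subspace_diff)
    then show ?thesis by simp
  qed
  have "\<exists>P. bounded_linear P \<and> (\<forall>x. P x \<in> V) \<and> (\<forall>x\<in>V. P x = x) \<and>
               (\<forall>x. \<forall>v\<in>V. (x - P x) \<bullet> v = 0)"
    using 1 2 4 5 by (intro exI[of _ ?P]) auto
  from someI_ex[OF this] show "bounded_linear (proj V)" "proj V x \<in> V"
    "x \<in> V \<Longrightarrow> proj V x = x" "v \<in> V \<Longrightarrow> (x - proj V x) \<bullet> v = 0"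
    unfolding proj_def[symmetric] by auto
qed

lemma linear_proj: "subspace V \<Longrightarrow> linear (proj V)"
  using bounded_linear_proj bounded_linear.linear by blast

lemma proj_proj: "subspace V \<Longrightarrow> proj V (proj V x) = proj V x"
  by (simp add: proj_id proj_in)

text \<open>On \<open>U\<close> the function equals \<open>f\<close> after \<open>proj V\<close>, so
  \<open>D x\<close> may be replaced by \<open>D x\<close> after \<open>proj V\<close>, and every
  direction reduces to one in \<open>V\<close>. Smoothness on subsets of \<open>V\<close> can
  therefore be treated without mentioning \<open>V\<close>, even where \<open>U\<close> is not open
  in the whole space.\<close>

lemma k_smooth_UNIV:
  assumes "subspace V" "U \<subseteq> V"
  shows "k_smooth V k U f \<longleftrightarrow> k_smooth UNIV k U f"
proof (induction k arbitrary: f)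
  case (Suc k)
  show ?case
  proof
    assume "k_smooth V (Suc k) U f"
    then obtain D where D: "\<And>x. x \<in> U \<Longrightarrow> (f has_derivative D x) (at x within U)"
      "\<And>v. v \<in> V \<Longrightarrow> k_smooth V k U (\<lambda>x. D x v)" by auto
    have "(f has_derivative (\<lambda>v. D x (proj V v))) (at x within U)" if x: "x \<in> U" for x
    proof -
      have "((\<lambda>y. f (proj V y)) has_derivative (\<lambda>v. D x (proj V v))) (at x within U)"
      proof -
        have 1: "(proj V has_derivative proj V) (at x within U)"
          by (simp add: assms(1) bounded_linear_imp_has_derivative bounded_linear_proj)
        have "proj V ` U \<subseteq> U" "proj V x = x" using assms x by (auto simp: proj_id subset_iff)
        then have "(f has_derivative D x) (at (proj V x) within proj V ` U)"
          using D(1)[OF x] by (simp add: has_derivative_subset)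
        from diff_chain_within[OF 1 this] show ?thesis by (simp add: o_def)
      qed
      then show ?thesis
        by (rule has_derivative_transform[OF x, rotated]) (use assms in \<open>auto simp: proj_id subset_iff\<close>)
    qed
    moreover have "k_smooth UNIV k U (\<lambda>x. D x (proj V v))" for v
      using D(2) Suc.IH proj_in[OF assms(1)] by blast
    ultimately show "k_smooth UNIV (Suc k) U f"
      by (subst k_smooth.simps(2)) (intro exI[of _ "\<lambda>x v. D x (proj V v)"], simp)
  next
    assume "k_smooth UNIV (Suc k) U f"
    then show "k_smooth V (Suc k) U f" using Suc.IH by auto
  qed
qed auto

text \<open>The neighbourhoods supply unrelated witnesses for the derivative. On an open set
  derivatives are unique, so \<open>frechet_derivative\<close> is one global witness that agrees
  with all of them and carries the induction.\<close>

lemma k_smooth_glue_open: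
  fixes f :: "'e::euclidean_space \<Rightarrow> 'f::real_normed_vector"
  assumes "open U" "\<And>x. x \<in> U \<Longrightarrow> \<exists>W. open W \<and> x \<in> W \<and> k_smooth UNIV k (U \<inter> W) f"
  shows "k_smooth UNIV k U f"
  using assms(2)
proof (induction k arbitrary: f)
  case 0
  show ?case unfolding k_smooth.simps continuous_on_eq_continuous_within
  proof
    fix x assume "x \<in> U"
    then obtain W where W: "open W" "x \<in> W" "continuous_on (U \<inter> W) f" using 0 by auto
    then show "continuous (at x within U) f"
      using \<open>x \<in> U\<close> assms(1)
      by (metis IntI at_within_open continuous_on_eq_continuous_at open_Int)
  qed
next
  case (Suc k)
  let ?D = "\<lambda>x. frechet_derivative f (at x)"
  have *: "\<exists>W. open W \<and> x \<in> W \<and> (\<forall>y\<in>U \<inter> W. (f has_derivative ?D y) (at y)) \<and>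
     (\<forall>v. k_smooth UNIV k (U \<inter> W) (\<lambda>y. ?D y v))" if xU: "x \<in> U" for x
  proof -
    obtain W where W: "open W" "x \<in> W" "k_smooth UNIV (Suc k) (U \<inter> W) f"
      using Suc.prems[OF xU] by blast
    then obtain D where D: "\<And>y. y \<in> U \<inter> W \<Longrightarrow> (f has_derivative D y) (at y within U \<inter> W)"
      "\<And>v. k_smooth UNIV k (U \<inter> W) (\<lambda>x. D x v)" by auto
    have 1: "(f has_derivative D y) (at y)" if "y \<in> U \<inter> W" for y
      using D(1)[OF that] at_within_open[OF that] assms(1) W(1) by (metis open_Int)
    then have "D y = ?D y" if "y \<in> U \<inter> W" for y
      using that frechet_derivative_at by blast
    then have "k_smooth UNIV k (U \<inter> W) (\<lambda>y. ?D y v)" for v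
      by (intro k_smooth_cong[OF D(2)]) simp
    then show ?thesis using 1 W frechet_derivative_at by (intro exI[of _ W]) fastforce
  qed
  then have "k_smooth UNIV k U (\<lambda>y. ?D y v)" for v
    using Suc.IH by metis
  moreover have "(f has_derivative ?D x) (at x within U)" if "x \<in> U" for x
    using *[OF that] that has_derivative_at_withinI by fastforce
  ultimately show ?case by (subst k_smooth.simps(2)) (intro exI[of _ ?D], simp)
qed

lemma smooth_on_UNIV: "subspace V \<Longrightarrow> U \<subseteq> V \<Longrightarrow> smooth_on V U f \<longleftrightarrow> smooth U f"
  unfolding smooth_on_def using k_smooth_UNIV by blast

lemma smooth_on_cong: "smooth_on V U f \<Longrightarrow> (\<And>x. x \<in> U \<Longrightarrow> f x = g x) \<Longrightarrow> smooth_on V U g"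
  unfolding smooth_on_def using k_smooth_cong by blast

lemma smooth_on_subset: "smooth_on V U f \<Longrightarrow> W \<subseteq> U \<Longrightarrow> smooth_on V W f"
  unfolding smooth_on_def using k_smooth_subset by blast

lemma smooth_on_continuous: "smooth_on V U f \<Longrightarrow> continuous_on U f"
  unfolding smooth_on_def using k_smooth_continuous by blast

lemma smooth_on_bounded_linear:
  "bounded_linear h \<Longrightarrow> smooth_on V U f \<Longrightarrow> smooth_on V U (\<lambda>x. h (f x))"
  unfolding smooth_on_def using k_smooth_bounded_linear by blast

lemma smooth_on_const: "smooth_on V U (\<lambda>x. c)"
  unfolding smooth_on_def using k_smooth_const by blast

lemma smooth_on_ident: "smooth_on V U (\<lambda>x. x)"
  unfolding smooth_on_def using k_smooth_ident by blast

lemma smooth_on_add: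
  "smooth_on V U f \<Longrightarrow> smooth_on V U g \<Longrightarrow> smooth_on V U (\<lambda>x. f x + g x)"
  unfolding smooth_on_def using k_smooth_add by blast

lemma smooth_on_minus: "smooth_on V U f \<Longrightarrow> smooth_on V U (\<lambda>x. - f x)"
  by (rule smooth_on_bounded_linear[OF bounded_linear_minus[OF bounded_linear_ident]])

lemma smooth_on_diff:
  "smooth_on V U f \<Longrightarrow> smooth_on V U g \<Longrightarrow> smooth_on V U (\<lambda>x. f x - g x)"
  using smooth_on_add[OF _ smooth_on_minus, of V U f g] by simp

lemma smooth_on_Pair:
  "smooth_on V U f \<Longrightarrow> smooth_on V U g \<Longrightarrow> smooth_on V U (\<lambda>x. (f x, g x))"
  unfolding smooth_on_def using k_smooth_Pair by blast

lemma smooth_on_mult: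
  fixes f g :: "'e::euclidean_space \<Rightarrow> real"
  shows "smooth_on V U f \<Longrightarrow> smooth_on V U g \<Longrightarrow> smooth_on V U (\<lambda>x. f x * g x)"
  unfolding smooth_on_def using k_smooth_bilinear[OF bounded_bilinear_mult] by blast

lemma smooth_on_compose:
  fixes f :: "'e::euclidean_space \<Rightarrow> 'f::euclidean_space"
  shows "smooth U f \<Longrightarrow> smooth W g \<Longrightarrow> f ` U \<subseteq> W \<Longrightarrow> smooth U (\<lambda>x. g (f x))"
  unfolding smooth_on_def using k_smooth_compose by blast

lemma smooth_on_glue_open:
  fixes f :: "'e::euclidean_space \<Rightarrow> 'f::real_normed_vector"
  assumes "open U" "\<And>x. x \<in> U \<Longrightarrow> \<exists>W. open W \<and> x \<in> W \<and> smooth (U \<inter> W) f"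
  shows "smooth U f"
  using assms k_smooth_glue_open unfolding smooth_on_def by metis

text \<open>Sets open in \<open>V\<close> pull back along \<open>proj V\<close> to open sets of the
  whole space. There the preceding gluing applies to \<open>f\<close> after \<open>proj V\<close>,
  and on \<open>U\<close> the projection is the identity.\<close>

lemma smooth_on_glue:
  fixes f :: "'e::euclidean_space \<Rightarrow> 'f::real_normed_vector"
  assumes V: "subspace V" and U: "openin (top_of_set V) U"
    and loc: "\<And>x. x \<in> U \<Longrightarrow> \<exists>W. openin (top_of_set V) W \<and> x \<in> W \<and> smooth (U \<inter> W) f"
  shows "smooth U f"
proof -
  have pre: "open (proj V -` W)" if "openin (top_of_set V) W" for W :: "'e set"
  proof -
    obtain T where T: "open T" "W = V \<inter> T" using \<open>openin (top_of_set V) W\<close> by (auto simp: openin_open)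
    then have "proj V -` W = proj V -` T" using proj_in[OF V] by auto
    then show ?thesis using T(1) bounded_linear_proj[OF V]
      by (simp add: linear_continuous_on open_vimage)
  qed
  have sp: "smooth A (proj V)" for A
    using smooth_on_bounded_linear[OF bounded_linear_proj[OF V] smooth_on_ident] .
  have "smooth (proj V -` U) (\<lambda>x. f (proj V x))"
  proof (rule smooth_on_glue_open[OF pre[OF U]])
    fix x assume "x \<in> proj V -` U"
    then obtain W where W: "openin (top_of_set V) W" "proj V x \<in> W" "smooth (U \<inter> W) f"
      using loc by blast
    show "\<exists>W. open W \<and> x \<in> W \<and> smooth (proj V -` U \<inter> W) (\<lambda>x. f (proj V x))"
      using W pre[OF W(1)] by (intro exI[of _ "proj V -` W"]) (auto intro!: smooth_on_compose[OF sp W(3)])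
  qed
  moreover have "U \<subseteq> proj V -` U" using openin_imp_subset[OF U] V by (auto simp: proj_id subset_iff)
  ultimately have "smooth U (\<lambda>x. f (proj V x))" using smooth_on_subset by blast
  then show ?thesis
    by (rule smooth_on_cong) (use openin_imp_subset[OF U] V in \<open>auto simp: proj_id subset_iff\<close>)
qed

section \<open>Frechet derivatives and the symmetry of second derivatives\<close>

abbreviation fderiv ("\<partial>") where "\<partial> f x v \<equiv> frechet_derivative f (at x) v"

lemma smooth_on_has_derivative:
  assumes "smooth U f" "open U" "x \<in> U"
  shows "(f has_derivative \<partial> f x) (at x)"
proof -
  have "k_smooth UNIV (Suc 0) U f" using assms(1) unfolding smooth_on_def by blast
  then obtain D where "(f has_derivative D) (at x within U)" using assms(3) by auto
  then show ?thesis using at_within_open[OF assms(3,2)]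
    by (metis frechet_derivative_at)
qed

lemma smooth_on_fderiv:
  assumes "smooth U f" "open U"
  shows "smooth U (\<lambda>x. \<partial> f x v)"
  unfolding smooth_on_def
proof
  fix k
  have "k_smooth UNIV (Suc k) U f" using assms(1) unfolding smooth_on_def by blast
  then obtain D where D: "\<And>x. x \<in> U \<Longrightarrow> (f has_derivative D x) (at x within U)"
    "k_smooth UNIV k U (\<lambda>x. D x v)" by auto
  then have "D x = \<partial> f x" if "x \<in> U" for x
    using that at_within_open[OF that assms(2)] frechet_derivative_at by metis
  then show "k_smooth UNIV k U (\<lambda>x. \<partial> f x v)"
    by (intro k_smooth_cong[OF D(2)]) simp
qed

lemma fderiv_eqI: "(f has_derivative D) (at x) \<Longrightarrow> \<partial> f x v = D v"
  by (metis frechet_derivative_at)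

lemma fderiv_cong:
  assumes "eventually (\<lambda>x. f x = g x) (nhds a)" "(f has_derivative D) (at a)"
  shows "(g has_derivative D) (at a)"
proof -
  obtain S where "open S" "a \<in> S" "\<forall>x\<in>S. f x = g x"
    using assms(1) by (auto simp: eventually_nhds)
  then show ?thesis using has_derivative_transform_within_open[OF assms(2)] by blast
qed

text \<open>The increment of \<open>f\<close> in direction \<open>w\<close> is an integral of the
  \<open>w\<close>-derivative. Differentiating this identity in direction \<open>v\<close> under the
  integral sign, and then in the upper limit at 0, produces one mixed derivative on each
  side.\<close>

lemma fderiv_commute:
  fixes f :: "'e::euclidean_space \<Rightarrow> 'f::euclidean_space"
  assumes sm: "smooth U f" and U: "open U" "x \<in> U"
  shows "\<partial> (\<lambda>z. \<partial> f z v) x w = \<partial> (\<lambda>z. \<partial> f z w) x v"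
proof -
  obtain r where r: "r > 0" "cball x r \<subseteq> U"
    using U open_contains_cball by blast
  \<comment> \<open>Chosen so that the parallelogram of all \<open>?p s t\<close> with
    \<open>\<bar>s\<bar>, \<bar>t\<bar> \<le> \<delta>\<close> stays in the closed ball; the summand
    1 avoids division by zero.\<close>
  define \<delta> where "\<delta> = r / (norm v + norm w + 1)"
  have d0: "\<delta> > 0" unfolding \<delta>_def using r(1) by (simp add: add_nonneg_pos)
  let ?p = "\<lambda>s t. x + s *\<^sub>R v + t *\<^sub>R w"
  have inU: "?p s t \<in> U" if "\<bar>s\<bar> \<le> \<delta>" "\<bar>t\<bar> \<le> \<delta>" for s t
  proof -
    have "norm (s *\<^sub>R v + t *\<^sub>R w) \<le> \<bar>s\<bar> * norm v + \<bar>t\<bar> * norm w"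
      by (metis norm_scaleR norm_triangle_ineq)
    also have "\<dots> \<le> \<delta> * norm v + \<delta> * norm w"
      using that by (intro add_mono mult_right_mono) auto
    also have "\<dots> \<le> \<delta> * (norm v + norm w + 1)" using d0 by (simp add: algebra_simps)
    also have "\<dots> = r" unfolding \<delta>_def by (simp add: add_nonneg_eq_0_iff add_nonneg_pos)
    finally have "dist x (?p s t) \<le> r" by (simp add: dist_norm norm_minus_commute add.assoc add.commute)
    then show ?thesis using r(2) by auto
  qed
  have der: "(g has_derivative \<partial> g y) (at y)" if "smooth U g" "y \<in> U" for g :: "'e \<Rightarrow> 'f" and y
    using smooth_on_has_derivative[OF that(1) U(1) that(2)] .
  have vs: "((\<lambda>s. g (?p s t)) has_vector_derivative \<partial> g (?p s t) v) (at s within S)"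
    if "smooth U g" "\<bar>s\<bar> \<le> \<delta>" "\<bar>t\<bar> \<le> \<delta>" for g :: "'e \<Rightarrow> 'f" and s t S
  proof -
    have "((\<lambda>s. ?p s t) has_derivative (\<lambda>h. h *\<^sub>R v)) (at s within S)"
      by (auto intro!: derivative_eq_intros)
    from has_derivative_compose[OF this der[OF that(1) inU[OF that(2,3)]]]
    show ?thesis unfolding has_vector_derivative_def
      using linear_scale[OF has_derivative_linear[OF der[OF that(1) inU[OF that(2,3)]]]] by (simp add: o_def)
  qed
  have vt: "((\<lambda>t. g (?p s t)) has_vector_derivative \<partial> g (?p s t) w) (at t within S)"
    if "smooth U g" "\<bar>s\<bar> \<le> \<delta>" "\<bar>t\<bar> \<le> \<delta>" for g :: "'e \<Rightarrow> 'f" and s t S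
  proof -
    have "((\<lambda>t. ?p s t) has_derivative (\<lambda>h. h *\<^sub>R w)) (at t within S)"
      by (auto intro!: derivative_eq_intros)
    from has_derivative_compose[OF this der[OF that(1) inU[OF that(2,3)]]]
    show ?thesis unfolding has_vector_derivative_def
      using linear_scale[OF has_derivative_linear[OF der[OF that(1) inU[OF that(2,3)]]]] by (simp add: o_def)
  qed
  let ?g = "\<lambda>z. \<partial> f z w" and ?h = "\<lambda>z. \<partial> f z v"
  have sg: "smooth U ?g" and sh: "smooth U ?h"
    using smooth_on_fderiv[OF sm U(1)] by auto
  have cont: "continuous_on ({-\<delta>..\<delta>} \<times> {0..\<delta>}) (\<lambda>(s, t). \<partial> ?g (?p s t) v)"
    unfolding split_beta
    by (rule continuous_on_compose2[OF smooth_on_continuous[OF smooth_on_fderiv[OF sg U(1)]]])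
       (auto intro!: continuous_intros inU)
  have FTC: "f (?p s t) - f (?p s 0) = integral {0..t} (\<lambda>\<tau>. ?g (?p s \<tau>))"
    if "\<bar>s\<bar> \<le> \<delta>" "0 \<le> t" "t \<le> \<delta>" for s t
    using fundamental_theorem_of_calculus[of 0 t "\<lambda>t. f (?p s t)" "\<lambda>\<tau>. ?g (?p s \<tau>)"]
      vt[OF sm that(1)] that by (simp add: integral_unique)
  have eq: "?h (?p 0 t) - ?h (?p 0 0) = integral {0..t} (\<lambda>\<tau>. \<partial> ?g (?p 0 \<tau>) v)"
    if t: "0 \<le> t" "t \<le> \<delta>" for t
  proof -
    have L: "((\<lambda>s. integral (cbox 0 t) (\<lambda>\<tau>. ?g (?p s \<tau>))) has_vector_derivative
        integral (cbox 0 t) (\<lambda>\<tau>. \<partial> ?g (?p 0 \<tau>) v)) (at 0 within {-\<delta>..\<delta>})"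
    proof (rule leibniz_rule_vector_derivative)
      show "((\<lambda>s. ?g (?p s \<tau>)) has_vector_derivative \<partial> ?g (?p s \<tau>) v) (at s within {-\<delta>..\<delta>})"
        if "s \<in> {-\<delta>..\<delta>}" "\<tau> \<in> cbox 0 t" for s \<tau>
        using that t by (intro vs sg) (auto simp: abs_le_iff)
      show "(\<lambda>\<tau>. ?g (?p s \<tau>)) integrable_on cbox 0 t" if "s \<in> {-\<delta>..\<delta>}" for s
      proof -
        have "continuous_on {0..t} (\<lambda>\<tau>. ?g (?p s \<tau>))"
          by (rule continuous_on_compose2[OF smooth_on_continuous[OF sg]])
            (use that t in \<open>auto intro!: continuous_intros inU\<close>)
        then show ?thesis by (simp add: integrable_continuous_interval)
      qed
      show "continuous_on ({-\<delta>..\<delta>} \<times> cbox 0 t) (\<lambda>(s, \<tau>). \<partial> ?g (?p s \<tau>) v)"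
        by (rule continuous_on_subset[OF cont]) (use t in auto)
    qed (use d0 in auto)
    have "((\<lambda>s. f (?p s t) - f (?p s 0)) has_vector_derivative ?h (?p 0 t) - ?h (?p 0 0)) (at 0 within {-\<delta>..\<delta>})"
      by (intro has_vector_derivative_diff vs sm) (use t d0 in auto)
    then have R: "((\<lambda>s. integral (cbox 0 t) (\<lambda>\<tau>. ?g (?p s \<tau>))) has_vector_derivative
        ?h (?p 0 t) - ?h (?p 0 0)) (at 0 within {-\<delta>..\<delta>})"
      by (rule has_vector_derivative_transform[rotated 2]) (use FTC t d0 in \<open>auto simp: abs_le_iff\<close>)
    show ?thesis
      by (rule vector_derivative_unique_within_closed_interval[unfolded box_real,
            OF _ _ R[unfolded box_real] L[unfolded box_real]]) (use d0 in auto)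
  qed
  \<comment> \<open>Both sides of \<open>eq\<close> are now differentiated in \<open>t\<close> at 0.
    Since \<open>eq\<close> holds for \<open>t \<ge> 0\<close> only, the derivatives are one-sided
    and are compared within \<open>{0..\<delta>}\<close>.\<close>
  have H: "((\<lambda>t. ?h (?p 0 t) - ?h (?p 0 0)) has_vector_derivative \<partial> ?h (?p 0 0) w) (at 0 within {0..\<delta>})"
    by (rule has_vector_derivative_eq_rhs[OF
          has_vector_derivative_diff[OF vt[OF sh] has_vector_derivative_const]]) (use d0 in auto)
  have A: "((\<lambda>t. integral {0..t} (\<lambda>\<tau>. \<partial> ?g (?p 0 \<tau>) v)) has_vector_derivative \<partial> ?h (?p 0 0) w) (at 0 within {0..\<delta>})"
    by (rule has_vector_derivative_transform[OF _ _ H]) (use eq[symmetric] d0 in auto)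
  have "continuous_on {0..\<delta>} (\<lambda>t. \<partial> ?g (?p 0 t) v)"
    by (rule continuous_on_compose2[OF smooth_on_continuous[OF smooth_on_fderiv[OF sg U(1)]]])
       (use d0 inU[of 0] in \<open>auto intro!: continuous_intros\<close>)
  from integral_has_vector_derivative[OF this, of 0]
  have "((\<lambda>t. integral {0..t} (\<lambda>\<tau>. \<partial> ?g (?p 0 \<tau>) v)) has_vector_derivative \<partial> ?g (?p 0 0) v) (at 0 within {0..\<delta>})"
    using d0 by simp
  from vector_derivative_unique_within_closed_interval[unfolded box_real, OF _ _ A this]
  have "\<partial> ?h (?p 0 0) w = \<partial> ?g (?p 0 0) v" using d0 by auto
  then show ?thesis by simp
qed

text \<open>Differentiation under the integral sign raises the exponent of the weight by one.\<close>

lemma k_smooth_radial_integral: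
  fixes f :: "'e::euclidean_space \<Rightarrow> real"
  assumes "smooth (ball 0 r) f"
  shows "k_smooth UNIV k (ball 0 r) (\<lambda>x. integral {0..1} (\<lambda>t. t ^ n * f (t *\<^sub>R x)))"
  using assms
proof (induction k arbitrary: n f)
  have inb: "t *\<^sub>R x \<in> ball 0 r" if "x \<in> ball 0 r" "t \<in> {0..1}" for t :: real and x :: 'e
  proof -
    have "\<bar>t\<bar> * norm x \<le> 1 * norm x" using that by (intro mult_right_mono) auto
    then show ?thesis using that by simp
  qed
  have deriv: "((\<lambda>x. integral {0..1} (\<lambda>t. t ^ n * f (t *\<^sub>R x))) has_derivative
      (\<lambda>v. integral {0..1} (\<lambda>t. t ^ Suc n * \<partial> f (t *\<^sub>R x) v))) (at x within ball 0 r)"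
    if sm: "smooth (ball 0 r) f" and x: "x \<in> ball 0 r" for n x and f :: "'e \<Rightarrow> real"
  proof -
    \<comment> \<open>\<open>leibniz_rule\<close> takes the derivative as a continuous map into the
      bounded linear maps; in finite dimension continuity can be checked on basis vectors.\<close>
    define F where "F z = Blinfun (\<partial> f z)" for z
    have hd: "(f has_derivative \<partial> f z) (at z)" if "z \<in> ball 0 r" for z
      using smooth_on_has_derivative[OF sm _ that] by simp
    have F: "blinfun_apply (F z) = \<partial> f z" if "z \<in> ball 0 r" for z
      unfolding F_def by (rule bounded_linear_Blinfun_apply[OF has_derivative_bounded_linear[OF hd[OF that]]])
    have cF: "continuous_on (ball 0 r) F"
    proof (rule continuous_on_blinfun_componentwise)
      fix i :: 'e
      have "continuous_on (ball 0 r) (\<lambda>z. \<partial> f z i)"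
        using smooth_on_continuous[OF smooth_on_fderiv[OF sm]] by simp
      then show "continuous_on (ball 0 r) (\<lambda>z. blinfun_apply (F z) i)"
        by (rule continuous_on_eq) (simp add: F)
    qed
    define G where "G x t = t ^ Suc n *\<^sub>R F (t *\<^sub>R x)" for x and t :: real
    have cG: "continuous_on (ball 0 r \<times> cbox 0 1) (\<lambda>(x, t). G x t)"
      unfolding G_def split_beta
      by (intro continuous_intros continuous_on_compose2[OF cF]) (use inb in auto)
    have "((\<lambda>x. integral (cbox 0 1) (\<lambda>t. t ^ n * f (t *\<^sub>R x))) has_derivative
        blinfun_apply (integral (cbox 0 1) (G x))) (at x within ball 0 r)"
    proof (rule leibniz_rule[OF _ _ cG x])
      fix y t assume y: "y \<in> ball (0::'e) r" "t \<in> cbox 0 (1::real)"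
      have "((\<lambda>y. t *\<^sub>R y) has_derivative (\<lambda>v. t *\<^sub>R v)) (at y within ball 0 r)"
        by (auto intro!: derivative_eq_intros)
      from has_derivative_compose[OF this hd] y inb[of y t]
      have "((\<lambda>y. f (t *\<^sub>R y)) has_derivative (\<lambda>v. \<partial> f (t *\<^sub>R y) (t *\<^sub>R v))) (at y within ball 0 r)"
        by (simp add: o_def)
      then have "((\<lambda>y. t ^ n * f (t *\<^sub>R y)) has_derivative (\<lambda>v. t ^ n * \<partial> f (t *\<^sub>R y) (t *\<^sub>R v))) (at y within ball 0 r)"
        by (rule has_derivative_mult_right)
      moreover have "linear (\<partial> f (t *\<^sub>R y))" using hd inb y has_derivative_linear by (metis cbox_interval)
      ultimately show "((\<lambda>y. t ^ n * f (t *\<^sub>R y)) has_derivative blinfun_apply (G y t)) (at y within ball 0 r)"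
        using F[of "t *\<^sub>R y"] inb[of y t] y unfolding G_def
        by (simp add: linear_scale scaleR_blinfun.rep_eq algebra_simps)
    next
      fix y :: 'e assume y: "y \<in> ball 0 r"
      have "continuous_on {0..1} (\<lambda>t. f (t *\<^sub>R y))"
        by (rule continuous_on_compose2[OF smooth_on_continuous[OF sm]])
          (use y inb in \<open>auto intro!: continuous_intros\<close>)
      then show "(\<lambda>t. t ^ n * f (t *\<^sub>R y)) integrable_on cbox 0 1"
        by (auto intro!: integrable_continuous_interval continuous_intros)
    qed simp
    moreover have "blinfun_apply (integral (cbox 0 1) (G x)) =
        (\<lambda>v. integral {0..1} (\<lambda>t. t ^ Suc n * \<partial> f (t *\<^sub>R x) v))"
    proof
      fix v
      have "continuous_on {0..1} (G x)"
        using continuous_on_compose2[OF cG continuous_on_Pair[OF continuous_on_const continuous_on_id], of x "{0..1}"] x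
        by (force simp: image_subset_iff)
      then have "G x integrable_on {0..1}" by (rule integrable_continuous_interval)
      then have "integral {0..1} ((\<lambda>g. blinfun_apply g v) \<circ> G x) = blinfun_apply (integral {0..1} (G x)) v"
        by (rule integral_linear) (rule blinfun.bounded_linear_left)
      moreover have "integral {0..1} ((\<lambda>g. blinfun_apply g v) \<circ> G x) = integral {0..1} (\<lambda>t. t ^ Suc n * \<partial> f (t *\<^sub>R x) v)"
        using F inb[OF x] by (intro integral_cong) (simp add: G_def scaleR_blinfun.rep_eq)
      ultimately show "blinfun_apply (integral (cbox 0 1) (G x)) v =
        integral {0..1} (\<lambda>t. t ^ Suc n * \<partial> f (t *\<^sub>R x) v)" by simp
    qed
    ultimately show ?thesis by (simp only: cbox_interval)
  qed
  {
    case 0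
    then show ?case
      unfolding k_smooth.simps continuous_on_eq_continuous_within
      using has_derivative_continuous[OF deriv[OF 0]] by blast
  next
    case (Suc k)
    have "k_smooth UNIV k (ball 0 r) (\<lambda>x. integral {0..1} (\<lambda>t. t ^ Suc n * \<partial> f (t *\<^sub>R x) v))" for v
      using Suc.IH[OF smooth_on_fderiv[OF Suc.prems]] by blast
    then show ?case
      using deriv[OF Suc.prems]
      by (subst k_smooth.simps(2)) (intro exI[of _ "\<lambda>x v. integral {0..1} (\<lambda>t. t ^ Suc n * \<partial> f (t *\<^sub>R x) v)"], simp)
  }
qed

text \<open>\<open>f x\<close> is the integral over \<open>{0..1}\<close> of the derivative of
  \<open>t \<mapsto> f (t x)\<close>. Expanding the direction \<open>x\<close> in the basis pulls
  the factors \<open>x \<bullet> b\<close> out, and the remaining radial integrals are smooth in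
  \<open>x\<close>.\<close>

lemma Hadamard:
  fixes f :: "'e::euclidean_space \<Rightarrow> real"
  assumes sm: "smooth (ball 0 r) f" and r: "r > 0" and "f 0 = 0"
  obtains g where "\<And>b. smooth (ball 0 r) (g b)" "\<And>b. g b 0 = \<partial> f 0 b"
    "\<And>x. x \<in> ball 0 r \<Longrightarrow> f x = (\<Sum>b\<in>Basis. (x \<bullet> b) * g b x)"
proof
  \<comment> \<open>The trivial weight \<open>t ^ 0\<close> brings the integrand into the form of
    \<open>k_smooth_radial_integral\<close>.\<close>
  let ?g = "\<lambda>b x. integral {0..1} (\<lambda>t. t ^ 0 * \<partial> f (t *\<^sub>R x) b)"
  show "smooth (ball 0 r) (?g b)" for b
    unfolding smooth_on_def using k_smooth_radial_integral[OF smooth_on_fderiv[OF sm]] by blast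
  show "?g b 0 = \<partial> f 0 b" for b by simp
  show "f x = (\<Sum>b\<in>Basis. (x \<bullet> b) * ?g b x)" if x: "x \<in> ball 0 r" for x
  proof -
    have inb: "t *\<^sub>R x \<in> ball 0 r" if "t \<in> {0..1}" for t :: real
    proof -
      have "\<bar>t\<bar> * norm x \<le> 1 * norm x" using that by (intro mult_right_mono) auto
      then show ?thesis using x by simp
    qed
    have hd: "(f has_derivative \<partial> f z) (at z)" if "z \<in> ball 0 r" for z
      using smooth_on_has_derivative[OF sm _ that] by simp
    have "((\<lambda>t. f (t *\<^sub>R x)) has_vector_derivative \<partial> f (t *\<^sub>R x) x) (at t within {0..1})"
      if "t \<in> {0..1}" for t
    proof -
      have "((\<lambda>t. t *\<^sub>R x) has_derivative (\<lambda>h. h *\<^sub>R x)) (at t within {0..1})"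
        by (auto intro!: derivative_eq_intros)
      from has_derivative_compose[OF this hd[OF inb[OF that]]]
      show ?thesis unfolding has_vector_derivative_def
        using linear_scale[OF has_derivative_linear[OF hd[OF inb[OF that]]]] by (simp add: o_def)
    qed
    then have "((\<lambda>t. \<partial> f (t *\<^sub>R x) x) has_integral f (1 *\<^sub>R x) - f (0 *\<^sub>R x)) {0..1}"
      by (intro fundamental_theorem_of_calculus) auto
    then have "f x = integral {0..1} (\<lambda>t. \<partial> f (t *\<^sub>R x) x)"
      using assms(3) by (simp add: integral_unique)
    also have "\<dots> = integral {0..1} (\<lambda>t. \<Sum>b\<in>Basis. (x \<bullet> b) *\<^sub>R \<partial> f (t *\<^sub>R x) b)"
    proof (rule integral_cong)
      fix t :: real assume "t \<in> {0..1}"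
      then have "linear (\<partial> f (t *\<^sub>R x))" using hd inb has_derivative_linear by blast
      then show "\<partial> f (t *\<^sub>R x) x = (\<Sum>b\<in>Basis. (x \<bullet> b) *\<^sub>R \<partial> f (t *\<^sub>R x) b)"
        by (subst (2) euclidean_representation[of x, symmetric])
           (simp add: linear_sum linear_scale del: euclidean_representation)
    qed
    also have "\<dots> = (\<Sum>b\<in>Basis. integral {0..1} (\<lambda>t. (x \<bullet> b) *\<^sub>R \<partial> f (t *\<^sub>R x) b))"
    proof (rule integral_sum)
      fix b :: 'e
      have "continuous_on {0..1} (\<lambda>t. \<partial> f (t *\<^sub>R x) b)"
        by (rule continuous_on_compose2[OF smooth_on_continuous[OF smooth_on_fderiv[OF sm]]])
          (use inb in \<open>auto intro!: continuous_intros\<close>)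
      then show "(\<lambda>t. (x \<bullet> b) *\<^sub>R \<partial> f (t *\<^sub>R x) b) integrable_on {0..1}"
        by (auto intro!: integrable_continuous_interval continuous_intros)
    qed simp
    finally show ?thesis by simp
  qed
qed

section \<open>Flat functions and bump functions\<close>

definition flat :: "nat \<Rightarrow> real \<Rightarrow> real" where
  "flat n t = (if t \<le> 0 then 0 else exp (- 1 / t) / t ^ n)"

lemma flat_tendsto: "((\<lambda>t. flat n t) \<longlongrightarrow> 0) (at 0)"
proof -
  have "((\<lambda>t::real. (inverse t) ^ n / exp (inverse t)) \<longlongrightarrow> 0) (at_right 0)"
    by (rule filterlim_compose[OF tendsto_power_div_exp_0 filterlim_inverse_at_top_right])
  then have "((\<lambda>t. flat n t) \<longlongrightarrow> 0) (at_right 0)"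
    by (rule Lim_transform_eventually)
       (auto simp: flat_def eventually_at_right_field exp_minus field_simps power_inverse intro: exI[of _ 1])
  moreover have "((\<lambda>t. flat n t) \<longlongrightarrow> 0) (at_left 0)"
    by (rule tendsto_eventually) (auto simp: flat_def eventually_at_left_field intro: exI[of _ "-1"])
  ultimately show ?thesis using filterlim_split_at by blast
qed

text \<open>The denominators \<open>t ^ n\<close> are part of the definition because they make the
  family closed under differentiation up to linear combinations. Smoothness of all members then
  follows by one induction on the order.\<close>

lemma flat_has_real_derivative:
  "(flat n has_real_derivative flat (n + 2) t - n * flat (n + 1) t) (at t)"
proof -
  consider "t < 0" | "t = 0" | "t > 0" by linarith
  then show ?thesis
  proof cases
    case 1
    have "((\<lambda>_. 0) has_real_derivative flat (n + 2) t - n * flat (n + 1) t) (at t)"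
      using 1 by (simp add: flat_def)
    then show ?thesis
      by (rule has_field_derivative_transform_within_open[where S="{..<0}"])
         (use 1 in \<open>auto simp: flat_def\<close>)
  next
    case 2
    \<comment> \<open>The difference quotient at 0 is itself a member of the family, so its limit is
      already known to be 0.\<close>
    have "(\<lambda>h. (flat n (0 + h) - flat n 0) / h) = flat (Suc n)"
      by (auto simp: flat_def fun_eq_iff field_simps)
    then have "(flat n has_real_derivative 0) (at 0)"
      using flat_tendsto[of "Suc n"] by (simp only: DERIV_def)
    then show ?thesis using 2 by (simp add: flat_def)
  next
    case 3
    have "((\<lambda>t. exp (- 1 / t) / t ^ n) has_real_derivative flat (n + 2) t - n * flat (n + 1) t) (at t)"
    proof (cases n)
      case 0
      show ?thesis unfolding 0 using 3
        by (auto intro!: derivative_eq_intros simp: flat_def field_simps power2_eq_square)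
    next
      case (Suc m)
      have "m = 0 \<or> t ^ m = t * t ^ (m - Suc 0)" by (cases m) auto
      then show ?thesis unfolding Suc using 3
        by (auto intro!: derivative_eq_intros simp: flat_def field_simps power2_eq_square)
    qed
    then show ?thesis
      by (rule has_field_derivative_transform_within_open[where S="{0<..}"])
         (use 3 in \<open>auto simp: flat_def\<close>)
  qed
qed

lemma smooth_flat: "smooth U (flat n)"
proof -
  have "k_smooth UNIV k U (flat n)" for k
  proof (induction k arbitrary: n)
    case 0
    show ?case unfolding k_smooth.simps
      by (meson DERIV_isCont continuous_at_imp_continuous_on flat_has_real_derivative)
  next
    case (Suc k)
    have "k_smooth UNIV k U (\<lambda>t. (flat (n + 2) t - n * flat (n + 1) t) * v)" for v
    proof -
      have 1: "k_smooth UNIV k U (\<lambda>t. flat (n + 2) t * v)"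
        by (rule k_smooth_bounded_linear[OF bounded_linear_mult_left]) (rule Suc.IH)
      have 2: "k_smooth UNIV k U (\<lambda>t. flat (n + 1) t * (- n * v))"
        by (rule k_smooth_bounded_linear[OF bounded_linear_mult_left]) (rule Suc.IH)
      show ?thesis using k_smooth_add[OF 1 2] by (simp add: algebra_simps)
    qed
    moreover have "(flat n has_derivative (\<lambda>v. (flat (n + 2) t - n * flat (n + 1) t) * v)) (at t within U)" for t
      using flat_has_real_derivative[of n t] has_derivative_at_withinI
      unfolding has_field_derivative_def by blast
    ultimately show ?case
      by (subst k_smooth.simps(2))
         (intro exI[of _ "\<lambda>t v. (flat (n + 2) t - n * flat (n + 1) t) * v"], simp)
  qed
  then show ?thesis unfolding smooth_on_def by blast
qed

text \<open>One flat function is nested in another. For \<open>norm x \<le> r / 2\<close> the inner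
  one vanishes and the outer is evaluated at 1, whence the factor \<open>inverse (flat 0 1)\<close>.
  The constant \<open>K\<close> makes the inner term equal to 1 at \<open>norm x = r\<close>; beyond
  that radius the outer argument is at most 0.\<close>

lemma ex_bump:
  assumes "r > 0"
  obtains \<beta> :: "'e::euclidean_space \<Rightarrow> real" and s where "smooth UNIV \<beta>" "0 < s" "s < r"
    "\<And>x. norm x \<le> s \<Longrightarrow> \<beta> x = 1" "\<And>x. norm x \<ge> r \<Longrightarrow> \<beta> x = 0"
proof
  define a where "a = (r / 2)\<^sup>2"
  define K where "K = inverse (flat 0 (r\<^sup>2 - a))"
  define \<beta> where "\<beta> x = inverse (flat 0 1) * flat 0 (1 - K * flat 0 (x \<bullet> x - a))" for x :: 'e
  have a: "0 < a" "a < r\<^sup>2" using assms by (auto simp: a_def power_divide)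
  then have K: "K > 0" by (simp add: K_def flat_def)
  have sq: "smooth UNIV (\<lambda>x::'e. x \<bullet> x - a)"
  proof -
    have "smooth UNIV (\<lambda>x::'e. x \<bullet> x)"
      unfolding smooth_on_def using k_smooth_bilinear[OF bounded_bilinear_inner k_smooth_ident k_smooth_ident] by blast
    then show ?thesis by (rule smooth_on_diff) (rule smooth_on_const)
  qed
  have "smooth UNIV (\<lambda>x::'e. 1 - K * flat 0 (x \<bullet> x - a))"
    by (intro smooth_on_diff smooth_on_mult smooth_on_const smooth_on_compose[OF sq smooth_flat[of UNIV 0]]) simp
  then show "smooth UNIV \<beta>" unfolding \<beta>_def
    by (intro smooth_on_mult smooth_on_const smooth_on_compose[OF _ smooth_flat]) auto
  show "0 < r / 2" "r / 2 < r" using assms by auto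
  show "\<beta> x = 1" if "norm x \<le> r / 2" for x
  proof -
    have "x \<bullet> x \<le> a" unfolding a_def power2_norm_eq_inner[symmetric] using that by (simp add: power_mono)
    then show ?thesis by (simp add: \<beta>_def flat_def)
  qed
  show "\<beta> x = 0" if "norm x \<ge> r" for x
  proof -
    have ge: "x \<bullet> x \<ge> r\<^sup>2" unfolding power2_norm_eq_inner[symmetric] using that assms by (simp add: power_mono)
    have "flat 0 (r\<^sup>2 - a) \<le> flat 0 (x \<bullet> x - a)"
      using ge a by (auto simp: flat_def field_simps)
    then have "K * flat 0 (x \<bullet> x - a) \<ge> K * flat 0 (r\<^sup>2 - a)" using K by simp
    also have "K * flat 0 (r\<^sup>2 - a) = 1" using a by (simp add: K_def flat_def)
    finally show ?thesis by (simp add: \<beta>_def flat_def)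
  qed
qed

text \<open>A Gronwall argument: the squared norm \<open>g\<close> of the system satisfies
  \<open>g' t \<le> K * g t\<close>, so \<open>g t * exp (- K * t)\<close> does not increase from
  its value 0.\<close>

lemma linear_ode_zero:
  fixes u :: "'i \<Rightarrow> real \<Rightarrow> 'f::real_inner"
  assumes I: "finite I"
    and der: "\<And>i t. i \<in> I \<Longrightarrow> t \<in> {0..1} \<Longrightarrow> (u i has_vector_derivative u' i t) (at t within {0..1})"
    and bd: "\<And>i t. i \<in> I \<Longrightarrow> t \<in> {0..1} \<Longrightarrow> norm (u' i t) \<le> C * (\<Sum>j\<in>I. norm (u j t))"
    and zero: "\<And>i. i \<in> I \<Longrightarrow> u i 0 = 0"
    and i: "i \<in> I"
  shows "u i 1 = 0"
proof -
  define N where "N t = (\<Sum>j\<in>I. norm (u j t))" for t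
  define g where "g t = (\<Sum>j\<in>I. u j t \<bullet> u j t)" for t
  define g' where "g' t = (\<Sum>j\<in>I. 2 * (u j t \<bullet> u' j t))" for t
  \<comment> \<open>The 2 comes from differentiating the squares, \<open>card I\<close> from
    bounding the square of a sum by the sum of squares. The sign of \<open>C\<close> is not known,
    hence the absolute value.\<close>
  define K where "K = 2 * \<bar>C\<bar> * card I"
  have g': "(g has_real_derivative g' t) (at t within {0..1})" if "t \<in> {0..1}" for t
    unfolding g_def g'_def has_field_derivative_def
    using der[OF _ that] unfolding has_vector_derivative_def
    by (auto intro!: derivative_eq_intros simp: sum_distrib_left sum_distrib_right inner_commute algebra_simps)
  have le: "g' t \<le> K * g t" if t: "t \<in> {0..1}" for t
  proof -
    have "g' t \<le> (\<Sum>j\<in>I. 2 * (norm (u j t) * (\<bar>C\<bar> * N t)))"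
      unfolding g'_def
    proof (rule sum_mono)
      fix j assume j: "j \<in> I"
      have "C * N t \<le> \<bar>C\<bar> * N t" unfolding N_def by (intro mult_right_mono sum_nonneg) auto
      then have "norm (u' j t) \<le> \<bar>C\<bar> * N t" using bd[OF j t] by (simp add: N_def)
      then show "2 * (u j t \<bullet> u' j t) \<le> 2 * (norm (u j t) * (\<bar>C\<bar> * N t))"
        using norm_cauchy_schwarz[of "u j t" "u' j t"]
        by (smt (verit) mult_left_mono norm_ge_zero)
    qed
    also have "\<dots> = 2 * \<bar>C\<bar> * (N t)\<^sup>2"
      by (simp add: N_def sum_distrib_left sum_distrib_right power2_eq_square algebra_simps)
    also have "\<dots> \<le> 2 * \<bar>C\<bar> * ((\<Sum>j\<in>I. (norm (u j t))\<^sup>2) * card I)"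
      unfolding N_def by (intro mult_left_mono sum_squared_le_sum_of_squares) (auto simp: I)
    also have "\<dots> = K * g t" by (simp add: K_def g_def power2_norm_eq_inner)
    finally show ?thesis .
  qed
  define h where "h t = g t * exp (- K * t)" for t
  have "(h has_derivative (\<lambda>x. x * ((g' t - K * g t) * exp (- K * t)))) (at t within {0..1})" if "t \<in> {0..1}" for t
    using g'[OF that] unfolding h_def has_field_derivative_def
    by (auto intro!: derivative_eq_intros simp: algebra_simps)
  from mvt_simple[OF zero_less_one, of h, OF this]
  obtain t where t: "t \<in> {0<..<1}" "h 1 - h 0 = (1 - 0) * ((g' t - K * g t) * exp (- K * t))" by auto
  then have "h 1 \<le> h 0" using le[of t] mult_nonpos_nonneg[of "g' t - K * g t" "exp (- K * t)"] by simp
  also have "h 0 = 0" by (simp add: h_def g_def zero)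
  finally have "g 1 \<le> 0" by (simp add: h_def mult_le_0_iff)
  moreover have "g 1 \<ge> u i 1 \<bullet> u i 1"
    unfolding g_def using member_le_sum[of i I "\<lambda>j. u j 1 \<bullet> u j 1"] I i by simp
  ultimately show ?thesis by (metis inner_ge_zero inner_eq_zero_iff order_antisym order_trans)
qed

section \<open>Derivatives along curves and relative to a subspace\<close>

lemma eventually_isCont_open:
  assumes "isCont f a" "open U" "f a \<in> U"
  shows "\<forall>\<^sub>F x in nhds a. f x \<in> U"
  using assms topological_tendstoD[of f "f a" "nhds a" U]
  by (simp add: isCont_def tendsto_at_iff_tendsto_nhds)

lemma has_derivative_along_curve:
  assumes "(\<gamma> has_vector_derivative v) (at t within S)" "(f has_derivative D) (at (\<gamma> t))"
  shows "((\<lambda>t. f (\<gamma> t)) has_vector_derivative D v) (at t within S)"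
proof -
  have "((\<lambda>t. f (\<gamma> t)) has_derivative (\<lambda>h. D (h *\<^sub>R v))) (at t within S)"
    using has_derivative_compose assms unfolding has_vector_derivative_def by blast
  then show ?thesis unfolding has_vector_derivative_def
    using linear_scale[OF has_derivative_linear[OF assms(2)]] by simp
qed

lemma has_vector_derivative_line:
  "((\<lambda>t. a + (t - t0) *\<^sub>R v) has_vector_derivative v) (at t within S)"
  unfolding has_vector_derivative_def by (auto intro!: derivative_eq_intros)

text \<open>The line through \<open>a\<close> in direction \<open>v\<close> stays in
  \<open>V\<close>, where the functions agree. Group identities in coordinates hold only on
  \<open>V\<close>, so their derivatives can be compared only in directions of
  \<open>V\<close>.\<close>

lemma derivative_eq_on_subspace:
  assumes V: "subspace V" "a \<in> V" "v \<in> V"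
    and f: "(f has_derivative D) (at a)" and g: "(g has_derivative E) (at a)"
    and eq: "\<forall>\<^sub>F x in nhds a. x \<in> V \<longrightarrow> f x = g x"
  shows "D v = E v"
proof -
  let ?\<gamma> = "\<lambda>t. a + (t - 0) *\<^sub>R v"
  have 1: "((\<lambda>t. f (?\<gamma> t)) has_vector_derivative D v) (at 0)"
    by (rule has_derivative_along_curve[OF has_vector_derivative_line]) (use f in simp)
  have 2: "((\<lambda>t. g (?\<gamma> t)) has_vector_derivative E v) (at 0)"
    by (rule has_derivative_along_curve[OF has_vector_derivative_line]) (use g in simp)
  obtain S where S: "open S" "a \<in> S" "\<And>x. x \<in> S \<Longrightarrow> x \<in> V \<Longrightarrow> f x = g x"
    using eq by (auto simp: eventually_nhds)
  have "isCont ?\<gamma> 0" by (intro continuous_intros)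
  then have "\<forall>\<^sub>F t in nhds 0. ?\<gamma> t \<in> S"
    by (rule eventually_isCont_open) (use S in auto)
  then obtain T where T: "open T" "0 \<in> T" "\<And>t. t \<in> T \<Longrightarrow> ?\<gamma> t \<in> S"
    by (auto simp: eventually_nhds)
  have "((\<lambda>t. g (?\<gamma> t)) has_vector_derivative D v) (at 0)"
    by (rule has_vector_derivative_transform_within_open[OF 1 T(1,2)])
       (use S(3) T(3) V in \<open>auto intro: subspace_add subspace_scale\<close>)
  with 2 show ?thesis using vector_derivative_unique_at by blast
qed

text \<open>Near \<open>a\<close> the function equals \<open>proj V\<close> after \<open>f\<close>,
  so by uniqueness of the derivative \<open>proj V\<close> fixes the values of
  \<open>D\<close>.\<close>

lemma derivative_in_subspace:
  fixes f :: "'a::real_normed_vector \<Rightarrow> 'b::euclidean_space"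
  assumes V: "subspace V" and f: "(f has_derivative D) (at a)" and ev: "\<forall>\<^sub>F x in nhds a. f x \<in> V"
  shows "D v \<in> V"
proof -
  have "((\<lambda>x. proj V (f x)) has_derivative (\<lambda>h. proj V (D h))) (at a)"
    using bounded_linear.has_derivative[OF bounded_linear_proj[OF V] f] .
  then have "(f has_derivative (\<lambda>h. proj V (D h))) (at a)"
    by (rule fderiv_cong[rotated]) (use ev V in \<open>auto elim!: eventually_mono simp: proj_id\<close>)
  from fun_cong[OF has_derivative_unique[OF this f]] have "proj V (D v) = D v" by simp
  then show ?thesis using proj_in[OF V] by metis
qed

lemma linear_Basis_sum:
  fixes f :: "'a::euclidean_space \<Rightarrow> 'b::real_vector"
  assumes "linear f" shows "f x = (\<Sum>b\<in>Basis. (x \<bullet> b) *\<^sub>R f b)"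
proof -
  have "f (\<Sum>b\<in>Basis. (x \<bullet> b) *\<^sub>R b) = (\<Sum>b\<in>Basis. (x \<bullet> b) *\<^sub>R f b)"
    by (simp add: linear_sum[OF assms] linear_scale[OF assms] del: euclidean_representation)
  then show ?thesis unfolding euclidean_representation .
qed

subsection \<open>Local groups in coordinates\<close>

text \<open>
  \<open>\<psi>\<close> is a parametrisation, near 0 in the subspace \<open>V\<close>, of a neighbourhood of the identity.
  The coordinate expressions \<open>M\<close> and \<open>I\<close> of multiplication and inversion are extended to
  neighbourhoods in the whole space so that ordinary derivatives can be used.
\<close>

locale local_group = group G for G :: "'a monoid" (structure) +
  fixes V :: "'s::euclidean_space set" and \<Omega> :: "'s set" and \<psi> :: "'s \<Rightarrow> 'a"
    and M :: "'s \<times> 's \<Rightarrow> 's" and DM :: "('s \<times> 's) set"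
    and I :: "'s \<Rightarrow> 's" and DI :: "'s set"
  assumes V: "subspace V"
    and open_\<Omega>: "open \<Omega>" and zero_\<Omega>: "0 \<in> \<Omega>"
    and \<psi>_closed: "\<psi> x \<in> carrier G" and \<psi>_zero: "\<psi> 0 = \<one>"
    and \<psi>_inj: "x \<in> V \<inter> \<Omega> \<Longrightarrow> y \<in> V \<inter> \<Omega> \<Longrightarrow> \<psi> x = \<psi> y \<Longrightarrow> x = y"
    and open_DM: "open DM" and zero_DM: "(0, 0) \<in> DM" and smooth_M: "smooth DM M"
    and M_in: "(x, y) \<in> DM \<Longrightarrow> M (x, y) \<in> V \<inter> \<Omega>"
    and \<psi>_M: "(x, y) \<in> DM \<Longrightarrow> \<psi> (M (x, y)) = \<psi> x \<otimes> \<psi> y"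
    and open_DI: "open DI" and zero_DI: "0 \<in> DI" and smooth_I: "smooth DI I"
    and I_in: "x \<in> DI \<Longrightarrow> I x \<in> V \<inter> \<Omega>"
    and \<psi>_I: "x \<in> DI \<Longrightarrow> \<psi> (I x) = inv (\<psi> x)"
begin

lemmas V0 = subspace_0[OF V]

lemma M_deriv: "p \<in> DM \<Longrightarrow> (M has_derivative \<partial> M p) (at p)"
  by (rule smooth_on_has_derivative[OF smooth_M open_DM])

lemma I_deriv: "p \<in> DI \<Longrightarrow> (I has_derivative \<partial> I p) (at p)"
  by (rule smooth_on_has_derivative[OF smooth_I open_DI])

lemma I_cont: "p \<in> DI \<Longrightarrow> isCont I p"
  using I_deriv has_derivative_continuous by blast

text \<open>This is the pattern for all identities in coordinates: apply \<open>\<psi>\<close>,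
  compute in the group, and return by injectivity of \<open>\<psi>\<close> on
  \<open>V \<inter> \<Omega>\<close>. Hence both sides must be known to lie in that set.\<close>

lemma M_right_zero: "x \<in> V \<inter> \<Omega> \<Longrightarrow> (x, 0) \<in> DM \<Longrightarrow> M (x, 0) = x"
  using \<psi>_M M_in \<psi>_inj \<psi>_closed \<psi>_zero by (metis r_one)

lemma M_left_zero: "x \<in> V \<inter> \<Omega> \<Longrightarrow> (0, x) \<in> DM \<Longrightarrow> M (0, x) = x"
  using \<psi>_M M_in \<psi>_inj \<psi>_closed \<psi>_zero by (metis l_one)

lemma M_zero: "M (0, 0) = 0"
  using M_right_zero zero_DM V0 zero_\<Omega> by blast

lemma I_zero: "I 0 = 0"
  using \<psi>_I[OF zero_DI] I_in[OF zero_DI] \<psi>_inj V0 zero_\<Omega> by (metis IntI \<psi>_zero inv_one)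

lemma isCont_slice1: "isCont (\<lambda>x. (x, y)) x" and isCont_slice2: "isCont (\<lambda>x. (y, x)) x"
  by (intro continuous_intros)+

lemma deriv_slice1: "((\<lambda>x. (x, y)) has_derivative (\<lambda>v. (v, 0))) (at x)"
  and deriv_slice2: "((\<lambda>x. (y, x)) has_derivative (\<lambda>v. (0, v))) (at x)"
  by (auto intro!: derivative_eq_intros)

lemma M_deriv1: "(x, y) \<in> DM \<Longrightarrow> ((\<lambda>x. M (x, y)) has_derivative (\<lambda>v. \<partial> M (x, y) (v, 0))) (at x)"
  using has_derivative_compose[OF deriv_slice1 M_deriv] .

lemma M_deriv2: "(x, y) \<in> DM \<Longrightarrow> ((\<lambda>y. M (x, y)) has_derivative (\<lambda>v. \<partial> M (x, y) (0, v))) (at y)"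
  using has_derivative_compose[OF deriv_slice2 M_deriv] .

lemma ev_DM1: "(x, y) \<in> DM \<Longrightarrow> \<forall>\<^sub>F z in nhds x. (z, y) \<in> DM"
  by (rule eventually_isCont_open[OF isCont_slice1 open_DM])

lemma ev_DM2: "(x, y) \<in> DM \<Longrightarrow> \<forall>\<^sub>F z in nhds y. (x, z) \<in> DM"
  by (rule eventually_isCont_open[OF isCont_slice2 open_DM])

lemma ev_\<Omega>: "x \<in> \<Omega> \<Longrightarrow> \<forall>\<^sub>F z in nhds x. z \<in> \<Omega>"
  using open_\<Omega> by (rule eventually_nhds_in_open)

text \<open>The partial derivatives come from the unit laws. These hold for points of
  \<open>V\<close> only, which restricts \<open>a\<close> and \<open>b\<close> to
  \<open>V\<close>.\<close>

lemma dM_zero: assumes "a \<in> V" "b \<in> V" shows "\<partial> M (0, 0) (a, b) = a + b"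
proof -
  have 1: "\<partial> M (0, 0) (a, 0) = a"
    by (rule derivative_eq_on_subspace[OF V V0 assms(1) M_deriv1[OF zero_DM] has_derivative_ident])
       (use ev_DM1[OF zero_DM] ev_\<Omega>[OF zero_\<Omega>] in eventually_elim, use M_right_zero in blast)
  have 2: "\<partial> M (0, 0) (0, b) = b"
    by (rule derivative_eq_on_subspace[OF V V0 assms(2) M_deriv2[OF zero_DM] has_derivative_ident])
       (use ev_DM2[OF zero_DM] ev_\<Omega>[OF zero_\<Omega>] in eventually_elim, use M_left_zero in blast)
  have "\<partial> M (0, 0) ((a, 0) + (0, b)) = \<partial> M (0, 0) (a, 0) + \<partial> M (0, 0) (0, b)"
    using linear_add[OF has_derivative_linear[OF M_deriv[OF zero_DM]]] .
  then show ?thesis using 1 2 by simp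
qed

section \<open>Conjugation and the adjoint representation in coordinates\<close>

definition \<kappa> :: "'s \<times> 's \<Rightarrow> 's" where "\<kappa> p = M (M p, I (fst p))"

definition DK where "DK = {p \<in> DM. fst p \<in> DI \<and> (M p, I (fst p)) \<in> DM}"

lemma \<psi>_\<kappa>: "(x, y) \<in> DK \<Longrightarrow> \<psi> (\<kappa> (x, y)) = \<psi> x \<otimes> \<psi> y \<otimes> inv (\<psi> x)"
  by (simp add: \<kappa>_def DK_def \<psi>_M \<psi>_I)

lemma \<kappa>_in: "p \<in> DK \<Longrightarrow> \<kappa> p \<in> V \<inter> \<Omega>"
  unfolding \<kappa>_def DK_def using M_in by blast

lemma zero_DK: "(0, 0) \<in> DK"
  by (simp add: DK_def zero_DM zero_DI M_zero I_zero)

lemma open_DK: "open DK"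
proof -
  have "open (DM \<inter> fst -` DI)" using open_DM open_DI by (simp add: open_Int open_vimage_fst)
  moreover have "continuous_on (DM \<inter> fst -` DI) (\<lambda>p. (M p, I (fst p)))"
    by (intro continuous_on_Pair continuous_on_subset[OF smooth_on_continuous[OF smooth_M]]
          continuous_on_compose2[OF smooth_on_continuous[OF smooth_I]] continuous_intros) auto
  ultimately have "open ((DM \<inter> fst -` DI) \<inter> (\<lambda>p. (M p, I (fst p))) -` DM)"
    using open_DM continuous_open_preimage by blast
  also have "(DM \<inter> fst -` DI) \<inter> (\<lambda>p. (M p, I (fst p))) -` DM = DK"
    by (auto simp: DK_def)
  finally show ?thesis .
qed

lemma smooth_\<kappa>: "smooth DK \<kappa>"
  unfolding \<kappa>_def
  by (rule smooth_on_compose[OF smooth_on_Pair[OF smooth_on_subset[OF smooth_M]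
          smooth_on_compose[OF smooth_on_bounded_linear[OF bounded_linear_fst smooth_on_ident] smooth_I]] smooth_M])
     (auto simp: DK_def)

lemma \<kappa>_deriv: "p \<in> DK \<Longrightarrow> (\<kappa> has_derivative \<partial> \<kappa> p) (at p)"
  by (rule smooth_on_has_derivative[OF smooth_\<kappa> open_DK])

lemma \<kappa>_zero: "(x, 0) \<in> DK \<Longrightarrow> \<kappa> (x, 0) = 0"
  using \<psi>_\<kappa>[of x 0] \<kappa>_in[of "(x, 0)"] \<psi>_inj[of "\<kappa> (x, 0)" 0] V0 zero_\<Omega>
  by (simp add: \<psi>_zero \<psi>_closed)

definition "X0 = {x. (x, 0) \<in> DK}"

definition "Ad x v = \<partial> \<kappa> (x, 0) (0, v)"

lemma open_X0: "open X0"
proof -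
  have "X0 = (\<lambda>x. (x, 0)) -` DK" by (auto simp: X0_def)
  then show ?thesis using open_DK by (simp add: open_vimage continuous_on_Pair)
qed

lemma zero_X0: "0 \<in> X0" by (simp add: X0_def zero_DK)

lemma \<kappa>_deriv2: "x \<in> X0 \<Longrightarrow> ((\<lambda>y. \<kappa> (x, y)) has_derivative Ad x) (at 0)"
  unfolding X0_def Ad_def using has_derivative_compose[OF deriv_slice2 \<kappa>_deriv] by auto

lemma linear_Ad: "x \<in> X0 \<Longrightarrow> linear (Ad x)"
  using \<kappa>_deriv2 has_derivative_linear by blast

lemma ev_DK2: "(x, y) \<in> DK \<Longrightarrow> \<forall>\<^sub>F z in nhds y. (x, z) \<in> DK"
  by (rule eventually_isCont_open[OF isCont_slice2 open_DK])

lemma Ad_in: assumes "x \<in> X0" shows "Ad x v \<in> V"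
proof (rule derivative_in_subspace[OF V \<kappa>_deriv2[OF assms]])
  have "\<forall>\<^sub>F y in nhds 0. (x, y) \<in> DK" using ev_DK2 assms by (simp add: X0_def)
  then show "\<forall>\<^sub>F y in nhds 0. \<kappa> (x, y) \<in> V"
    by eventually_elim (use \<kappa>_in in blast)
qed

lemma Ad_zero: assumes "v \<in> V" shows "Ad 0 v = v"
proof (rule derivative_eq_on_subspace[OF V V0 assms \<kappa>_deriv2[OF zero_X0] has_derivative_ident])
  show "\<forall>\<^sub>F x in nhds 0. x \<in> V \<longrightarrow> \<kappa> (0, x) = x"
    using ev_DK2[OF zero_DK] ev_\<Omega>[OF zero_\<Omega>]
  proof eventually_elim
    case (elim x)
    then show ?case using \<psi>_\<kappa>[of 0 x] \<kappa>_in[of "(0, x)"] \<psi>_inj[of "\<kappa> (0, x)" x]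
      by (simp add: \<psi>_zero \<psi>_closed)
  qed
qed

lemma smooth_Ad: "smooth X0 (\<lambda>x. Ad x v)"
  unfolding Ad_def
  by (rule smooth_on_compose[OF smooth_on_Pair[OF smooth_on_ident smooth_on_const]
        smooth_on_fderiv[OF smooth_\<kappa> open_DK]]) (auto simp: X0_def)

lemma Ad_deriv: "x \<in> X0 \<Longrightarrow> ((\<lambda>x. Ad x v) has_derivative \<partial> (\<lambda>x. Ad x v) x) (at x)"
  by (rule smooth_on_has_derivative[OF smooth_Ad open_X0])

definition "ad w v = \<partial> (\<lambda>z. Ad z v) 0 w"

text \<open>Conjugation by a product is the composition of the conjugations; the chain rule at the
  identity, a fixed point of both, gives the claim.\<close>

lemma Ad_mult:
  assumes x: "(x, 0) \<in> DK" "(x, z) \<in> DM" "M (x, z) \<in> X0" "z \<in> X0"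
  shows "Ad (M (x, z)) v = Ad x (Ad z v)"
proof -
  have \<kappa>z: "\<kappa> (z, 0) = 0" using x \<kappa>_zero by (simp add: X0_def)
  have "((\<lambda>y. \<kappa> (x, \<kappa> (z, y))) has_derivative (\<lambda>v. Ad x (Ad z v))) (at 0)"
    using has_derivative_compose[OF \<kappa>_deriv2[OF x(4)], of "\<lambda>y. \<kappa> (x, y)" "Ad x"] \<kappa>_deriv2[of x] x(1) \<kappa>z
    by (simp add: X0_def)
  moreover have "\<forall>\<^sub>F y in nhds 0. \<kappa> (x, \<kappa> (z, y)) = \<kappa> (M (x, z), y)"
  proof -
    have "isCont (\<lambda>y. (x, \<kappa> (z, y))) 0"
      using has_derivative_continuous[OF \<kappa>_deriv2[OF x(4)]] by (intro continuous_intros)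
    from eventually_isCont_open[OF this open_DK] have "\<forall>\<^sub>F y in nhds 0. (x, \<kappa> (z, y)) \<in> DK"
      using x(1) \<kappa>z by simp
    moreover have "\<forall>\<^sub>F y in nhds 0. (z, y) \<in> DK" "\<forall>\<^sub>F y in nhds 0. (M (x, z), y) \<in> DK"
      using ev_DK2 x(3,4) by (auto simp: X0_def)
    ultimately show ?thesis
    proof eventually_elim
      case (elim y)
      have "\<psi> (\<kappa> (x, \<kappa> (z, y))) = \<psi> (\<kappa> (M (x, z), y))"
        using elim x(2) by (simp add: \<psi>_\<kappa> \<psi>_M \<psi>_closed m_assoc inv_mult_group)
      then show ?case using \<psi>_inj \<kappa>_in elim by blast
    qed
  qed
  ultimately have "((\<lambda>y. \<kappa> (M (x, z), y)) has_derivative (\<lambda>v. Ad x (Ad z v))) (at 0)"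
    by (rule fderiv_cong[rotated])
  from fun_cong[OF has_derivative_unique[OF this \<kappa>_deriv2[OF x(3)]]] show ?thesis by simp
qed

text \<open>The points at which \<open>Ad\<close> is defined and at which, in addition, left
  translation by the inverse can be expressed in coordinates near \<open>x\<close> and carries
  \<open>x\<close> to 0.\<close>

definition "X1 = {x \<in> X0. x \<in> \<Omega> \<and> (x, 0) \<in> DM \<and> (I x, x) \<in> DM}"

lemma X1_D: "x \<in> X1 \<Longrightarrow> x \<in> X0 \<and> x \<in> \<Omega> \<and> x \<in> DI \<and> (x, 0) \<in> DM \<and> (I x, x) \<in> DM"
  by (auto simp: X1_def X0_def DK_def)

lemma zero_X1: "0 \<in> X1"
  by (simp add: X1_def zero_X0 zero_\<Omega> zero_DM I_zero)

lemma open_X1: "open X1"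
proof -
  have "open (X0 \<inter> \<Omega> \<inter> (\<lambda>x. (x, 0)) -` DM \<inter> DI)"
    using open_X0 open_\<Omega> open_DM open_DI
    by (intro open_Int open_vimage) (auto intro!: continuous_intros)
  moreover have "continuous_on (X0 \<inter> \<Omega> \<inter> (\<lambda>x. (x, 0)) -` DM \<inter> DI) (\<lambda>x. (I x, x))"
    by (intro continuous_on_Pair continuous_on_subset[OF smooth_on_continuous[OF smooth_I]] continuous_intros) auto
  ultimately have "open ((X0 \<inter> \<Omega> \<inter> (\<lambda>x. (x, 0)) -` DM \<inter> DI) \<inter> (\<lambda>x. (I x, x)) -` DM)"
    using open_DM continuous_open_preimage by blast
  moreover have "(X0 \<inter> \<Omega> \<inter> (\<lambda>x. (x, 0)) -` DM \<inter> DI) \<inter> (\<lambda>x. (I x, x)) -` DM = X1"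
    by (auto simp: X1_def X0_def DK_def)
  ultimately show ?thesis by simp
qed

text \<open>The velocity \<open>a\<close> at \<open>x\<close> is transported to the identity by left translation.\<close>

definition "ltrans x a = \<partial> M (I x, x) (0, a)"

lemma M_cancel_zero: assumes "x \<in> X1" shows "M (I x, x) = 0"
proof -
  have "\<psi> (M (I x, x)) = \<psi> 0"
    using X1_D[OF assms] by (simp add: \<psi>_M \<psi>_I \<psi>_closed \<psi>_zero)
  then show ?thesis using \<psi>_inj M_in X1_D[OF assms] V0 zero_\<Omega> by blast
qed

lemma ltrans_in: assumes "x \<in> X1" shows "ltrans x a \<in> V"
  unfolding ltrans_def
  by (rule derivative_in_subspace[OF V M_deriv2, of "I x" x])
     (use X1_D[OF assms] ev_DM2[of "I x" x] M_in in \<open>auto elim!: eventually_mono\<close>)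

text \<open>The derivative at \<open>y = x\<close> of the identity
  \<open>x (x^-1 y) = y\<close>.\<close>

lemma ltrans_inverse:
  assumes x: "x \<in> X1" "x \<in> V" "a \<in> V"
  shows "\<partial> M (x, 0) (0, ltrans x a) = a"
proof -
  note X = X1_D[OF x(1)]
  have "((\<lambda>y. M (x, M (I x, y))) has_derivative (\<lambda>v. \<partial> M (x, 0) (0, ltrans x v))) (at x)"
    using has_derivative_compose[OF M_deriv2[of "I x" x], of "\<lambda>y. M (x, y)"] M_deriv2[of x 0] X
      M_cancel_zero[OF x(1)] unfolding ltrans_def by simp
  then show ?thesis
  proof (rule derivative_eq_on_subspace[OF V x(2,3) _ has_derivative_ident])
    have "isCont (\<lambda>y. (x, M (I x, y))) x"
      using has_derivative_continuous[OF M_deriv2[of "I x" x]] X by (intro continuous_intros) blast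
    from eventually_isCont_open[OF this open_DM]
    have "\<forall>\<^sub>F y in nhds x. (x, M (I x, y)) \<in> DM"
      using X M_cancel_zero[OF x(1)] by simp
    moreover have "\<forall>\<^sub>F y in nhds x. (I x, y) \<in> DM" using ev_DM2 X by blast
    moreover have "\<forall>\<^sub>F y in nhds x. y \<in> \<Omega>" using ev_\<Omega> X by blast
    ultimately show "\<forall>\<^sub>F y in nhds x. y \<in> V \<longrightarrow> M (x, M (I x, y)) = y"
    proof eventually_elim
      case (elim y)
      have "\<psi> (M (x, M (I x, y))) = \<psi> y"
        using elim X by (simp add: \<psi>_M \<psi>_I \<psi>_closed m_assoc[symmetric])
      then show ?case using \<psi>_inj M_in elim by blast
    qed
  qed
qed

text \<open>Differentiate \<open>Ad_mult\<close> in \<open>z\<close> at 0 in the direction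
  \<open>ltrans x a\<close>; by \<open>ltrans_inverse\<close> the product \<open>x z\<close> then
  moves with velocity \<open>a\<close>. Here \<open>ad\<close> stands to the right of
  \<open>Ad x\<close>, so the ideal property can be used before \<open>Ad x\<close> is
  applied.\<close>

lemma Ad_deriv_eq:
  assumes x: "x \<in> X1" "x \<in> V" "a \<in> V"
  shows "\<partial> (\<lambda>x. Ad x v) x a = Ad x (ad (ltrans x a) v)"
proof -
  note X = X1_D[OF x(1)]
  have Mx: "M (x, 0) = x" using M_right_zero X x by blast
  have 1: "((\<lambda>z. Ad (M (x, z)) v) has_derivative (\<lambda>w. \<partial> (\<lambda>x. Ad x v) x (\<partial> M (x, 0) (0, w)))) (at 0)"
    using has_derivative_compose[OF M_deriv2[of x 0], of "\<lambda>x. Ad x v"] Ad_deriv[of x v] Mx X by simp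
  have 2: "((\<lambda>z. Ad x (Ad z v)) has_derivative (\<lambda>w. Ad x (ad w v))) (at 0)"
    unfolding ad_def
    using bounded_linear.has_derivative[OF _ Ad_deriv[OF zero_X0], of "Ad x" v] linear_Ad X
      linear_linear by blast
  have "isCont (\<lambda>z. M (x, z)) 0"
    using has_derivative_continuous[OF M_deriv2] X by blast
  from eventually_isCont_open[OF this open_X0] have "\<forall>\<^sub>F z in nhds 0. M (x, z) \<in> X0"
    using X Mx by simp
  moreover have "\<forall>\<^sub>F z in nhds 0. (x, z) \<in> DM" using ev_DM2 X by blast
  moreover have "\<forall>\<^sub>F z in nhds 0. z \<in> X0" using open_X0 zero_X0 by (rule eventually_nhds_in_open)
  ultimately have "\<forall>\<^sub>F z in nhds 0. Ad (M (x, z)) v = Ad x (Ad z v)"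
    by eventually_elim (use Ad_mult X in \<open>auto simp: X0_def\<close>)
  from fun_cong[OF has_derivative_unique[OF fderiv_cong[OF this 1] 2]]
  have "\<partial> (\<lambda>x. Ad x v) x (\<partial> M (x, 0) (0, w)) = Ad x (ad w v)" for w .
  from this[of "ltrans x a"] show ?thesis using ltrans_inverse[OF x] by simp
qed

text \<open>The mixed bilinear term in the second-order Taylor expansion of the multiplication at
  the identity; its antisymmetrisation is the Lie bracket.\<close>

definition "B w v = \<partial> (\<lambda>p. \<partial> M p (0, v)) (0, 0) (w, 0)"

lemma ad_in: "ad w v \<in> V"
  unfolding ad_def
  by (rule derivative_in_subspace[OF V Ad_deriv[OF zero_X0]])
     (use open_X0 zero_X0 Ad_in in \<open>auto simp: eventually_nhds\<close>)

lemma linear_ad: "linear (\<lambda>w. ad w v)"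
  unfolding ad_def using has_derivative_linear[OF Ad_deriv[OF zero_X0]] .

text \<open>Differentiate \<open>(x y x^-1) x = x y\<close> in \<open>y\<close> at 0, which removes
  the inverse, and then in \<open>x\<close> at 0. The product rule on the left gives
  \<open>ad w v\<close> plus a second derivative of the multiplication with its arguments in the
  other order.\<close>

lemma ad_eq:
  assumes v: "v \<in> V"
  shows "ad w v = B w v - B v w"
proof -
  let ?N = "\<lambda>u x. \<partial> M (0, x) (u, 0)"
  have lin: "linear (\<lambda>u. ?N u x)" if "(0, x) \<in> DM" for x
    using has_derivative_linear[OF M_deriv1[OF that]] .
  have sN: "((\<lambda>p. \<partial> M p (u, 0)) has_derivative \<partial> (\<lambda>p. \<partial> M p (u, 0)) (0, 0)) (at (0, 0))" for u
    using smooth_on_has_derivative[OF smooth_on_fderiv[OF smooth_M open_DM] open_DM zero_DM] .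
  have dN: "(?N u has_derivative (\<lambda>w. \<partial> (\<lambda>p. \<partial> M p (u, 0)) (0, 0) (0, w))) (at 0)" for u
    using has_derivative_compose[OF deriv_slice2 sN] .
  define N' where "N' u w = \<partial> (\<lambda>p. \<partial> M p (u, 0)) (0, 0) (0, w)" for u w
  have dN: "(?N u has_derivative N' u) (at 0)" for u
    unfolding N'_def by (rule dN)
  have evD: "\<forall>\<^sub>F x in nhds 0. (0, x) \<in> DM" using ev_DM2[OF zero_DM] .
  \<comment> \<open>The second derivative inherits linearity in the direction \<open>v\<close> from
    the first derivatives \<open>?N\<close>, which are linear in it at every point near 0.\<close>
  have N'lin: "N' v w = (\<Sum>b\<in>Basis. (v \<bullet> b) *\<^sub>R N' b w)"
  proof -
    have "((\<lambda>x. \<Sum>b\<in>Basis. (v \<bullet> b) *\<^sub>R ?N b x) has_derivative (\<lambda>w. \<Sum>b\<in>Basis. (v \<bullet> b) *\<^sub>R N' b w)) (at 0)"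
      by (intro has_derivative_sum has_derivative_scaleR_right dN)
    moreover have "\<forall>\<^sub>F x in nhds 0. (\<Sum>b\<in>Basis. (v \<bullet> b) *\<^sub>R ?N b x) = ?N v x"
      using evD by eventually_elim (rule linear_Basis_sum[OF lin, symmetric])
    ultimately have "(?N v has_derivative (\<lambda>w. \<Sum>b\<in>Basis. (v \<bullet> b) *\<^sub>R N' b w)) (at 0)"
      by (rule fderiv_cong[rotated])
    from fun_cong[OF has_derivative_unique[OF dN this]] show ?thesis by simp
  qed
  have rhs: "((\<lambda>x. \<partial> M (x, 0) (0, v)) has_derivative (\<lambda>w. B w v)) (at 0)"
    unfolding B_def
    using has_derivative_compose[OF deriv_slice1
        smooth_on_has_derivative[OF smooth_on_fderiv[OF smooth_M open_DM] open_DM zero_DM]] .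
  have A0: "((\<lambda>x. Ad x v \<bullet> b) has_derivative (\<lambda>w. ad w v \<bullet> b)) (at 0)" for b
    unfolding ad_def by (rule has_derivative_inner_left[OF Ad_deriv[OF zero_X0]])
  \<comment> \<open>In the derivative of right translation by \<open>x\<close> both the base point
    and the direction \<open>Ad x v\<close> depend on \<open>x\<close>. The basis expansion
    separates them for the product rule.\<close>
  have "((\<lambda>x. \<Sum>b\<in>Basis. (Ad x v \<bullet> b) *\<^sub>R ?N b x) has_derivative
      (\<lambda>w. \<Sum>b\<in>Basis. (Ad 0 v \<bullet> b) *\<^sub>R N' b w + (ad w v \<bullet> b) *\<^sub>R ?N b 0)) (at 0)"
    by (intro has_derivative_sum has_derivative_scaleR A0 dN)
  moreover have "\<forall>\<^sub>F x in nhds 0. (\<Sum>b\<in>Basis. (Ad x v \<bullet> b) *\<^sub>R ?N b x) = \<partial> M (x, 0) (0, v)"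
    using evD ev_DM1[OF zero_DM] eventually_nhds_in_open[OF open_X0 zero_X0]
  proof eventually_elim
    case (elim x)
    have xK: "(x, 0) \<in> DK" using elim by (simp add: X0_def)
    have "((\<lambda>y. M (\<kappa> (x, y), x)) has_derivative (\<lambda>v. ?N (Ad x v) x)) (at 0)"
      using has_derivative_compose[OF \<kappa>_deriv2[OF elim(3)], of "\<lambda>y. M (y, x)"] M_deriv1[OF elim(1)] \<kappa>_zero[OF xK]
      by simp
    moreover have "\<forall>\<^sub>F y in nhds 0. M (\<kappa> (x, y), x) = M (x, y)"
    proof -
      have "isCont (\<lambda>y. (\<kappa> (x, y), x)) 0"
        using has_derivative_continuous[OF \<kappa>_deriv2[OF elim(3)]] by (intro continuous_intros)
      from eventually_isCont_open[OF this open_DM] have "\<forall>\<^sub>F y in nhds 0. (\<kappa> (x, y), x) \<in> DM"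
        using elim \<kappa>_zero[OF xK] by simp
      with ev_DM2[OF elim(2)] ev_DK2[OF xK] show ?thesis
      proof eventually_elim
        case (elim y)
        have "\<psi> (M (\<kappa> (x, y), x)) = \<psi> (M (x, y))"
          using elim by (simp add: \<psi>_M \<psi>_\<kappa> \<psi>_closed m_assoc)
        then show ?case using \<psi>_inj M_in elim by blast
      qed
    qed
    ultimately have "((\<lambda>y. M (x, y)) has_derivative (\<lambda>v. ?N (Ad x v) x)) (at 0)"
      by (rule fderiv_cong[rotated])
    from fun_cong[OF has_derivative_unique[OF this M_deriv2[OF elim(2)]]]
    have "?N (Ad x v) x = \<partial> M (x, 0) (0, v)" by simp
    then show ?case using linear_Basis_sum[OF lin[OF elim(1)]] by metis
  qed
  ultimately have "((\<lambda>x. \<partial> M (x, 0) (0, v)) has_derivative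
      (\<lambda>w. \<Sum>b\<in>Basis. (Ad 0 v \<bullet> b) *\<^sub>R N' b w + (ad w v \<bullet> b) *\<^sub>R ?N b 0)) (at 0)"
    by (rule fderiv_cong[rotated])
  from fun_cong[OF has_derivative_unique[OF rhs this]]
  have "B w v = (\<Sum>b\<in>Basis. (Ad 0 v \<bullet> b) *\<^sub>R N' b w + (ad w v \<bullet> b) *\<^sub>R ?N b 0)" by simp
  also have "\<dots> = N' v w + ?N (ad w v) 0"
    using linear_Basis_sum[OF lin[OF zero_DM], of "ad w v"] N'lin
    by (simp add: sum.distrib Ad_zero[OF v])
  also have "?N (ad w v) 0 = ad w v" using dM_zero[OF ad_in V0] by simp
  \<comment> \<open>The two sides differ in the order of the two differentiations.\<close>
  also have "N' v w = B v w"
    unfolding N'_def B_def using fderiv_commute[OF smooth_M open_DM zero_DM] by blast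
  finally show ?thesis by simp
qed

lemma Ad_invariant:
  assumes L: "subspace L" "L \<subseteq> V"
    and ideal: "\<And>w v. w \<in> V \<Longrightarrow> v \<in> L \<Longrightarrow> B w v - B v w \<in> L"
  obtains r where "r > 0" "ball 0 r \<subseteq> X1" "\<And>a v. a \<in> V \<Longrightarrow> norm a < r \<Longrightarrow> v \<in> L \<Longrightarrow> Ad a v \<in> L"
proof -
  obtain r where r: "r > 0" "ball 0 r \<subseteq> X1"
    using open_X1 zero_X1 open_contains_ball by blast
  have "Ad a v \<in> L" if a: "a \<in> V" "norm a < r" and v: "v \<in> L" for a v
  proof -
    have ta: "t *\<^sub>R a \<in> X1" "t *\<^sub>R a \<in> V" if "t \<in> {0..1}" for t
    proof -
      have "\<bar>t\<bar> * norm a \<le> 1 * norm a" using that by (intro mult_right_mono) auto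
      then show "t *\<^sub>R a \<in> X1" using r(2) a(2) by (auto simp: subset_iff)
      show "t *\<^sub>R a \<in> V" using a V subspace_scale by blast
    qed
    define P where "P x = x - proj L x" for x
    have blP: "bounded_linear P" unfolding P_def
      by (intro bounded_linear_sub bounded_linear_ident bounded_linear_proj L)
    have P0: "P x = 0 \<longleftrightarrow> x \<in> L" for x
      unfolding P_def using proj_id[OF L(1)] proj_in[OF L(1), of x] by force
    \<comment> \<open>The derivative of \<open>Ad (t a) (proj L b)\<close> in \<open>t\<close> is
      \<open>Ad (t a)\<close> of this vector, which lies in \<open>L\<close> because
      \<open>L\<close> is an ideal. The vectors \<open>proj L b\<close> span \<open>L\<close>, so
      finitely many unknowns suffice.\<close>
    define l where "l b t = ad (ltrans (t *\<^sub>R a) a) (proj L b)" for b t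
    have lL: "l b t \<in> L" if "t \<in> {0..1}" for b t
      using ideal[OF ltrans_in[OF ta(1)[OF that]] proj_in[OF L(1)]] ad_eq L proj_in[OF L(1)]
      unfolding l_def by (metis subsetD)
    \<comment> \<open>The component that has to vanish: the part of the transported vector
      orthogonal to \<open>L\<close>.\<close>
    define u where "u b t = P (Ad (t *\<^sub>R a) (proj L b))" for b t
    have "\<exists>C. \<forall>b\<in>Basis. \<forall>t\<in>{0..1}. norm (l b t) \<le> C"
    proof -
      have "\<exists>C. \<forall>t\<in>{0..1}. norm (l b t) \<le> C" for b
      proof -
        have c1: "continuous_on {0..1} (\<lambda>t. ltrans (t *\<^sub>R a) a)"
          unfolding ltrans_def
          by (rule continuous_on_compose2[OF smooth_on_continuous[OF smooth_on_fderiv[OF smooth_M open_DM]]])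
             (use ta X1_D in \<open>auto intro!: continuous_intros
                continuous_on_compose2[OF smooth_on_continuous[OF smooth_I]]\<close>)
        have "continuous_on {0..1} (l b)"
          unfolding l_def
          by (rule bounded_linear.continuous_on[OF _ c1]) (use linear_ad linear_linear in blast)
        then have "compact (l b ` {0..1})" by (rule compact_continuous_image) simp
        then show ?thesis using compact_imp_bounded bounded_iff by (metis imageI)
      qed
      then obtain C where C: "\<And>b t. t \<in> {0..1} \<Longrightarrow> norm (l b t) \<le> C b" by metis
      have "norm (l b t) \<le> (\<Sum>b\<in>Basis. \<bar>C b\<bar>)" if "b \<in> Basis" "t \<in> {0..1}" for b t
        using C[OF that(2), of b] member_le_sum[of b Basis "\<lambda>b. \<bar>C b\<bar>"] that(1) by force
      then show ?thesis by blast
    qed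
    then obtain C where C: "\<And>b t. b \<in> Basis \<Longrightarrow> t \<in> {0..1} \<Longrightarrow> norm (l b t) \<le> C" by blast
    have u1: "u b 1 = 0" if "b \<in> Basis" for b
    proof (rule linear_ode_zero[where u=u and i=b and I=Basis and C=C and u'="\<lambda>b t. P (Ad (t *\<^sub>R a) (l b t))"])
      fix b :: 's and t :: real assume b: "b \<in> Basis" and t: "t \<in> {0..1}"
      have "((\<lambda>t. t *\<^sub>R a) has_vector_derivative a) (at t within {0..1})"
        using has_vector_derivative_line[of 0 0 a] by simp
      from has_derivative_along_curve[OF this Ad_deriv[of "t *\<^sub>R a" "proj L b"]]
      have "((\<lambda>t. Ad (t *\<^sub>R a) (proj L b)) has_vector_derivative Ad (t *\<^sub>R a) (l b t)) (at t within {0..1})"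
        using Ad_deriv_eq[OF ta[OF t] a(1)] X1_D[OF ta(1)[OF t]] unfolding l_def by simp
      from bounded_linear.has_vector_derivative[OF blP this]
      show "(u b has_vector_derivative P (Ad (t *\<^sub>R a) (l b t))) (at t within {0..1})"
        unfolding u_def[abs_def] .
      have "linear (\<lambda>x. P (Ad (t *\<^sub>R a) (proj L x)))"
        using linear_compose[OF linear_compose[OF linear_proj[OF L(1)] linear_Ad]
            bounded_linear.linear[OF blP]] X1_D[OF ta(1)[OF t]] by (simp add: o_def)
      \<comment> \<open>As \<open>l b t\<close> lies in \<open>L\<close>, inserting
        \<open>proj L\<close> changes nothing, and the derivative of \<open>u b\<close> becomes a
        linear combination of the unknowns themselves. The coefficients are bounded by compactness
        of \<open>{0..1}\<close>.\<close>
      from linear_Basis_sum[OF this, of "l b t"]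
      have "P (Ad (t *\<^sub>R a) (l b t)) = (\<Sum>b'\<in>Basis. (l b t \<bullet> b') *\<^sub>R u b' t)"
        unfolding u_def using proj_id[OF L(1) lL[OF t]] by simp
      also have "norm \<dots> \<le> (\<Sum>b'\<in>Basis. C * norm (u b' t))"
      proof (rule sum_norm_le)
        fix b' :: 's assume "b' \<in> Basis"
        then have "\<bar>l b t \<bullet> b'\<bar> \<le> C" using C[OF b t] Basis_le_norm order_trans by blast
        then show "norm ((l b t \<bullet> b') *\<^sub>R u b' t) \<le> C * norm (u b' t)"
          by (simp add: mult_right_mono)
      qed
      finally show "norm (P (Ad (t *\<^sub>R a) (l b t))) \<le> C * (\<Sum>j\<in>Basis. norm (u j t))"
        by (simp add: sum_distrib_left)
    next
      fix b :: 's
      have "proj L b \<in> L" "proj L b \<in> V" using proj_in[OF L(1)] L(2) by auto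
      then show "u b 0 = 0" unfolding u_def using P0 by (simp add: Ad_zero)
    qed (use that in auto)
    have "linear (\<lambda>x. P (Ad a (proj L x)))"
      using linear_compose[OF linear_compose[OF linear_proj[OF L(1)] linear_Ad]
          bounded_linear.linear[OF blP]] X1_D[OF ta(1)[of 1]] by (simp add: o_def)
    from linear_Basis_sum[OF this, of v] have "P (Ad a v) = 0"
      using u1 unfolding u_def by (simp add: proj_id[OF L(1) v])
    then show ?thesis using P0 by blast
  qed
  with r show ?thesis using that by blast
qed

end

text \<open>Both coordinate systems parametrise parts of the same ambient group \<open>G\<close>,
  the primed one lying in the subgroup. Identities mixing the two can thus be checked in
  \<open>G\<close>. The map \<open>J\<close> is the inclusion in coordinates, and its derivative is
  required to be injective only on \<open>V'\<close>, at the identity.\<close>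

locale local_subgroup =
  local_group G V \<Omega> \<psi> M DM I DI + H: local_group G V' \<Omega>' \<psi>' M' DM' I' DI'
  for G :: "'a monoid" (structure)
    and V :: "'s::euclidean_space set" and \<Omega> :: "'s set" and \<psi> :: "'s \<Rightarrow> 'a"
    and M :: "'s \<times> 's \<Rightarrow> 's" and DM :: "('s \<times> 's) set" and I :: "'s \<Rightarrow> 's" and DI :: "'s set"
    and V' :: "'t::euclidean_space set" and \<Omega>' :: "'t set" and \<psi>' :: "'t \<Rightarrow> 'a"
    and M' :: "'t \<times> 't \<Rightarrow> 't" and DM' :: "('t \<times> 't) set" and I' :: "'t \<Rightarrow> 't" and DI' :: "'t set" +
  fixes J :: "'t \<Rightarrow> 's" and DJ :: "'t set"
  assumes open_DJ: "open DJ" and zero_DJ: "0 \<in> DJ" and smooth_J: "smooth DJ J"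
    and J_in: "u \<in> DJ \<Longrightarrow> J u \<in> V \<inter> \<Omega>" and \<psi>_J: "u \<in> DJ \<Longrightarrow> \<psi> (J u) = \<psi>' u"
    and immersion: "u \<in> V' \<Longrightarrow> \<partial> J 0 u = 0 \<Longrightarrow> u = 0"
begin

abbreviation "j \<equiv> \<partial> J 0"

definition "L = j ` V'"

lemma J_zero: "J 0 = 0"
  using J_in[OF zero_DJ] \<psi>_J[OF zero_DJ] \<psi>_inj[of "J 0" 0] V0 zero_\<Omega> by (simp add: \<psi>_zero H.\<psi>_zero)

lemma J_deriv: "(J has_derivative j) (at 0)"
  by (rule smooth_on_has_derivative[OF smooth_J open_DJ zero_DJ])

lemma linear_j: "linear j"
  using J_deriv has_derivative_linear by blast

lemma ev_DJ: "\<forall>\<^sub>F u in nhds 0. u \<in> DJ"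
  using open_DJ zero_DJ by (rule eventually_nhds_in_open)

lemma subspace_L: "subspace L"
  unfolding L_def using linear_j H.V by (rule linear_subspace_image)

lemma L_subset: "L \<subseteq> V"
proof
  fix x assume "x \<in> L"
  then obtain u where "x = j u" by (auto simp: L_def)
  moreover have "\<forall>\<^sub>F u in nhds 0. J u \<in> V" using ev_DJ by eventually_elim (use J_in in blast)
  ultimately show "x \<in> V" using derivative_in_subspace[OF V J_deriv] by blast
qed

text \<open>
  By the inverse function theorem \<open>(u, w) \<mapsto> J u \<cdot> w\<close>, with \<open>w\<close> in a complement of \<open>L\<close>, is a
  coordinate system. The complementary coordinate \<open>F\<close> vanishes only on the subgroup and is locally
  invariant under left translation by the subgroup.
\<close>

lemma slice_coordinate:
  obtains W and F :: "'s \<Rightarrow> 's" and F' where "open W" "0 \<in> W" "F 0 = 0"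
    "\<And>y. y \<in> W \<Longrightarrow> (F has_derivative F' y) (at y)"
    "\<And>y. y \<in> W \<Longrightarrow> (0, y) \<in> DM"
    "\<And>y. y \<in> W \<inter> V \<Longrightarrow> F y = 0 \<Longrightarrow> \<psi> y \<in> range \<psi>'"
    "\<And>y. y \<in> W \<inter> V \<Longrightarrow> \<forall>\<^sub>F u in nhds 0. F (M (J u, y)) = F y"
proof -
  have "inj_on j V'"
    unfolding linear_injective_on_subspace_0[OF linear_j H.V] using immersion by blast
  from linear_exists_left_inverse_on[OF linear_j H.V this]
  obtain g where g: "range g \<subseteq> V'" "linear g" "\<And>u. u \<in> V' \<Longrightarrow> g (j u) = u" by auto
  \<comment> \<open>The chart splits a vector into the parameter \<open>\<sigma> x\<close> of a
    point of the subgroup, read off from the \<open>L\<close>-component by a left inverse of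
    \<open>j\<close>, and the remaining component \<open>\<nu> x\<close> in
    \<open>V\<close>.\<close>
  define \<sigma> where "\<sigma> x = g (proj L x)" for x
  define \<nu> where "\<nu> x = proj V x - proj L x" for x
  \<comment> \<open>The last summand acts on the complement of \<open>V\<close>. With it the
    derivative of \<open>\<Phi>\<close> at 0 is the identity of the whole Euclidean space, as the
    inverse function theorem requires.\<close>
  define \<Phi> where "\<Phi> x = M (J (\<sigma> x), \<nu> x) + (x - proj V x)" for x
  have bl\<sigma>: "bounded_linear \<sigma>" unfolding \<sigma>_def
    using linear_compose[OF linear_proj[OF subspace_L] g(2)] by (simp add: o_def linear_linear)
  have bl\<nu>: "bounded_linear \<nu>" unfolding \<nu>_def
    by (intro bounded_linear_sub bounded_linear_proj V subspace_L)
  have \<sigma>V: "\<sigma> x \<in> V'" for x unfolding \<sigma>_def using g(1) by auto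
  have j\<sigma>: "j (\<sigma> x) = proj L x" for x
  proof -
    obtain u where "u \<in> V'" "proj L x = j u" using proj_in[OF subspace_L, of x] by (auto simp: L_def)
    then show ?thesis using g(3) by (simp add: \<sigma>_def)
  qed
  have \<nu>V: "\<nu> x \<in> V" for x
    unfolding \<nu>_def using V proj_in[OF V] proj_in[OF subspace_L] L_subset by (meson subsetD subspace_diff)
  have cont: "continuous_on S \<sigma>" "continuous_on S \<nu>" for S
    using bl\<sigma> bl\<nu> linear_continuous_on by blast+
  have s\<sigma>: "smooth S \<sigma>" and s\<nu>: "smooth S \<nu>" for S
    using smooth_on_bounded_linear[OF bl\<sigma> smooth_on_ident] smooth_on_bounded_linear[OF bl\<nu> smooth_on_ident] by auto
  have [simp]: "\<sigma> 0 = 0" "\<nu> 0 = 0"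
    using bl\<sigma> bl\<nu> bounded_linear.linear linear_0 by blast+
  \<comment> \<open>The two primed conditions make \<open>H.M_left_zero\<close> applicable at
    \<open>\<sigma> x\<close> and let this parameter be multiplied from the left by elements near
    the identity.\<close>
  define U where "U = {x. \<sigma> x \<in> DJ \<and> (J (\<sigma> x), \<nu> x) \<in> DM \<and> (0, \<sigma> x) \<in> DM' \<and> \<sigma> x \<in> \<Omega>'}"
  have "open U"
  proof -
    have 1: "open (\<sigma> -` DJ \<inter> (\<lambda>x. (0, \<sigma> x)) -` DM' \<inter> \<sigma> -` \<Omega>')"
      using open_DJ H.open_DM H.open_\<Omega>
      by (intro open_Int open_vimage) (auto intro!: continuous_intros cont)
    have "continuous_on (\<sigma> -` DJ \<inter> (\<lambda>x. (0, \<sigma> x)) -` DM' \<inter> \<sigma> -` \<Omega>') (\<lambda>x. (J (\<sigma> x), \<nu> x))"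
      by (intro continuous_on_Pair cont continuous_on_compose2[OF smooth_on_continuous[OF smooth_J]]) auto
    from continuous_open_preimage[OF this 1 open_DM]
    have "open ((\<sigma> -` DJ \<inter> (\<lambda>x. (0, \<sigma> x)) -` DM' \<inter> \<sigma> -` \<Omega>') \<inter> (\<lambda>x. (J (\<sigma> x), \<nu> x)) -` DM)" .
    also have "\<dots> = U" by (auto simp: U_def)
    finally show ?thesis .
  qed
  have "0 \<in> U" by (simp add: U_def zero_DJ J_zero zero_DM H.zero_DM H.zero_\<Omega>)
  have s\<Phi>: "smooth U \<Phi>"
    unfolding \<Phi>_def
    by (rule smooth_on_add[OF smooth_on_compose[OF smooth_on_Pair[OF smooth_on_compose[OF s\<sigma> smooth_J] s\<nu>] smooth_M]
          smooth_on_diff[OF smooth_on_ident smooth_on_bounded_linear[OF bounded_linear_proj[OF V] smooth_on_ident]]])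
       (auto simp: U_def)
  have \<Phi>0: "\<Phi> 0 = 0"
    using linear_0[OF linear_proj[OF V]] by (simp add: \<Phi>_def J_zero M_zero)
  have d0: "\<partial> \<Phi> 0 x = x" for x
  proof -
    have "(J has_derivative j) (at (\<sigma> 0))" using J_deriv by simp
    from has_derivative_compose[OF bounded_linear_imp_has_derivative[OF bl\<sigma>] this]
    have "((\<lambda>x. (J (\<sigma> x), \<nu> x)) has_derivative (\<lambda>x. (j (\<sigma> x), \<nu> x))) (at 0)"
      by (intro has_derivative_Pair bounded_linear_imp_has_derivative[OF bl\<nu>])
    moreover have "(M has_derivative \<partial> M (0, 0)) (at (J (\<sigma> 0), \<nu> 0))"
      using M_deriv[OF zero_DM] by (simp add: J_zero)
    ultimately have "((\<lambda>x. M (J (\<sigma> x), \<nu> x)) has_derivative (\<lambda>x. \<partial> M (0, 0) (j (\<sigma> x), \<nu> x))) (at 0)"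
      by (rule has_derivative_compose)
    then have "(\<Phi> has_derivative (\<lambda>x. \<partial> M (0, 0) (j (\<sigma> x), \<nu> x) + (x - proj V x))) (at 0)"
      unfolding \<Phi>_def
      by (intro has_derivative_add has_derivative_diff has_derivative_ident
            bounded_linear_imp_has_derivative[OF bounded_linear_proj[OF V]])
    then have "\<partial> \<Phi> 0 x = \<partial> M (0, 0) (j (\<sigma> x), \<nu> x) + (x - proj V x)" by (rule fderiv_eqI)
    also have "\<partial> M (0, 0) (j (\<sigma> x), \<nu> x) = proj L x + \<nu> x"
      using dM_zero[OF _ \<nu>V] L_subset proj_in[OF subspace_L] unfolding j\<sigma> by blast
    finally show ?thesis by (simp add: \<nu>_def)
  qed
  define f' where "f' x = Blinfun (\<partial> \<Phi> x)" for x
  have hd: "(\<Phi> has_derivative \<partial> \<Phi> x) (at x)" if "x \<in> U" for x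
    by (rule smooth_on_has_derivative[OF s\<Phi> \<open>open U\<close> that])
  have f': "blinfun_apply (f' x) = \<partial> \<Phi> x" if "x \<in> U" for x
    unfolding f'_def by (rule bounded_linear_Blinfun_apply[OF has_derivative_bounded_linear[OF hd[OF that]]])
  have "continuous_on U f'"
  proof (rule continuous_on_blinfun_componentwise)
    fix i :: 's
    show "continuous_on U (\<lambda>x. blinfun_apply (f' x) i)"
      by (rule continuous_on_eq[OF smooth_on_continuous[OF smooth_on_fderiv[OF s\<Phi> \<open>open U\<close>]]]) (simp add: f')
  qed
  moreover have "f' 0 = id_blinfun"
    by (rule blinfun_eqI) (simp add: f' \<open>0 \<in> U\<close> d0)
  ultimately obtain U' W0 k k' where IFT: "open U'" "U' \<subseteq> U" "0 \<in> U'" "open W0" "0 \<in> W0"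
    "homeomorphism U' W0 \<Phi> k" "\<And>y. y \<in> W0 \<Longrightarrow> (k has_derivative k' y) (at y)"
    using inverse_function_theorem_scaled[of U \<Phi> f'] \<open>open U\<close> \<open>0 \<in> U\<close> hd f' \<Phi>0 by metis
  define W where "W = W0 \<inter> (\<lambda>y. (0, y)) -` DM"
  define F where "F y = k y - proj L (k y)" for y
  have k\<Phi>: "k (\<Phi> x) = x" if "x \<in> U'" for x using IFT(6) that by (simp add: homeomorphism_def)
  have \<Phi>k: "\<Phi> (k y) = y" "k y \<in> U'" if "y \<in> W0" for y using IFT(6) that by (auto simp: homeomorphism_def)
  \<comment> \<open>For \<open>y\<close> in \<open>V\<close> the off-\<open>V\<close> part of
    \<open>k y\<close> is a difference of vectors of \<open>V\<close>, because \<open>M\<close>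
    takes values there. Being also orthogonal to \<open>V\<close>, it is 0.\<close>
  have kV: "k y \<in> V" if "y \<in> W0" "y \<in> V" for y
  proof -
    have kU: "k y \<in> U" using \<Phi>k that IFT(2) by blast
    then have "(J (\<sigma> (k y)), \<nu> (k y)) \<in> DM" by (simp add: U_def)
    then have "k y - proj V (k y) \<in> V"
      using M_in \<Phi>k(1)[OF that(1)] that(2) V unfolding \<Phi>_def
      by (metis IntD1 add_diff_cancel_left' subspace_diff)
    then have "(k y - proj V (k y)) \<bullet> (k y - proj V (k y)) = 0" by (rule proj_orth[OF V])
    then show ?thesis using proj_in[OF V, of "k y"] by simp
  qed
  show thesis
  proof
    show "open W" unfolding W_def
      using IFT(4) open_DM by (intro open_Int open_vimage) (auto intro!: continuous_intros)
    show "0 \<in> W" by (simp add: W_def IFT zero_DM)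
    show "F 0 = 0" using k\<Phi>[OF IFT(3)] linear_0[OF linear_proj[OF subspace_L]] by (simp add: F_def \<Phi>0)
    show "(F has_derivative (\<lambda>v. k' y v - proj L (k' y v))) (at y)" if "y \<in> W" for y
      unfolding F_def using that IFT(7) unfolding W_def
      by (intro has_derivative_diff bounded_linear.has_derivative[OF bounded_linear_proj[OF subspace_L]]) auto
    show "(0, y) \<in> DM" if "y \<in> W" for y using that by (simp add: W_def)
    show "\<psi> y \<in> range \<psi>'" if y: "y \<in> W \<inter> V" "F y = 0" for y
    proof -
      let ?x = "k y"
      have xU: "?x \<in> U" using y \<Phi>k IFT(2) by (auto simp: W_def)
      have "proj V ?x = ?x" using kV y proj_id[OF V] by (auto simp: W_def)
      moreover have "proj L ?x = ?x" using y(2) by (simp add: F_def)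
      ultimately have "y = M (J (\<sigma> ?x), 0)" using \<Phi>k(1)[of y] y by (simp add: W_def \<Phi>_def \<nu>_def)
      moreover have "(J (\<sigma> ?x), 0) \<in> DM" "\<sigma> ?x \<in> DJ"
        using xU \<open>proj V ?x = ?x\<close> \<open>proj L ?x = ?x\<close> by (auto simp: U_def \<nu>_def)
      ultimately have "\<psi> y = \<psi>' (\<sigma> ?x)" by (metis \<psi>_M \<psi>_J \<psi>_zero H.\<psi>_closed r_one)
      then show ?thesis by simp
    qed
    show "\<forall>\<^sub>F u in nhds 0. F (M (J u, y)) = F y" if y: "y \<in> W \<inter> V" for y
    proof -
      define x where "x = k y"
      have xU': "x \<in> U'" and xU: "x \<in> U" and \<Phi>x: "\<Phi> x = y" and xV: "proj V x = x"
        using y \<Phi>k IFT(2) kV proj_id[OF V] unfolding x_def by (auto simp: W_def)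
      define u0 where "u0 = \<sigma> x"
      have u0: "(0, u0) \<in> DM'" "u0 \<in> V' \<inter> \<Omega>'" "u0 \<in> DJ" "(J u0, \<nu> x) \<in> DM"
        using xU \<sigma>V unfolding u0_def by (auto simp: U_def)
      have yM: "y = M (J u0, \<nu> x)" using \<Phi>x xV by (simp add: \<Phi>_def u0_def)
      \<comment> \<open>The expected coordinate of \<open>J u\<close> times \<open>y\<close>. Since
        \<open>y\<close> is \<open>J u0\<close> times \<open>\<nu> x\<close>, the product is
        \<open>J\<close> of \<open>M' (u, u0)\<close> times \<open>\<nu> x\<close>: only the
        \<open>L\<close>-component changes. For small \<open>u\<close> the point \<open>h u\<close>
        stays in \<open>U'\<close>, where \<open>k\<close> inverts \<open>\<Phi>\<close>.\<close>
      define h where "h u = j (M' (u, u0)) + (x - proj L x)" for u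
      have cM': "isCont (\<lambda>u. M' (u, u0)) 0"
        using has_derivative_continuous[OF H.M_deriv1[OF u0(1)]] .
      have "isCont h 0" unfolding h_def
        by (intro continuous_intros isCont_o2[OF cM'] linear_continuous_at) (use linear_j linear_linear in blast)
      moreover have "h 0 = x"
        using H.M_left_zero[OF u0(2,1)] j\<sigma> by (simp add: h_def u0_def)
      ultimately have "\<forall>\<^sub>F u in nhds 0. h u \<in> U'"
        using eventually_isCont_open IFT(1) xU' by metis
      moreover have "\<forall>\<^sub>F u in nhds 0. (u, u0) \<in> DM'" by (rule H.ev_DM1[OF u0(1)])
      moreover have "isCont (\<lambda>u. (J u, y)) 0"
        using has_derivative_continuous[OF J_deriv] by (intro continuous_intros)
      then have "\<forall>\<^sub>F u in nhds 0. (J u, y) \<in> DM"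
        by (rule eventually_isCont_open[OF _ open_DM]) (use y in \<open>simp add: J_zero W_def\<close>)
      ultimately show ?thesis using ev_DJ
      proof eventually_elim
        case (elim u)
        let ?m = "M' (u, u0)"
        have m: "?m \<in> V'" using H.M_in elim by blast
        then have jm: "j ?m \<in> L" by (auto simp: L_def)
        have pLh: "proj L (h u) = j ?m"
        proof -
          have "proj L (h u) = proj L (j ?m) + (proj L x - proj L (proj L x))"
            unfolding h_def using linear_add[OF linear_proj[OF subspace_L]] linear_diff[OF linear_proj[OF subspace_L]] by metis
          then show ?thesis using proj_id[OF subspace_L jm] proj_proj[OF subspace_L] by simp
        qed
        have hV: "proj V (h u) = h u"
        proof (rule proj_id[OF V])
          have "x \<in> V" using xV proj_in[OF V] by metis
          then show "h u \<in> V" unfolding h_def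
            using jm L_subset proj_in[OF subspace_L, of x] V by (meson subsetD subspace_add subspace_diff)
        qed
        have \<sigma>h: "\<sigma> (h u) = ?m" using pLh g(3)[OF m] by (simp add: \<sigma>_def)
        have \<nu>h: "\<nu> (h u) = \<nu> x" unfolding \<nu>_def hV pLh xV by (simp add: h_def)
        have hU: "?m \<in> DJ" "(J ?m, \<nu> x) \<in> DM"
          using elim(1) IFT(2) \<sigma>h \<nu>h by (auto simp: U_def)
        have "\<psi> (M (J ?m, \<nu> x)) = \<psi> (M (J u, y))"
          using elim hU u0 by (simp add: yM \<psi>_M \<psi>_J H.\<psi>_M m_assoc H.\<psi>_closed \<psi>_closed)
        then have "M (J ?m, \<nu> x) = M (J u, y)" using \<psi>_inj M_in hU elim by blast
        then have "\<Phi> (h u) = M (J u, y)" by (simp add: \<Phi>_def \<sigma>h \<nu>h hV)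
        then have "k (M (J u, y)) = h u" using k\<Phi>[OF elim(1)] by simp
        then have "F (M (J u, y)) = h u - j ?m" by (simp only: F_def pLh)
        also have "\<dots> = x - proj L x" by (simp add: h_def)
        finally have "F (M (J u, y)) = x - proj L x" .
        then show ?case by (simp add: F_def x_def)
      qed
    qed
  qed
qed

text \<open>Invariance of \<open>L\<close> under \<open>Ad a\<close> is information at the identity
  alone. At another time \<open>t0\<close> it is used after writing \<open>h_t = p_t h_t0\<close>
  with \<open>p_t\<close> in the subgroup, so that the conjugated curve is \<open>a p_t a^-1\<close>
  times its own value at \<open>t0\<close>. The radius \<open>s\<close> may depend on
  \<open>a\<close>.\<close>

theorem conj_in_subgroup:
  assumes ideal: "\<And>w v. w \<in> V \<Longrightarrow> v \<in> L \<Longrightarrow> B w v - B v w \<in> L"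
  obtains r where "r > 0"
    "\<And>a. a \<in> V \<Longrightarrow> norm a < r \<Longrightarrow>
      \<exists>s>0. \<forall>u\<in>V'. norm u < s \<longrightarrow> \<psi> a \<otimes> \<psi>' u \<otimes> inv (\<psi> a) \<in> range \<psi>'"
proof -
  obtain r where r: "r > 0" "ball 0 r \<subseteq> X1"
    and AdL: "\<And>a v. a \<in> V \<Longrightarrow> norm a < r \<Longrightarrow> v \<in> L \<Longrightarrow> Ad a v \<in> L"
    using Ad_invariant[OF subspace_L L_subset ideal] by blast
  obtain W and F :: "'s \<Rightarrow> 's" and F' where W: "open W" "0 \<in> W" "F 0 = 0"
    and F': "\<And>y. y \<in> W \<Longrightarrow> (F has_derivative F' y) (at y)"
    and WM: "\<And>y. y \<in> W \<Longrightarrow> (0, y) \<in> DM"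
    and F0: "\<And>y. y \<in> W \<inter> V \<Longrightarrow> F y = 0 \<Longrightarrow> \<psi> y \<in> range \<psi>'"
    and Finv: "\<And>y. y \<in> W \<inter> V \<Longrightarrow> \<forall>\<^sub>F u in nhds 0. F (M (J u, y)) = F y"
    by (rule slice_coordinate) (rule that)
  have "\<exists>s>0. \<forall>u\<in>V'. norm u < s \<longrightarrow> \<psi> a \<otimes> \<psi>' u \<otimes> inv (\<psi> a) \<in> range \<psi>'"
    if a: "a \<in> V" "norm a < r" for a
  proof -
    have aX1: "a \<in> X1" using r(2) a(2) by (auto simp: subset_iff)
    then have aX0: "a \<in> X0" using X1_D by blast
    then have aK: "(a, 0) \<in> DK" by (simp add: X0_def)
    have "isCont (\<lambda>u. (a, J u)) 0"
      using has_derivative_continuous[OF J_deriv] by (intro continuous_intros)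
    from eventually_isCont_open[OF this open_DK] have e1: "\<forall>\<^sub>F u in nhds 0. (a, J u) \<in> DK"
      using aK by (simp add: J_zero)
    have "isCont (\<lambda>u. \<kappa> (a, J u)) 0"
      by (rule isCont_o2[OF has_derivative_continuous[OF J_deriv]])
         (use has_derivative_continuous[OF \<kappa>_deriv2[OF aX0]] in \<open>simp add: J_zero\<close>)
    from eventually_isCont_open[OF this W(1)] have e2: "\<forall>\<^sub>F u in nhds 0. \<kappa> (a, J u) \<in> W"
      using W(2) \<kappa>_zero[OF aK] by (simp add: J_zero)
    have e3: "\<forall>\<^sub>F u in nhds 0. u \<in> H.X1" using H.open_X1 H.zero_X1 by (rule eventually_nhds_in_open)
    have "isCont (\<lambda>u. (u, I' u)) 0"
      using H.I_cont[OF H.zero_DI] by (intro continuous_intros)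
    from eventually_isCont_open[OF this H.open_DM] have e4: "\<forall>\<^sub>F u in nhds 0. (u, I' u) \<in> DM'"
      using H.zero_DM by (simp add: H.I_zero)
    \<comment> \<open>The last condition lets the quotient of a nearby point of the curve by the
      point at the base time be formed in the coordinates of the subgroup.\<close>
    have "\<forall>\<^sub>F u in nhds 0. u \<in> DJ \<and> (a, J u) \<in> DK \<and> \<kappa> (a, J u) \<in> W \<and> u \<in> H.X1 \<and> (u, I' u) \<in> DM'"
      using ev_DJ e1 e2 e3 e4 by eventually_elim simp
    then obtain s where s: "s > 0"
      "\<And>u. norm u < s \<Longrightarrow> u \<in> DJ \<and> (a, J u) \<in> DK \<and> \<kappa> (a, J u) \<in> W \<and> u \<in> H.X1 \<and> (u, I' u) \<in> DM'"
      unfolding eventually_nhds_metric dist_norm diff_zero by blast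
    have "\<psi> a \<otimes> \<psi>' u \<otimes> inv (\<psi> a) \<in> range \<psi>'" if u: "u \<in> V'" "norm u < s" for u
    proof -
      have tu: "t *\<^sub>R u \<in> V'" "norm (t *\<^sub>R u) < s" if "t \<in> {0..1}" for t
      proof -
        have "\<bar>t\<bar> * norm u \<le> 1 * norm u" using that by (intro mult_right_mono) auto
        then show "norm (t *\<^sub>R u) < s" using u(2) by simp
        show "t *\<^sub>R u \<in> V'" using u H.V subspace_scale by blast
      qed
      note tu' = s(2)[OF tu(2)]
      define \<eta> where "\<eta> t = \<kappa> (a, J (t *\<^sub>R u))" for t
      have \<eta>\<psi>: "\<psi> (\<eta> t) = \<psi> a \<otimes> \<psi>' (t *\<^sub>R u) \<otimes> inv (\<psi> a)" if "t \<in> {0..1}" for t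
        unfolding \<eta>_def using tu'[OF that] by (simp add: \<psi>_\<kappa> \<psi>_J)
      have \<eta>W: "\<eta> t \<in> W \<inter> V" if "t \<in> {0..1}" for t
        unfolding \<eta>_def using tu'[OF that] \<kappa>_in by blast
      have der: "((\<lambda>t. F (\<eta> t)) has_vector_derivative 0) (at t0 within {0..1})" if t0: "t0 \<in> {0..1}" for t0
      proof -
        let ?u0 = "t0 *\<^sub>R u" and ?y = "\<eta> t0"
        have y: "?y \<in> W" "?y \<in> V" "(0, ?y) \<in> DM" using \<eta>W[OF t0] WM by auto
        note T = tu'[OF t0]
        have iD: "?u0 \<in> DI'" using T H.X1_D by blast
        \<comment> \<open>The quotient of the curve by its value at \<open>t0\<close>: it passes
          through the identity at \<open>t0\<close>, and its velocity \<open>q\<close> there lies in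
          \<open>V'\<close>.\<close>
        define p where "p t = M' (t *\<^sub>R u, I' ?u0)" for t
        have p0: "p t0 = 0"
        proof -
          have "\<psi>' (p t0) = \<psi>' 0" unfolding p_def
            using T iD by (simp add: H.\<psi>_M H.\<psi>_I H.\<psi>_closed H.\<psi>_zero)
          then show ?thesis unfolding p_def using H.\<psi>_inj H.M_in T H.V0 H.zero_\<Omega> by blast
        qed
        have line: "((\<lambda>t. t *\<^sub>R u) has_vector_derivative u) (at t within S)" for t S
          using has_vector_derivative_line[of 0 0 u] by simp
        have "((\<lambda>t. t *\<^sub>R u) has_derivative (\<lambda>h. h *\<^sub>R u)) (at t0)"
          using line unfolding has_vector_derivative_def by blast
        from has_derivative_compose[OF this H.M_deriv1] T
        have pd: "(p has_derivative (\<lambda>h. \<partial> M' (?u0, I' ?u0) (h *\<^sub>R u, 0))) (at t0)"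
          unfolding p_def by simp
        define q where "q = \<partial> M' (?u0, I' ?u0) (u, 0)"
        have pv: "(p has_vector_derivative q) (at t0)"
          unfolding p_def q_def by (rule has_derivative_along_curve[OF line]) (use H.M_deriv1 T in blast)
        have ct: "isCont (\<lambda>t. t *\<^sub>R u) t0" by (intro continuous_intros)
        have evp: "\<forall>\<^sub>F t in nhds t0. (t *\<^sub>R u, I' ?u0) \<in> DM'"
        proof -
          have "isCont (\<lambda>t. (t *\<^sub>R u, I' ?u0)) t0" by (intro continuous_intros)
          from eventually_isCont_open[OF this H.open_DM] show ?thesis using T by simp
        qed
        have qV: "q \<in> V'"
        proof -
          have "\<forall>\<^sub>F t in nhds t0. p t \<in> V'" using evp unfolding p_def
            by eventually_elim (use H.M_in in blast)
          from derivative_in_subspace[OF H.V pd this, of 1] show ?thesis by (simp add: q_def)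
        qed
        have cp: "isCont p t0" using pd has_derivative_continuous by blast
        have Jp: "isCont (\<lambda>t. J (p t)) t0"
          by (rule isCont_o2[OF cp]) (use has_derivative_continuous[OF J_deriv] p0 in simp)
        have kp: "isCont (\<lambda>t. \<kappa> (a, J (p t))) t0"
          by (rule isCont_o2[OF Jp])
             (use has_derivative_continuous[OF \<kappa>_deriv2[OF aX0]] in \<open>simp add: p0 J_zero\<close>)
        have "\<forall>\<^sub>F t in nhds t0. p t \<in> DJ"
          by (rule eventually_isCont_open[OF cp open_DJ]) (simp add: p0 zero_DJ)
        moreover have "\<forall>\<^sub>F t in nhds t0. (a, J (p t)) \<in> DK"
          by (rule eventually_isCont_open[OF _ open_DK]) (use Jp aK in \<open>auto intro!: continuous_intros simp: p0 J_zero\<close>)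
        moreover have "\<forall>\<^sub>F t in nhds t0. (\<kappa> (a, J (p t)), ?y) \<in> DM"
          by (rule eventually_isCont_open[OF _ open_DM])
             (use kp y aK in \<open>auto intro!: continuous_intros simp: p0 J_zero \<kappa>_zero\<close>)
        moreover have "\<forall>\<^sub>F t in nhds t0. t *\<^sub>R u \<in> ball 0 s"
          by (rule eventually_isCont_open[OF ct open_ball]) (use tu(2)[OF t0] in simp)
        ultimately have ev: "\<forall>\<^sub>F t in nhds t0. M (\<kappa> (a, J (p t)), ?y) = \<eta> t"
          using evp
        proof eventually_elim
          case (elim t)
          have E: "t *\<^sub>R u \<in> DJ \<and> (a, J (t *\<^sub>R u)) \<in> DK"
            using s(2)[of "t *\<^sub>R u"] elim(4) by (simp only: mem_ball_0)
          have "\<psi> (M (\<kappa> (a, J (p t)), ?y)) =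
              (\<psi> a \<otimes> (\<psi>' (t *\<^sub>R u) \<otimes> inv (\<psi>' ?u0)) \<otimes> inv (\<psi> a)) \<otimes> (\<psi> a \<otimes> \<psi>' ?u0 \<otimes> inv (\<psi> a))"
            using elim iD \<eta>\<psi>[OF t0] by (simp add: \<psi>_M \<psi>_\<kappa> \<psi>_J p_def H.\<psi>_M H.\<psi>_I)
          also have "\<dots> = \<psi> a \<otimes> (\<psi>' (t *\<^sub>R u) \<otimes> (inv (\<psi>' ?u0) \<otimes> ((inv (\<psi> a) \<otimes> \<psi> a) \<otimes> \<psi>' ?u0))) \<otimes> inv (\<psi> a)"
            by (simp only: m_assoc \<psi>_closed H.\<psi>_closed inv_closed m_closed)
          also have "\<dots> = \<psi> a \<otimes> \<psi>' (t *\<^sub>R u) \<otimes> inv (\<psi> a)"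
            by (simp add: \<psi>_closed H.\<psi>_closed)
          also have "\<dots> = \<psi> (\<eta> t)" unfolding \<eta>_def using E by (simp add: \<psi>_\<kappa> \<psi>_J)
          finally show ?case
            using \<psi>_inj[of "M (\<kappa> (a, J (p t)), ?y)" "\<eta> t"] M_in elim \<kappa>_in E unfolding \<eta>_def by blast
        qed
        have jq: "j q \<in> L" using qV by (auto simp: L_def)
        then have "Ad a (j q) \<in> L" using AdL a by blast
        then obtain q2 where q2: "q2 \<in> V'" "Ad a (j q) = j q2" by (auto simp: L_def)
        have "((\<lambda>t. J (p t)) has_vector_derivative j q) (at t0)"
          by (rule has_derivative_along_curve[OF pv]) (use J_deriv p0 in simp)
        then have "((\<lambda>t. \<kappa> (a, J (p t))) has_vector_derivative Ad a (j q)) (at t0)"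
          by (rule has_derivative_along_curve[where f="\<lambda>x. \<kappa> (a, x)"])
             (use \<kappa>_deriv2[OF aX0] p0 in \<open>simp add: J_zero\<close>)
        then have "((\<lambda>t. M (\<kappa> (a, J (p t)), ?y)) has_vector_derivative \<partial> M (0, ?y) (j q2, 0)) (at t0)"
          unfolding q2(2)
          by (rule has_derivative_along_curve[where f="\<lambda>x. M (x, ?y)"])
             (use M_deriv1[OF y(3)] p0 aK in \<open>simp add: J_zero \<kappa>_zero\<close>)
        then have "((\<lambda>t. F (M (\<kappa> (a, J (p t)), ?y))) has_vector_derivative F' ?y (\<partial> M (0, ?y) (j q2, 0))) (at t0)"
          by (rule has_derivative_along_curve)
             (use F'[OF y(1)] eventually_nhds_x_imp_x[OF ev] in simp)
        \<comment> \<open>The velocity \<open>Ad a (j q)\<close> equals \<open>j q2\<close>, so the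
          curve has the same first-order behaviour as left translation of \<open>?y\<close> by
          subgroup elements in direction \<open>q2\<close>. Along these translations
          \<open>F\<close> is constant.\<close>
        moreover have "F' ?y (\<partial> M (0, ?y) (j q2, 0)) = 0"
        proof -
          have "((\<lambda>u. M (J u, ?y)) has_derivative (\<lambda>v. \<partial> M (0, ?y) (j v, 0))) (at 0)"
            using has_derivative_compose[OF J_deriv, of "\<lambda>x. M (x, ?y)"] M_deriv1[OF y(3)] by (simp add: J_zero)
          then have "((\<lambda>u. F (M (J u, ?y))) has_derivative (\<lambda>v. F' ?y (\<partial> M (0, ?y) (j v, 0)))) (at 0)"
          proof -
            have "M (0, ?y) = ?y"
            proof (rule M_left_zero[OF _ y(3)])
              show "?y \<in> V \<inter> \<Omega>" unfolding \<eta>_def using \<kappa>_in T by blast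
            qed
            then show ?thesis
              using has_derivative_compose[OF \<open>((\<lambda>u. M (J u, ?y)) has_derivative _) (at 0)\<close>, of F "F' ?y"]
                F'[OF y(1)] by (simp add: J_zero)
          qed
          from fderiv_cong[OF Finv this] y
          have "((\<lambda>u. F ?y) has_derivative (\<lambda>v. F' ?y (\<partial> M (0, ?y) (j v, 0)))) (at 0)" by blast
          from fun_cong[OF has_derivative_unique[OF this has_derivative_const], of q2] show ?thesis .
        qed
        ultimately have D: "((\<lambda>t. F (M (\<kappa> (a, J (p t)), ?y))) has_derivative (\<lambda>h. 0)) (at t0)"
          unfolding has_vector_derivative_def by simp
        have "((\<lambda>t. F (\<eta> t)) has_derivative (\<lambda>h. 0)) (at t0)"
          by (rule fderiv_cong[OF _ D]) (use ev in \<open>auto elim: eventually_mono\<close>)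
        then show ?thesis unfolding has_vector_derivative_def
          by (simp add: has_derivative_at_withinI)
      qed
      have "\<exists>c. \<forall>t\<in>{0..1}. F (\<eta> t) = c"
        by (rule has_vector_derivative_zero_constant[of "{0..1}" "\<lambda>t. F (\<eta> t)"]) (use der in auto)
      then have "F (\<eta> 1) = F (\<eta> 0)" by force
      also have "\<eta> 0 = 0" unfolding \<eta>_def using aK by (simp add: J_zero \<kappa>_zero)
      finally have "\<psi> (\<eta> 1) \<in> range \<psi>'" using F0 \<eta>W[of 1] W(3) by simp
      then show ?thesis using \<eta>\<psi>[of 1] by simp
    qed
    then show ?thesis using s(1) by blast
  qed
  with r(1) show ?thesis using that by blast
qed

end

subsection \<open>Local parametrisations of manifolds\<close>

text \<open>
  Coordinates are centred at \<open>p\<close>, and the parametrisation is extended from the model space to the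
  whole Euclidean space by orthogonal projection.
\<close>

definition "lchart M p = (SOME c. c \<in> charts M \<and> p \<in> fst c)"
definition "lnbh M p = fst (lchart M p)"
definition "lmap M p = snd (lchart M p)"
definition "lcoord M p q = lmap M p q - lmap M p p"
definition "ldom M p = {x. lmap M p p + proj (model M) x \<in> lmap M p ` lnbh M p}"
text \<open>The default value \<open>p\<close> keeps all values in the carrier, so
  \<open>lpar_closed\<close> holds without a condition on \<open>x\<close>.\<close>

definition "lpar M p x =
  (if x \<in> ldom M p then inv_into (lnbh M p) (lmap M p) (lmap M p p + proj (model M) x) else p)"

lemma smooth_manifold_charts:
  assumes "smooth_manifold M"
  shows "subspace (model M)"
    and "(U, \<phi>) \<in> charts M \<Longrightarrow> U \<subseteq> carrier M"
    and "(U, \<phi>) \<in> charts M \<Longrightarrow> inj_on \<phi> U"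
    and "(U, \<phi>) \<in> charts M \<Longrightarrow> openin (top_of_set (model M)) (\<phi> ` U)"
proof -
  have 1: "(\<Union>(U, \<phi>)\<in>charts M. U) = carrier M"
    and 2: "\<forall>(U, \<phi>)\<in>charts M. inj_on \<phi> U \<and> openin (top_of_set (model M)) (\<phi> ` U)"
    using assms unfolding smooth_manifold_def by blast+
  show "subspace (model M)" using assms unfolding smooth_manifold_def by blast
  show "U \<subseteq> carrier M" if "(U, \<phi>) \<in> charts M" using 1 that by blast
  show "inj_on \<phi> U" "openin (top_of_set (model M)) (\<phi> ` U)" if "(U, \<phi>) \<in> charts M"
    using bspec[OF 2 that] by auto
qed

lemma smooth_manifold_transition:
  assumes "smooth_manifold M" "(U, \<phi>) \<in> charts M" "(W, \<psi>) \<in> charts M"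
  shows "openin (top_of_set (model M)) (\<phi> ` (U \<inter> W))"
    and "smooth_on (model M) (\<phi> ` (U \<inter> W)) (\<psi> \<circ> inv_into U \<phi>)"
proof -
  have "\<forall>(U, \<phi>)\<in>charts M. \<forall>(W, \<psi>)\<in>charts M.
        openin (top_of_set (model M)) (\<phi> ` (U \<inter> W)) \<and>
        smooth_on (model M) (\<phi> ` (U \<inter> W)) (\<psi> \<circ> inv_into U \<phi>)"
    using assms(1) unfolding smooth_manifold_def by blast
  from bspec[OF this assms(2)] assms(3)
  show "openin (top_of_set (model M)) (\<phi> ` (U \<inter> W))"
    "smooth_on (model M) (\<phi> ` (U \<inter> W)) (\<psi> \<circ> inv_into U \<phi>)" by fastforce+
qed

lemma smooth_map_charts:
  assumes "smooth_map M N F" "(U, \<phi>) \<in> charts M" "(W, \<psi>) \<in> charts N"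
  shows "openin (top_of_set (model M)) (\<phi> ` (U \<inter> F -` W))"
    and "smooth_on (model M) (\<phi> ` (U \<inter> F -` W)) (\<psi> \<circ> F \<circ> inv_into U \<phi>)"
proof -
  have "\<forall>(U, \<phi>)\<in>charts M. \<forall>(W, \<psi>)\<in>charts N.
        openin (top_of_set (model M)) (\<phi> ` (U \<inter> F -` W)) \<and>
        smooth_on (model M) (\<phi> ` (U \<inter> F -` W)) (\<psi> \<circ> F \<circ> inv_into U \<phi>)"
    using assms(1) unfolding smooth_map_def by blast
  from bspec[OF this assms(2)] assms(3)
  show "openin (top_of_set (model M)) (\<phi> ` (U \<inter> F -` W))"
    "smooth_on (model M) (\<phi> ` (U \<inter> F -` W)) (\<psi> \<circ> F \<circ> inv_into U \<phi>)" by fastforce+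
qed

lemma smooth_map_in: "smooth_map M N F \<Longrightarrow> x \<in> carrier M \<Longrightarrow> F x \<in> carrier N"
  unfolding smooth_map_def by blast

lemma smooth_fun_charts:
  "smooth_fun M f \<Longrightarrow> (U, \<phi>) \<in> charts M \<Longrightarrow> smooth_on (model M) (\<phi> ` U) (f \<circ> inv_into U \<phi>)"
  unfolding smooth_fun_def by (auto dest: bspec)

context
  fixes M :: "('a, 'e::euclidean_space, 'z) manifold_scheme" and p :: 'a
  assumes M: "smooth_manifold M" and p: "p \<in> carrier M"
begin

lemma lchart: "(lnbh M p, lmap M p) \<in> charts M" "p \<in> lnbh M p"
proof -
  have "p \<in> (\<Union>(U, \<phi>)\<in>charts M. U)" using M p unfolding smooth_manifold_def by blast
  then have "\<exists>c. c \<in> charts M \<and> p \<in> fst c" by force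
  from someI_ex[OF this] show "(lnbh M p, lmap M p) \<in> charts M" "p \<in> lnbh M p"
    unfolding lnbh_def lmap_def lchart_def by auto
qed

lemma lnbh_subset: "lnbh M p \<subseteq> carrier M"
  using smooth_manifold_charts(2)[OF M lchart(1)] .

lemma lmap_inj: "inj_on (lmap M p) (lnbh M p)"
  using smooth_manifold_charts(3)[OF M lchart(1)] .

lemma lmap_in: "q \<in> lnbh M p \<Longrightarrow> lmap M p q \<in> model M"
  using smooth_manifold_charts(4)[OF M lchart(1)] openin_imp_subset by blast

lemma model: "subspace (model M)"
  using smooth_manifold_charts(1)[OF M] .

lemma lmap_proj_in: "lmap M p p + proj (model M) x \<in> model M"
  using lmap_in lchart model proj_in by (blast intro: subspace_add)

lemma open_vimage_lmap:
  assumes "openin (top_of_set (model M)) T"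
  shows "open {x. lmap M p p + proj (model M) x \<in> T}"
proof -
  obtain T' where T': "open T'" "T = model M \<inter> T'" using assms by (auto simp: openin_open)
  then have "{x. lmap M p p + proj (model M) x \<in> T} = (\<lambda>x. lmap M p p + proj (model M) x) -` T'"
    using lmap_proj_in by auto
  moreover have "continuous_on UNIV (\<lambda>x. lmap M p p + proj (model M) x)"
    using bounded_linear_proj[OF model] by (intro continuous_intros linear_continuous_on)
  ultimately show ?thesis using open_vimage[OF T'(1)] by simp
qed

lemma open_ldom: "open (ldom M p)"
  unfolding ldom_def by (rule open_vimage_lmap[OF smooth_manifold_charts(4)[OF M lchart(1)]])

lemma zero_ldom: "0 \<in> ldom M p"
  using lchart(2) linear_0[OF linear_proj[OF model]] by (simp add: ldom_def)

lemma lpar_in: "x \<in> ldom M p \<Longrightarrow> lpar M p x \<in> lnbh M p"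
  unfolding lpar_def ldom_def by (auto intro: inv_into_into)

lemma lpar_closed: "lpar M p x \<in> carrier M"
  using lpar_in[of x] lnbh_subset p by (cases "x \<in> ldom M p") (auto simp: lpar_def)

lemma lmap_lpar: "x \<in> ldom M p \<Longrightarrow> lmap M p (lpar M p x) = lmap M p p + proj (model M) x"
  unfolding lpar_def ldom_def by (auto intro: f_inv_into_f)

lemma lcoord_lpar: "x \<in> ldom M p \<Longrightarrow> lcoord M p (lpar M p x) = proj (model M) x"
  by (simp add: lcoord_def lmap_lpar)

lemma lpar_zero: "lpar M p 0 = p"
  using zero_ldom lchart(2) linear_0[OF linear_proj[OF model]] lmap_inj by (simp add: lpar_def)

lemma lcoord_in: "q \<in> lnbh M p \<Longrightarrow> lcoord M p q \<in> model M \<inter> ldom M p"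
proof -
  assume q: "q \<in> lnbh M p"
  then have 1: "lcoord M p q \<in> model M"
    using lmap_in lchart(2) model by (auto simp: lcoord_def intro: subspace_diff)
  then have "lcoord M p q \<in> ldom M p"
    using q proj_id[OF model 1] by (simp add: ldom_def lcoord_def)
  with 1 show ?thesis by blast
qed

lemma lpar_lcoord: "q \<in> lnbh M p \<Longrightarrow> lpar M p (lcoord M p q) = q"
proof -
  assume q: "q \<in> lnbh M p"
  have "lpar M p (lcoord M p q) = inv_into (lnbh M p) (lmap M p) (lmap M p q)"
    using lcoord_in[OF q] proj_id[OF model, of "lcoord M p q"] by (simp add: lpar_def lcoord_def)
  then show ?thesis using q lmap_inj by simp
qed

lemma lpar_inj:
  "x \<in> model M \<inter> ldom M p \<Longrightarrow> y \<in> model M \<inter> ldom M p \<Longrightarrow> lpar M p x = lpar M p y \<Longrightarrow> x = y"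
  using lcoord_lpar proj_id[OF model] by (metis IntD1 IntD2)

lemma lcoord_self: "lcoord M p p = 0"
  by (simp add: lcoord_def)

lemma smooth_affine: "smooth S (\<lambda>x. lmap M p p + proj (model M) x)"
  by (intro smooth_on_add smooth_on_const smooth_on_bounded_linear[OF bounded_linear_proj[OF model]] smooth_on_ident)

lemma smooth_fun_lpar:
  assumes "smooth_fun M f"
  shows "smooth (ldom M p) (\<lambda>x. f (lpar M p x))"
proof -
  have "smooth (lmap M p ` lnbh M p) (f \<circ> inv_into (lnbh M p) (lmap M p))"
    using smooth_fun_charts[OF assms lchart(1)] smooth_on_UNIV[OF model]
      openin_imp_subset[OF smooth_manifold_charts(4)[OF M lchart(1)]] by blast
  from smooth_on_compose[OF smooth_affine this] show ?thesis
    by (rule smooth_on_cong) (auto simp: ldom_def lpar_def)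
qed

lemma smooth_map_lpar:
  assumes F: "smooth_map M N F" and W: "(W, \<theta>) \<in> charts N"
  defines "D \<equiv> {x \<in> ldom M p. F (lpar M p x) \<in> W}"
  shows "open D" "smooth D (\<lambda>x. \<theta> (F (lpar M p x)))"
proof -
  let ?U = "lnbh M p" and ?\<phi> = "lmap M p"
  note 1 = smooth_map_charts[OF F lchart(1) W]
  have D: "D = {x. lmap M p p + proj (model M) x \<in> ?\<phi> ` (?U \<inter> F -` W)}"
    unfolding D_def using lmap_inj lpar_in lmap_lpar
    by (auto simp: ldom_def lpar_def inj_on_image_mem_iff)
  show "open D" unfolding D by (rule open_vimage_lmap[OF 1(1)])
  have "smooth (?\<phi> ` (?U \<inter> F -` W)) (\<theta> \<circ> F \<circ> inv_into ?U ?\<phi>)"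
    using 1 smooth_on_UNIV[OF model] openin_imp_subset by blast
  from smooth_on_compose[OF smooth_affine this, of D]
  have "smooth D (\<lambda>x. (\<theta> \<circ> F \<circ> inv_into ?U ?\<phi>) (lmap M p p + proj (model M) x))"
    unfolding D by blast
  then show "smooth D (\<lambda>x. \<theta> (F (lpar M p x)))"
    by (rule smooth_on_cong) (auto simp: D_def lpar_def)
qed

end

lemma smooth_map_lcoord:
  assumes "smooth_manifold M" "p \<in> carrier M" "smooth_manifold N" "q \<in> carrier N" "smooth_map M N F"
  defines "D \<equiv> {x \<in> ldom M p. F (lpar M p x) \<in> lnbh N q}"
  shows "open D" "smooth D (\<lambda>x. lcoord N q (F (lpar M p x)))"
  using smooth_map_lpar[OF assms(1,2,5) lchart(1)[OF assms(3,4)]]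
  unfolding D_def lcoord_def by (auto intro!: smooth_on_diff smooth_on_const)

lemma smooth_map_id: "smooth_manifold M \<Longrightarrow> smooth_map M M (\<lambda>x. x)"
  using smooth_manifold_transition[of M] unfolding smooth_map_def by (auto simp: o_def)

text \<open>The chart that \<open>lchart\<close> selects on a product need not be the product of the
  selected charts. Hence the product chart is used directly, with a pair of
  parametrisations.\<close>

lemma smooth_map_prod_lcoord:
  fixes M :: "('a, 'e::euclidean_space, 'x) manifold_scheme"
    and N :: "('b, 'f::euclidean_space, 'y) manifold_scheme"
    and K :: "('c, 'g::euclidean_space, 'z) manifold_scheme"
  assumes M: "smooth_manifold M" "p \<in> carrier M" and N: "smooth_manifold N" "q \<in> carrier N"
    and K: "smooth_manifold K" "r \<in> carrier K" and F: "smooth_map (prod_manifold M N) K F"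
  defines "D \<equiv> {(x, y). x \<in> ldom M p \<and> y \<in> ldom N q \<and> F (lpar M p x, lpar N q y) \<in> lnbh K r}"
  shows "open D" "smooth D (\<lambda>(x, y). lcoord K r (F (lpar M p x, lpar N q y)))"
proof -
  let ?U = "lnbh M p" and ?\<phi> = "lmap M p" and ?W = "lnbh N q" and ?\<theta> = "lmap N q" and ?Z = "lnbh K r"
  let ?P = "prod_manifold M N" and ?T = "map_prod (lmap M p) (lmap N q) ` (lnbh M p \<times> lnbh N q \<inter> F -` lnbh K r)"
  let ?G = "lmap K r \<circ> F \<circ> inv_into (?U \<times> ?W) (map_prod ?\<phi> ?\<theta>)"
  have ch: "(?U \<times> ?W, map_prod ?\<phi> ?\<theta>) \<in> charts ?P"
    using lchart(1)[OF M] lchart(1)[OF N] unfolding prod_manifold_def by auto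
  have mod: "model ?P = model M \<times> model N" by (simp add: prod_manifold_def)
  have V: "subspace (model M \<times> model N)"
    using model[OF M] model[OF N] by (rule subspace_Times)
  have 1: "openin (top_of_set (model M \<times> model N)) ?T" "smooth_on (model M \<times> model N) ?T ?G"
    using smooth_map_charts[OF F ch lchart(1)[OF K]] unfolding mod by auto
  then have 2: "smooth ?T ?G"
    using smooth_on_UNIV[OF V] openin_imp_subset by blast
  let ?a = "\<lambda>z. (?\<phi> p + proj (model M) (fst z), ?\<theta> q + proj (model N) (snd z))"
  have inj: "inj_on (map_prod ?\<phi> ?\<theta>) (?U \<times> ?W)"
    using lmap_inj[OF M] lmap_inj[OF N] by (rule map_prod_inj_on)
  have par: "map_prod ?\<phi> ?\<theta> (lpar M p x, lpar N q y) = ?a (x, y)" "(lpar M p x, lpar N q y) \<in> ?U \<times> ?W"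
    if "x \<in> ldom M p" "y \<in> ldom N q" for x y
    using lmap_lpar[OF M that(1)] lmap_lpar[OF N that(2)] lpar_in[OF M that(1)] lpar_in[OF N that(2)] by auto
  then have inv: "inv_into (?U \<times> ?W) (map_prod ?\<phi> ?\<theta>) (?a (x, y)) = (lpar M p x, lpar N q y)"
    if "x \<in> ldom M p" "y \<in> ldom N q" for x y
    using inv_into_f_f[OF inj] that by metis
  have D: "D = ?a -` ?T"
  proof (rule Set.set_eqI)
    fix z :: "'e \<times> 'f"
    obtain x y where z: "z = (x, y)" by force
    show "z \<in> D \<longleftrightarrow> z \<in> ?a -` ?T"
    proof
      assume "z \<in> D"
      then show "z \<in> ?a -` ?T" using par[of x y] unfolding D_def z
        by (auto intro!: image_eqI[of _ _ "(lpar M p x, lpar N q y)"])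
    next
      assume "z \<in> ?a -` ?T"
      then obtain s t where st: "s \<in> ?U" "t \<in> ?W" "F (s, t) \<in> ?Z" "?\<phi> s = ?\<phi> p + proj (model M) x"
        "?\<theta> t = ?\<theta> q + proj (model N) y"
        unfolding z by auto
      then have d: "x \<in> ldom M p" "y \<in> ldom N q" unfolding ldom_def by (metis image_eqI mem_Collect_eq)+
      then have "lpar M p x = s" "lpar N q y = t"
        using st lmap_inj[OF M] lmap_inj[OF N] by (simp_all add: lpar_def flip: st(4,5))
      then show "z \<in> D" using st d unfolding D_def z by simp
    qed
  qed
  have bl: "bounded_linear (\<lambda>z. proj (model M) (fst z))" "bounded_linear (\<lambda>z. proj (model N) (snd z))"
    using bounded_linear_compose[OF bounded_linear_proj[OF model[OF M]] bounded_linear_fst]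
      bounded_linear_compose[OF bounded_linear_proj[OF model[OF N]] bounded_linear_snd] by auto
  have sa: "smooth S ?a" for S
    by (intro smooth_on_Pair smooth_on_add smooth_on_const smooth_on_bounded_linear[OF bl(1) smooth_on_ident]
         smooth_on_bounded_linear[OF bl(2) smooth_on_ident])
  obtain T' where T': "open T'" "?T = (model M \<times> model N) \<inter> T'" using 1(1) by (auto simp: openin_open)
  have "?a z \<in> model M \<times> model N" for z using lmap_proj_in[OF M] lmap_proj_in[OF N] by auto
  then have "D = ?a -` T'" unfolding D T'(2) by blast
  then show "open D" using open_vimage[OF T'(1) smooth_on_continuous[OF sa]] by simp
  have "smooth D (\<lambda>z. ?G (?a z) - lmap K r r)"
    by (intro smooth_on_diff smooth_on_const smooth_on_compose[OF sa 2]) (auto simp: D)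
  then show "smooth D (\<lambda>(x, y). lcoord K r (F (lpar M p x, lpar N q y)))"
  proof (rule smooth_on_cong)
    fix z assume "z \<in> D"
    then obtain x y where "z = (x, y)" "x \<in> ldom M p" "y \<in> ldom N q" by (auto simp: D_def)
    then show "?G (?a z) - lmap K r r = (case z of (x, y) \<Rightarrow> lcoord K r (F (lpar M p x, lpar N q y)))"
      using inv[of x y] by (simp add: lcoord_def)
  qed
qed

text \<open>Smoothness has to be shown in every chart of the atlas. Around each point the given
  chart is compared with the selected one by a transition map, and the local statements are
  glued.\<close>

lemma smooth_funI:
  assumes M: "smooth_manifold M"
    and loc: "\<And>p. p \<in> carrier M \<Longrightarrow> \<exists>D. open D \<and> 0 \<in> D \<and> smooth D (\<lambda>x. f (lpar M p x))"
  shows "smooth_fun M f"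
  unfolding smooth_fun_def
proof safe
  fix U \<phi> assume ch: "(U, \<phi>) \<in> charts M"
  note V = smooth_manifold_charts(1)[OF M]
  note inj = smooth_manifold_charts(3)[OF M ch]
  note op = smooth_manifold_charts(4)[OF M ch]
  have "smooth (\<phi> ` U) (f \<circ> inv_into U \<phi>)"
  proof (rule smooth_on_glue[OF V op])
    fix z assume "z \<in> \<phi> ` U"
    then obtain p where p: "p \<in> U" "z = \<phi> p" by blast
    have pM: "p \<in> carrier M" using p smooth_manifold_charts(2)[OF M ch] by blast
    note c = lchart[OF M pM]
    obtain D where D: "open D" "0 \<in> D" "smooth D (\<lambda>x. f (lpar M p x))" using loc[OF pM] by blast
    define A where "A = \<phi> ` (U \<inter> lnbh M p)"
    have A: "openin (top_of_set (model M)) A" "smooth_on (model M) A (lmap M p \<circ> inv_into U \<phi>)"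
      using smooth_manifold_transition[OF M ch c(1)] unfolding A_def by auto
    have sA: "smooth A (\<lambda>x. (lmap M p \<circ> inv_into U \<phi>) x - lmap M p p)"
      using A smooth_on_UNIV[OF V] openin_imp_subset by (intro smooth_on_diff smooth_on_const) blast
    define W where "W = A \<inter> (\<lambda>x. (lmap M p \<circ> inv_into U \<phi>) x - lmap M p p) -` D"
    have "openin (top_of_set (model M)) W"
    proof -
      have "openin (top_of_set A) W"
        unfolding W_def by (rule continuous_openin_preimage_gen[OF smooth_on_continuous[OF sA] D(1)])
      then show ?thesis using A(1) openin_trans by blast
    qed
    moreover have "z \<in> W"
      using p c(2) inj D(2) by (auto simp: W_def A_def)
    moreover have "smooth (\<phi> ` U \<inter> W) (f \<circ> inv_into U \<phi>)"
    proof -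
      have "smooth W (\<lambda>x. f (lpar M p ((lmap M p \<circ> inv_into U \<phi>) x - lmap M p p)))"
        by (rule smooth_on_compose[OF smooth_on_subset[OF sA] D(3)]) (auto simp: W_def)
      then have "smooth W (f \<circ> inv_into U \<phi>)"
      proof (rule smooth_on_cong)
        fix x assume "x \<in> W"
        then obtain q where q: "q \<in> U" "q \<in> lnbh M p" "x = \<phi> q" by (auto simp: W_def A_def)
        then have "inv_into U \<phi> x = q" using inj by simp
        then show "f (lpar M p ((lmap M p \<circ> inv_into U \<phi>) x - lmap M p p)) = (f \<circ> inv_into U \<phi>) x"
          using lpar_lcoord[OF M pM q(2)] by (simp add: lcoord_def)
      qed
      then show ?thesis by (rule smooth_on_subset) auto
    qed
    ultimately show "\<exists>W. openin (top_of_set (model M)) W \<and> z \<in> W \<and> smooth (\<phi> ` U \<inter> W) (f \<circ> inv_into U \<phi>)"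
      by blast
  qed
  then show "smooth_on (model M) (\<phi> ` U) (f \<circ> inv_into U \<phi>)"
    using smooth_on_UNIV[OF V] openin_imp_subset[OF op] by blast
qed

lemma smooth_fun_compose:
  assumes M: "smooth_manifold M" and N: "smooth_manifold N" and F: "smooth_map M N F" and f: "smooth_fun N f"
  shows "smooth_fun M (\<lambda>x. f (F x))"
proof (rule smooth_funI[OF M])
  fix p assume p: "p \<in> carrier M"
  then have q: "F p \<in> carrier N" by (rule smooth_map_in[OF F])
  note D = smooth_map_lcoord[OF M p N q F]
  let ?D = "{x \<in> ldom M p. F (lpar M p x) \<in> lnbh N (F p)}"
  have "smooth ?D (\<lambda>x. f (lpar N (F p) (lcoord N (F p) (F (lpar M p x)))))"
    by (rule smooth_on_compose[OF D(2) smooth_fun_lpar[OF N q f]]) (use lcoord_in[OF N q] in auto)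
  then have "smooth ?D (\<lambda>x. f (F (lpar M p x)))"
    by (rule smooth_on_cong) (simp add: lpar_lcoord[OF N q])
  moreover have "0 \<in> ?D" using zero_ldom[OF M p] lchart(2)[OF N q] by (simp add: lpar_zero[OF M p])
  ultimately show "\<exists>D. open D \<and> 0 \<in> D \<and> smooth D (\<lambda>x. f (F (lpar M p x)))"
    using D(1) by blast
qed

section \<open>The manifold topology in coordinates\<close>

lemma topspace_manifold:
  assumes M: "smooth_manifold M"
  shows "topspace (manifold_topology M) = carrier M"
proof -
  have "\<Union> {U \<inter> \<phi> -` T | U \<phi> T. (U, \<phi>) \<in> charts M \<and> open T} = (\<Union>(U, \<phi>)\<in>charts M. U)"
    (is "?L = ?R")
  proof
    show "?R \<subseteq> ?L"
    proof
      fix x assume "x \<in> ?R"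
      then obtain U \<phi> where "(U, \<phi>) \<in> charts M" "x \<in> U \<inter> \<phi> -` UNIV" by auto
      then show "x \<in> ?L" using open_UNIV by blast
    qed
  qed auto
  moreover have "?R = carrier M" using M unfolding smooth_manifold_def by blast
  ultimately show ?thesis unfolding manifold_topology_def by simp
qed

lemma openin_manifoldI:
  assumes M: "smooth_manifold M" and W: "W \<subseteq> carrier M"
    and loc: "\<And>p. p \<in> W \<Longrightarrow> \<exists>r>0. \<forall>x\<in>model M. norm x < r \<longrightarrow> lpar M p x \<in> W"
  shows "openin (manifold_topology M) W"
proof (subst openin_subopen, rule ballI)
  fix p assume p: "p \<in> W"
  then have pM: "p \<in> carrier M" using W by blast
  obtain r where r: "r > 0" "\<And>x. x \<in> model M \<Longrightarrow> norm x < r \<Longrightarrow> lpar M p x \<in> W" using loc[OF p] by blast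
  let ?T = "lnbh M p \<inter> lmap M p -` ball (lmap M p p) r"
  have "openin (manifold_topology M) ?T"
    unfolding manifold_topology_def
    by (rule topology_generated_by_Basis) (use lchart(1)[OF M pM] in auto)
  moreover have "p \<in> ?T" using lchart(2)[OF M pM] r(1) by simp
  moreover have "?T \<subseteq> W"
  proof
    fix q assume q: "q \<in> ?T"
    then have "norm (lcoord M p q) < r" by (simp add: lcoord_def dist_norm norm_minus_commute)
    then show "q \<in> W" using r(2)[of "lcoord M p q"] lcoord_in[OF M pM, of q] lpar_lcoord[OF M pM, of q] q by simp
  qed
  ultimately show "\<exists>T. openin (manifold_topology M) T \<and> p \<in> T \<and> T \<subseteq> W" by blast
qed

lemma continuous_map_lpar:
  assumes M: "smooth_manifold M" and p: "p \<in> carrier M" and A: "A \<subseteq> ldom M p"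
  shows "continuous_map (top_of_set A) (manifold_topology M) (lpar M p)"
  unfolding manifold_topology_def continuous_on_generated_topo_iff
proof (intro conjI allI impI)
  fix Q assume "Q \<in> {U \<inter> \<phi> -` T | U \<phi> T. (U, \<phi>) \<in> charts M \<and> open T}"
  then obtain U \<phi> T where Q: "Q = U \<inter> \<phi> -` T" "(U, \<phi>) \<in> charts M" "open T" by blast
  note D = smooth_map_lpar[OF M p smooth_map_id[OF M] Q(2)]
  have "open ({x \<in> ldom M p. lpar M p x \<in> U} \<inter> (\<lambda>x. \<phi> (lpar M p x)) -` T)"
    by (rule continuous_open_preimage[OF smooth_on_continuous[OF D(2)] D(1) Q(3)])
  moreover have "lpar M p -` Q \<inter> topspace (top_of_set A)
      = A \<inter> ({x \<in> ldom M p. lpar M p x \<in> U} \<inter> (\<lambda>x. \<phi> (lpar M p x)) -` T)"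
    using A by (auto simp: Q(1))
  ultimately show "openin (top_of_set A) (lpar M p -` Q \<inter> topspace (top_of_set A))"
    using openin_open_Int by metis
next
  have "\<Union> {U \<inter> \<phi> -` T | U \<phi> T. (U, \<phi>) \<in> charts M \<and> open T} = carrier M"
    using topspace_manifold[OF M] unfolding manifold_topology_def by simp
  then show "lpar M p ` topspace (top_of_set A) \<subseteq> \<Union> {U \<inter> \<phi> -` T | U \<phi> T. (U, \<phi>) \<in> charts M \<and> open T}"
    using lpar_closed[OF M p] by auto
qed

lemma eventually_notin_closed:
  assumes M: "smooth_manifold M" and q: "q \<in> carrier M" and K: "closedin (manifold_topology M) K" "q \<notin> K"
  obtains D where "open D" "0 \<in> D" "\<And>x. x \<in> D \<Longrightarrow> lpar M q x \<notin> K"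
proof -
  have "openin (manifold_topology M) (carrier M - K)"
    using K(1) openin_diff[OF openin_topspace] topspace_manifold[OF M] by metis
  from openin_continuous_map_preimage[OF continuous_map_lpar[OF M q order_refl] this]
  have "openin (top_of_set (ldom M q)) {x \<in> ldom M q. lpar M q x \<in> carrier M - K}" by simp
  then have "open {x \<in> ldom M q. lpar M q x \<in> carrier M - K}"
    using open_ldom[OF M q] openin_open_trans by blast
  moreover have "0 \<in> {x \<in> ldom M q. lpar M q x \<in> carrier M - K}"
    using zero_ldom[OF M q] K(2) q by (simp add: lpar_zero[OF M q])
  ultimately show ?thesis using that by blast
qed

section \<open>Extension of local functions by zero, and derivations at a point\<close>

definition lextend :: "('a, 'e::euclidean_space, 'z) manifold_scheme \<Rightarrow> 'a \<Rightarrow> ('e \<Rightarrow> real) \<Rightarrow> 'a \<Rightarrow> real" where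
  "lextend M p f q = (if q \<in> lnbh M p then f (lcoord M p q) else 0)"

text \<open>The support lies in the image \<open>K\<close> of a compact ball, which is closed
  because the topology is Hausdorff. Off \<open>K\<close> the function is locally zero; around a
  point of \<open>K\<close> it is a smooth coordinate expression, as \<open>r1 < r\<close> leaves
  room.\<close>

lemma lextend_smooth:
  assumes M: "smooth_manifold M" and p: "p \<in> carrier M"
    and r: "r1 < r" "ball 0 r \<subseteq> ldom M p" and f: "smooth (ball 0 r) f" "\<And>x. norm x \<ge> r1 \<Longrightarrow> f x = 0"
  shows "lextend M p f \<in> smooth_funs M"
proof -
  define K where "K = lpar M p ` (model M \<inter> cball 0 r1)"
  have K: "closedin (manifold_topology M) K"
  proof (rule compactin_imp_closedin)
    show "Hausdorff_space (manifold_topology M)" using M by (simp add: smooth_manifold_def)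
    have "model M \<inter> cball 0 r1 \<subseteq> ldom M p" using r by auto
    moreover have "compactin (top_of_set (model M \<inter> cball 0 r1)) (model M \<inter> cball 0 r1)"
      using compact_Int_closed[of "cball 0 r1" "model M"] closed_subspace[OF model[OF M p]]
      by (simp add: compactin_subtopology Int_commute)
    ultimately show "compactin (manifold_topology M) K"
      unfolding K_def using image_compactin continuous_map_lpar[OF M p] by blast
  qed
  have zero: "lextend M p f q = 0" if "q \<notin> K" for q
  proof (cases "q \<in> lnbh M p")
    case True
    have "\<not> norm (lcoord M p q) \<le> r1"
    proof
      assume "norm (lcoord M p q) \<le> r1"
      then have "q \<in> K" unfolding K_def
        using lcoord_in[OF M p True] lpar_lcoord[OF M p True] by (intro image_eqI[of _ _ "lcoord M p q"]) auto
      then show False using that by blast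
    qed
    then show ?thesis using f(2) by (simp add: lextend_def)
  qed (simp add: lextend_def)
  have "smooth_fun M (lextend M p f)"
  proof (rule smooth_funI[OF M])
    fix q assume q: "q \<in> carrier M"
    show "\<exists>D. open D \<and> 0 \<in> D \<and> smooth D (\<lambda>x. lextend M p f (lpar M q x))"
    proof (cases "q \<in> K")
      case False
      obtain D where D: "open D" "0 \<in> D" "\<And>x. x \<in> D \<Longrightarrow> lpar M q x \<notin> K"
        using eventually_notin_closed[OF M q K False] by blast
      have "smooth D (\<lambda>x. lextend M p f (lpar M q x))"
        by (rule smooth_on_cong[OF smooth_on_const[of _ _ 0]]) (simp add: zero D(3))
      then show ?thesis using D by blast
    next
      case True
      then obtain x0 where x0: "x0 \<in> model M" "norm x0 \<le> r1" "q = lpar M p x0" by (auto simp: K_def)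
      have x0d: "x0 \<in> ldom M p" using x0(2) r by auto
      have qp: "q \<in> lnbh M p" "lcoord M p q = x0"
        using lpar_in[OF M p x0d] lcoord_lpar[OF M p x0d] proj_id[OF model[OF M p] x0(1)] by (auto simp: x0(3))
      note T = smooth_map_lcoord[OF M q M p smooth_map_id[OF M]]
      let ?D = "{x \<in> ldom M q. lpar M q x \<in> lnbh M p}"
      let ?D' = "?D \<inter> (\<lambda>x. lcoord M p (lpar M q x)) -` ball 0 r"
      have "open ?D'" by (rule continuous_open_preimage[OF smooth_on_continuous[OF T(2)] T(1) open_ball])
      moreover have "0 \<in> ?D'"
        using zero_ldom[OF M q] qp x0(2) r(1) by (simp add: lpar_zero[OF M q])
      moreover have "smooth ?D' (\<lambda>x. lextend M p f (lpar M q x))"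
      proof (rule smooth_on_cong)
        show "smooth ?D' (\<lambda>x. f (lcoord M p (lpar M q x)))"
          by (rule smooth_on_compose[OF smooth_on_subset[OF T(2)] f(1)]) auto
      qed (simp add: lextend_def)
      ultimately show ?thesis by blast
    qed
  qed
  moreover have "lextend M p f x = 0" if "x \<notin> carrier M" for x
    using that lnbh_subset[OF M p] by (auto simp: lextend_def)
  ultimately show ?thesis by (simp add: smooth_funs_def)
qed

lemma smooth_funs_add: "f \<in> smooth_funs M \<Longrightarrow> h \<in> smooth_funs M \<Longrightarrow> (\<lambda>x. f x + h x) \<in> smooth_funs M"
  unfolding smooth_funs_def smooth_fun_def o_def by (fastforce intro: smooth_on_add)

lemma smooth_funs_mult: "f \<in> smooth_funs M \<Longrightarrow> h \<in> smooth_funs M \<Longrightarrow> (\<lambda>x. f x * h x) \<in> smooth_funs M"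
  unfolding smooth_funs_def smooth_fun_def o_def by (fastforce intro: smooth_on_mult)

lemma smooth_funs_zero: "(\<lambda>x. 0) \<in> smooth_funs M"
  unfolding smooth_funs_def smooth_fun_def o_def by (auto intro: smooth_on_const)

lemma smooth_funs_scale: "f \<in> smooth_funs M \<Longrightarrow> (\<lambda>x. c * f x) \<in> smooth_funs M"
  unfolding smooth_funs_def smooth_fun_def o_def
  by (fastforce intro: smooth_on_bounded_linear[OF bounded_linear_mult_right])

lemma
  assumes "v \<in> tangent_space M p" "f \<in> smooth_funs M"
  shows tangent_add: "h \<in> smooth_funs M \<Longrightarrow> v (\<lambda>x. f x + h x) = v f + v h"
    and tangent_mult: "h \<in> smooth_funs M \<Longrightarrow> v (\<lambda>x. f x * h x) = f p * v h + h p * v f"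
    and tangent_scale: "v (\<lambda>x. c * f x) = c * v f"
  using assms unfolding tangent_space_def by simp_all

lemma tangent_sum:
  assumes v: "v \<in> tangent_space M p" and "finite I" "\<And>i. i \<in> I \<Longrightarrow> f i \<in> smooth_funs M"
  shows "(\<lambda>x. \<Sum>i\<in>I. f i x) \<in> smooth_funs M \<and> v (\<lambda>x. \<Sum>i\<in>I. f i x) = (\<Sum>i\<in>I. v (f i))"
  using assms(2,3)
proof (induction I)
  case empty
  show ?case using tangent_scale[OF v smooth_funs_zero, of 0] smooth_funs_zero by simp
next
  case (insert i I)
  then have "v (\<lambda>x. f i x + (\<Sum>i\<in>I. f i x)) = v (f i) + v (\<lambda>x. \<Sum>i\<in>I. f i x)"
    by (intro tangent_add[OF v]) auto
  then show ?case using insert smooth_funs_add[of "f i" M] by simp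
qed

text \<open>Derivations see only the first derivative at \<open>p\<close>. By
  \<open>Hadamard\<close>, \<open>h\<close> is near \<open>p\<close> a sum of products of two
  functions vanishing at \<open>p\<close>, and the product rule annihilates these. Bump factors turn
  the local identity into one between global smooth functions.\<close>

lemma tangent_eq_zero:
  fixes M :: "('a, 'e::euclidean_space, 'z) manifold_scheme"
  assumes M: "smooth_manifold M" and p: "p \<in> carrier M" and v: "v \<in> tangent_space M p"
    and h: "h \<in> smooth_funs M" "h p = 0" "\<And>b. \<partial> (\<lambda>x. h (lpar M p x)) 0 b = 0"
  shows "v h = 0"
proof -
  obtain r where r: "r > 0" "ball 0 r \<subseteq> ldom M p"
    using open_ldom[OF M p] zero_ldom[OF M p] open_contains_ball by blast
  have sH: "smooth (ball 0 r) (\<lambda>x. h (lpar M p x))"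
    using smooth_on_subset[OF smooth_fun_lpar[OF M p] r(2)] h(1) by (simp add: smooth_funs_def)
  obtain g where g: "\<And>b. smooth (ball 0 r) (g b)" "\<And>b. g b 0 = 0"
    "\<And>x. x \<in> ball 0 r \<Longrightarrow> h (lpar M p x) = (\<Sum>b\<in>Basis. (x \<bullet> b) * g b x)"
    using Hadamard[OF sH r(1)] h(2,3) by (auto simp: lpar_zero[OF M p])
  have "r / 2 > 0" using r by simp
  then obtain \<beta> :: "'e \<Rightarrow> real" and s where \<beta>: "smooth UNIV \<beta>" "0 < s" "s < r / 2"
    "\<And>x. norm x \<le> s \<Longrightarrow> \<beta> x = 1" "\<And>x. norm x \<ge> r / 2 \<Longrightarrow> \<beta> x = 0"
    by (rule ex_bump) (rule that)
  have s\<beta>: "smooth (ball 0 r) \<beta>" using \<beta>(1) smooth_on_subset by blast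
  have si: "smooth (ball 0 r) (\<lambda>x. x \<bullet> b)" for b :: 'e
    by (rule smooth_on_bounded_linear[OF bounded_linear_inner_left smooth_on_ident])
  have rr: "r / 2 < r" using r by simp
  define c where "c b = lextend M p (\<lambda>x. \<beta> x * (x \<bullet> b))" for b
  define \<gamma> where "\<gamma> b = lextend M p (\<lambda>x. \<beta> x * g b x)" for b
  define B where "B = lextend M p \<beta>"
  have c: "c b \<in> smooth_funs M" for b unfolding c_def
    by (rule lextend_smooth[OF M p rr r(2) smooth_on_mult[OF s\<beta> si]]) (simp add: \<beta>(5))
  have \<gamma>: "\<gamma> b \<in> smooth_funs M" for b unfolding \<gamma>_def
    by (rule lextend_smooth[OF M p rr r(2) smooth_on_mult[OF s\<beta> g(1)]]) (simp add: \<beta>(5))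
  have B: "B \<in> smooth_funs M" unfolding B_def
    by (rule lextend_smooth[OF M p rr r(2) s\<beta>]) (simp add: \<beta>(5))
  have at_p: "c b p = 0" "\<gamma> b p = 0" "B p = 1" for b
    using lchart(2)[OF M p] \<beta>(2,4) by (simp_all add: c_def \<gamma>_def B_def lextend_def lcoord_self[OF M p] g(2))
  \<comment> \<open>Two bump factors are needed, one for each factor of the products. They do not
    change the value of \<open>v\<close>, because \<open>B p = 1\<close> and
    \<open>h p = 0\<close>.\<close>
  have eq: "(\<lambda>q. B q * (B q * h q)) = (\<lambda>q. \<Sum>b\<in>Basis. c b q * \<gamma> b q)"
  proof
    fix q
    show "B q * (B q * h q) = (\<Sum>b\<in>Basis. c b q * \<gamma> b q)"
    proof (cases "q \<in> lnbh M p")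
      case True
      let ?x = "lcoord M p q"
      show ?thesis
      proof (cases "norm ?x < r")
        case t: True
        have "h q = (\<Sum>b\<in>Basis. (?x \<bullet> b) * g b ?x)"
          using g(3)[of ?x] t lpar_lcoord[OF M p True] by simp
        then show ?thesis using True
          by (simp add: B_def c_def \<gamma>_def lextend_def sum_distrib_left algebra_simps)
      next
        case False
        then have "\<beta> ?x = 0" using \<beta>(5) rr by simp
        then show ?thesis using True by (simp add: B_def c_def \<gamma>_def lextend_def)
      qed
    qed (simp add: B_def c_def \<gamma>_def lextend_def)
  qed
  note mult = tangent_mult[OF v]
  have "v (\<lambda>q. B q * (B q * h q)) = v h"
    using mult[OF B smooth_funs_mult[OF B h(1)]] mult[OF B h(1)] h(2) at_p by simp
  moreover have "v (\<lambda>q. \<Sum>b\<in>Basis. c b q * \<gamma> b q) = (\<Sum>b\<in>Basis. v (\<lambda>q. c b q * \<gamma> b q))"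
    using tangent_sum[OF v, of Basis "\<lambda>b q. c b q * \<gamma> b q"] smooth_funs_mult[OF c \<gamma>] by simp
  ultimately show ?thesis using eq mult[OF c \<gamma>] at_p by simp
qed

subsection \<open>Lie groups in coordinates\<close>

abbreviation "lone G \<equiv> \<one>\<^bsub>grp G\<^esub>"
abbreviation "epar G \<equiv> lpar G (lone G)"

lemma smooth_fun_cong:
  assumes M: "smooth_manifold M" and f: "smooth_fun M f" and eq: "\<And>x. x \<in> carrier M \<Longrightarrow> f x = g x"
  shows "smooth_fun M g"
  unfolding smooth_fun_def
proof safe
  fix U \<phi> assume ch: "(U, \<phi>) \<in> charts M"
  show "smooth_on (model M) (\<phi> ` U) (g \<circ> inv_into U \<phi>)"
  proof (rule smooth_on_cong[OF smooth_fun_charts[OF f ch]])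
    fix x assume "x \<in> \<phi> ` U"
    then have "inv_into U \<phi> x \<in> carrier M"
      using smooth_manifold_charts(2)[OF M ch] inv_into_into by (metis subsetD)
    then show "(f \<circ> inv_into U \<phi>) x = (g \<circ> inv_into U \<phi>) x" using eq by simp
  qed
qed

lemma smooth_funs_restrict:
  assumes "smooth_manifold M" "smooth_fun M f"
  shows "(\<lambda>x. if x \<in> carrier M then f x else 0) \<in> smooth_funs M"
  using smooth_fun_cong[OF assms] by (simp add: smooth_funs_def)

lemma lpar_proj:
  assumes "smooth_manifold M" "p \<in> carrier M"
  shows "lpar M p (proj (model M) x) = lpar M p x"
  by (simp add: lpar_def ldom_def proj_proj[OF model[OF assms]])

lemma
  assumes "lie_group G"
  shows lie_manifold: "smooth_manifold G" and lie_grp: "group (grp G)"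
    and lie_carrier: "carrier (grp G) = carrier G"
    and lie_mult_smooth_map: "smooth_map (prod_manifold G G) G (\<lambda>(x, y). x \<otimes>\<^bsub>grp G\<^esub> y)"
    and lie_inv_smooth_map: "smooth_map G G (\<lambda>x. inv\<^bsub>grp G\<^esub> x)"
  using assms unfolding lie_group_def by blast+

lemma
  assumes G: "lie_group G"
  shows lie_one_closed: "(lone G) \<in> carrier G"
    and lie_mult_closed: "x \<in> carrier G \<Longrightarrow> y \<in> carrier G \<Longrightarrow> x \<otimes>\<^bsub>grp G\<^esub> y \<in> carrier G"
    and lie_inv_closed: "x \<in> carrier G \<Longrightarrow> inv\<^bsub>grp G\<^esub> x \<in> carrier G"
  using lie_grp[OF G] unfolding lie_carrier[OF G, symmetric]
  by (simp_all add: group.inv_closed group.is_monoid monoid.m_closed monoid.one_closed)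

lemma lie_mult_lcoord:
  assumes G: "lie_group G" and p: "p \<in> carrier G" "q \<in> carrier G" "r \<in> carrier G"
  defines "D \<equiv> {(x, y). x \<in> ldom G p \<and> y \<in> ldom G q \<and> lpar G p x \<otimes>\<^bsub>grp G\<^esub> lpar G q y \<in> lnbh G r}"
  shows "open D" "smooth D (\<lambda>(x, y). lcoord G r (lpar G p x \<otimes>\<^bsub>grp G\<^esub> lpar G q y))"
  using smooth_map_prod_lcoord[OF lie_manifold[OF G] p(1) lie_manifold[OF G] p(2) lie_manifold[OF G] p(3)
      lie_mult_smooth_map[OF G]]
  unfolding D_def by simp_all

lemma lie_smooth_fun_mult:
  assumes G: "lie_group G" and p: "p \<in> carrier G" "q \<in> carrier G" and f: "smooth_fun G f"
  obtains D where "open D" "(0, 0) \<in> D" "smooth D (\<lambda>(x, y). f (lpar G p x \<otimes>\<^bsub>grp G\<^esub> lpar G q y))"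
proof
  let ?r = "p \<otimes>\<^bsub>grp G\<^esub> q"
  let ?D = "{(x, y). x \<in> ldom G p \<and> y \<in> ldom G q \<and> lpar G p x \<otimes>\<^bsub>grp G\<^esub> lpar G q y \<in> lnbh G ?r}"
  note M = lie_manifold[OF G]
  have r: "?r \<in> carrier G" using lie_mult_closed[OF G p] .
  note D = lie_mult_lcoord[OF G p r]
  show "open ?D" by (rule D(1))
  show "(0, 0) \<in> ?D"
    using zero_ldom[OF M] lchart(2)[OF M r] p by (simp add: lpar_zero[OF M])
  have "smooth ?D (\<lambda>z. f (lpar G ?r ((\<lambda>(x, y). lcoord G ?r (lpar G p x \<otimes>\<^bsub>grp G\<^esub> lpar G q y)) z)))"
    by (rule smooth_on_compose[OF D(2) smooth_fun_lpar[OF M r f]]) (use lcoord_in[OF M r] in auto)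
  then show "smooth ?D (\<lambda>(x, y). f (lpar G p x \<otimes>\<^bsub>grp G\<^esub> lpar G q y))"
    by (rule smooth_on_cong) (auto simp: lpar_lcoord[OF M r])
qed

lemma smooth_slice:
  assumes "open D" "smooth D g"
  shows "open {x. (x, b) \<in> D}" "smooth {x. (x, b) \<in> D} (\<lambda>x. g (x, b))"
    and "open {y. (a, y) \<in> D}" "smooth {y. (a, y) \<in> D} (\<lambda>y. g (a, y))"
proof -
  have "{x. (x, b) \<in> D} = (\<lambda>x. (x, b)) -` D" "{y. (a, y) \<in> D} = (\<lambda>y. (a, y)) -` D" by auto
  then show "open {x. (x, b) \<in> D}" "open {y. (a, y) \<in> D}"
    using assms(1) by (simp_all add: open_vimage continuous_on_Pair)
  show "smooth {x. (x, b) \<in> D} (\<lambda>x. g (x, b))" "smooth {y. (a, y) \<in> D} (\<lambda>y. g (a, y))"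
    by (rule smooth_on_compose[OF smooth_on_Pair[OF smooth_on_ident smooth_on_const] assms(2)], blast)
       (rule smooth_on_compose[OF smooth_on_Pair[OF smooth_on_const smooth_on_ident] assms(2)], blast)
qed

lemma smooth_fun_left_mult:
  assumes G: "lie_group G" and a: "a \<in> carrier G" and f: "smooth_fun G f"
  shows "smooth_fun G (\<lambda>x. f (a \<otimes>\<^bsub>grp G\<^esub> x))"
proof (rule smooth_funI[OF lie_manifold[OF G]])
  fix p assume p: "p \<in> carrier G"
  obtain D where D: "open D" "(0, 0) \<in> D" "smooth D (\<lambda>(x, y). f (lpar G a x \<otimes>\<^bsub>grp G\<^esub> lpar G p y))"
    using lie_smooth_fun_mult[OF G a p f] .
  show "\<exists>D. open D \<and> 0 \<in> D \<and> smooth D (\<lambda>x. f (a \<otimes>\<^bsub>grp G\<^esub> lpar G p x))"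
    using smooth_slice(3,4)[OF D(1,3), of 0] D(2)
    by (intro exI[of _ "{y. (0, y) \<in> D}"]) (simp add: lpar_zero[OF lie_manifold[OF G] a])
qed

text \<open>The left-invariant field whose value at the identity is the coordinate direction
  \<open>x\<close>. It differentiates along the left translates by \<open>p\<close> of coordinate
  curves through the identity, which takes the place of \<open>p exp(tx)\<close>. The zero cases
  follow the conventions of \<open>tangent_space\<close> and \<open>vector_fields\<close>.\<close>

definition lifield :: "('a, 'e::euclidean_space, 'z) lie_scheme \<Rightarrow> 'e \<Rightarrow> 'a \<Rightarrow> 'a tangent" where
  "lifield G x p f =
    (if p \<in> carrier G \<and> f \<in> smooth_funs G
     then \<partial> (\<lambda>y. f (p \<otimes>\<^bsub>grp G\<^esub> epar G y)) 0 x else 0)"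

lemma lifield_has_derivative:
  assumes G: "lie_group G" and p: "p \<in> carrier G" and f: "f \<in> smooth_funs G"
  shows "((\<lambda>y. f (p \<otimes>\<^bsub>grp G\<^esub> epar G y)) has_derivative (\<lambda>v. lifield G v p f)) (at 0)"
proof -
  have "smooth_fun G f" using f by (simp add: smooth_funs_def)
  then obtain D where D: "open D" "(0, 0) \<in> D"
    "smooth D (\<lambda>(x, y). f (lpar G p x \<otimes>\<^bsub>grp G\<^esub> epar G y))"
    using lie_smooth_fun_mult[OF G p lie_one_closed[OF G]] by blast
  from smooth_on_has_derivative[OF smooth_slice(4,3)[OF D(1,3), of 0], of 0] D(2)
  show ?thesis using p f by (simp add: lifield_def lpar_zero[OF lie_manifold[OF G] p])
qed

lemma lifield_tangent:
  assumes G: "lie_group G" and p: "p \<in> carrier G"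
  shows "lifield G x p \<in> tangent_space G p"
proof -
  let ?\<psi> = "epar G"
  have p0: "p \<otimes>\<^bsub>grp G\<^esub> ?\<psi> 0 = p"
    using lpar_zero[OF lie_manifold[OF G] lie_one_closed[OF G]] p lie_grp[OF G] lie_carrier[OF G]
    by (simp add: group.is_monoid monoid.r_one)
  note d = lifield_has_derivative[OF G p]
  have eq: "lifield G x p f = D x"
    if "f \<in> smooth_funs G" "((\<lambda>y. f (p \<otimes>\<^bsub>grp G\<^esub> ?\<psi> y)) has_derivative D) (at 0)" for f D
    using fun_cong[OF has_derivative_unique[OF d[OF that(1)] that(2)]] .
  show ?thesis unfolding tangent_space_def mem_Collect_eq
  proof (intro conjI allI impI ballI)
    fix f assume "f \<notin> smooth_funs G"
    then show "lifield G x p f = 0" by (simp add: lifield_def)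
  next
    fix f h assume f: "f \<in> smooth_funs G" and h: "h \<in> smooth_funs G"
    show "lifield G x p (\<lambda>x. f x + h x) = lifield G x p f + lifield G x p h"
      by (rule eq[OF smooth_funs_add[OF f h] has_derivative_add[OF d[OF f] d[OF h]]])
    have "lifield G x p (\<lambda>x. f x * h x) = f (p \<otimes>\<^bsub>grp G\<^esub> ?\<psi> 0) * lifield G x p h + lifield G x p f * h (p \<otimes>\<^bsub>grp G\<^esub> ?\<psi> 0)"
      by (rule eq[OF smooth_funs_mult[OF f h] has_derivative_mult[OF d[OF f] d[OF h]]])
    then show "lifield G x p (\<lambda>x. f x * h x) = f p * lifield G x p h + h p * lifield G x p f"
      by (simp add: p0)
  next
    fix f c assume f: "f \<in> smooth_funs G"
    show "lifield G x p (\<lambda>x. c * f x) = c * lifield G x p f"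
      by (rule eq[OF smooth_funs_scale[OF f] has_derivative_mult_right[OF d[OF f]]])
  qed
qed

text \<open>In coordinates this is a partial derivative at \<open>y = 0\<close> of a smooth function
  of the pair \<open>(p, y)\<close>, hence smooth in \<open>p\<close>.\<close>

lemma lifield_smooth:
  assumes G: "lie_group G" and f: "f \<in> smooth_funs G"
  shows "(\<lambda>p. lifield G x p f) \<in> smooth_funs G"
proof -
  have sf: "smooth_fun G f" using f by (simp add: smooth_funs_def)
  have "smooth_fun G (\<lambda>p. lifield G x p f)"
  proof (rule smooth_funI[OF lie_manifold[OF G]])
    fix p assume p: "p \<in> carrier G"
    obtain D where D: "open D" "(0, 0) \<in> D"
      "smooth D (\<lambda>(x, y). f (lpar G p x \<otimes>\<^bsub>grp G\<^esub> epar G y))"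
      using lie_smooth_fun_mult[OF G p lie_one_closed[OF G] sf] .
    let ?k = "\<lambda>(x, y). f (lpar G p x \<otimes>\<^bsub>grp G\<^esub> epar G y)"
    note sl = smooth_slice[OF D(1) smooth_on_fderiv[OF D(3,1), of "(0, x)"]]
    have "smooth {z. (z, 0) \<in> D} (\<lambda>z. lifield G x (lpar G p z) f)"
    proof (rule smooth_on_cong[OF sl(2)])
      fix z assume "z \<in> {z. (z, 0) \<in> D}"
      then have "(?k has_derivative \<partial> ?k (z, 0)) (at (z, 0))"
        using smooth_on_has_derivative[OF D(3,1)] by blast
      from has_derivative_compose[OF has_derivative_Pair[OF has_derivative_const has_derivative_ident] this]
      have "((\<lambda>y. f (lpar G p z \<otimes>\<^bsub>grp G\<^esub> epar G y)) has_derivative (\<lambda>v. \<partial> ?k (z, 0) (0, v))) (at 0)"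
        by simp
      from fderiv_eqI[OF this] show "\<partial> ?k (z, 0) (0, x) = lifield G x (lpar G p z) f"
        using f lpar_closed[OF lie_manifold[OF G] p] by (simp add: lifield_def)
    qed
    then show "\<exists>D. open D \<and> 0 \<in> D \<and> smooth D (\<lambda>z. lifield G x (lpar G p z) f)"
      using sl(1)[of 0] D(2) by (intro exI[of _ "{z. (z, 0) \<in> D}"]) simp
  qed
  then show ?thesis by (simp add: smooth_funs_def lifield_def)
qed

lemma lifield_Lie:
  assumes G: "lie_group G"
  shows "lifield G x \<in> Lie G"
proof -
  have "lifield G x \<in> vector_fields G"
    unfolding vector_fields_def
    using lifield_tangent[OF G] lifield_smooth[OF G] by (auto simp: lifield_def smooth_funs_def fun_eq_iff)
  moreover have "differential G G (\<lambda>x. a \<otimes>\<^bsub>grp G\<^esub> x) (lifield G x p) = lifield G x (a \<otimes>\<^bsub>grp G\<^esub> p)"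
    if a: "a \<in> carrier G" and p: "p \<in> carrier G" for a p
  proof
    fix f
    show "differential G G (\<lambda>x. a \<otimes>\<^bsub>grp G\<^esub> x) (lifield G x p) f = lifield G x (a \<otimes>\<^bsub>grp G\<^esub> p) f"
    proof (cases "f \<in> smooth_funs G")
      case True
      then have "smooth_fun G f" by (simp add: smooth_funs_def)
      from smooth_funs_restrict[OF lie_manifold[OF G] smooth_fun_left_mult[OF G a this]]
      have 1: "(\<lambda>x. if x \<in> carrier G then f (a \<otimes>\<^bsub>grp G\<^esub> x) else 0) \<in> smooth_funs G" .
      have "p \<otimes>\<^bsub>grp G\<^esub> epar G y \<in> carrier G"
        "a \<otimes>\<^bsub>grp G\<^esub> (p \<otimes>\<^bsub>grp G\<^esub> epar G y) = a \<otimes>\<^bsub>grp G\<^esub> p \<otimes>\<^bsub>grp G\<^esub> epar G y" for y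
        using lpar_closed[OF lie_manifold[OF G] lie_one_closed[OF G]] a p lie_mult_closed[OF G] lie_grp[OF G]
        by (simp_all add: lie_carrier[OF G] group.is_monoid monoid.m_assoc)
      then show ?thesis using True 1 p lie_mult_closed[OF G a p] by (simp add: differential_def lifield_def)
    qed (simp add: differential_def lifield_def)
  qed
  ultimately show ?thesis by (simp add: Lie_def)
qed

text \<open>\<open>N\<close> is closed under products but not assumed closed under inverses. For
  \<open>x\<close> near \<open>p\<close> both \<open>p^-1 x\<close> and \<open>x^-1 p\<close> lie in
  \<open>N\<close>: the first shows that \<open>N\<close> is open, the second that a point
  \<open>x\<close> of \<open>N\<close> near \<open>p\<close> would force \<open>p\<close> into
  \<open>N\<close>, so the complement is open as well.\<close>

lemma lie_connected_generated:
  assumes G: "lie_group G" and con: "lie_connected G" and N: "N \<subseteq> carrier G"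
    and mult: "\<And>x y. x \<in> N \<Longrightarrow> y \<in> N \<Longrightarrow> x \<otimes>\<^bsub>grp G\<^esub> y \<in> N"
    and r: "r > 0" "\<And>x. x \<in> model G \<Longrightarrow> norm x < r \<Longrightarrow> epar G x \<in> N"
  shows "N = carrier G"
proof -
  note M = lie_manifold[OF G]
  interpret group "grp G" by (rule lie_grp[OF G])
  note C = lie_carrier[OF G]
  note e = lie_one_closed[OF G]
  have near: "\<exists>s>0. \<forall>x\<in>model G. norm x < s \<longrightarrow>
      inv\<^bsub>grp G\<^esub> p \<otimes>\<^bsub>grp G\<^esub> lpar G p x \<in> N \<and> inv\<^bsub>grp G\<^esub> (lpar G p x) \<otimes>\<^bsub>grp G\<^esub> p \<in> N"
    if p: "p \<in> carrier G" for p
  proof -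
    let ?q = "inv\<^bsub>grp G\<^esub> p"
    have q: "?q \<in> carrier G" using lie_inv_closed[OF G p] .
    let ?k = "\<lambda>(x, y). lcoord G (lone G) (lpar G ?q x \<otimes>\<^bsub>grp G\<^esub> lpar G p y)"
    define D where "D = {(x, y). x \<in> ldom G ?q \<and> y \<in> ldom G p \<and> lpar G ?q x \<otimes>\<^bsub>grp G\<^esub> lpar G p y \<in> lnbh G (lone G)}"
    have D: "open D" "smooth D ?k" using lie_mult_lcoord[OF G q p e] unfolding D_def by auto
    define W where "W = D \<inter> ?k -` ball 0 r"
    have "open W" unfolding W_def
      by (rule continuous_open_preimage[OF smooth_on_continuous[OF D(2)] D(1) open_ball])
    have qp: "?q \<otimes>\<^bsub>grp G\<^esub> p = (lone G)" using p C by simp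
    have W0: "(0, 0) \<in> W"
      using zero_ldom[OF M q] zero_ldom[OF M p] lchart(2)[OF M e] r(1)
      by (simp add: W_def D_def lpar_zero[OF M q] lpar_zero[OF M p] qp lcoord_self[OF M e])
    have WN: "lpar G ?q x \<otimes>\<^bsub>grp G\<^esub> lpar G p y \<in> N" if "(x, y) \<in> W" for x y
    proof -
      let ?g = "lpar G ?q x \<otimes>\<^bsub>grp G\<^esub> lpar G p y"
      have g: "?g \<in> lnbh G (lone G)" using that by (auto simp: W_def D_def)
      have "norm (lcoord G (lone G) ?g) < r" using that by (auto simp: W_def)
      then show ?thesis using r(2)[of "lcoord G (lone G) ?g"] lcoord_in[OF M e g] lpar_lcoord[OF M e g] by simp
    qed
    have 1: "\<forall>\<^sub>F x in nhds 0. (0, x) \<in> W"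
      by (rule eventually_isCont_open[OF _ \<open>open W\<close>]) (use W0 in \<open>auto intro!: continuous_intros\<close>)
    let ?E = "{x \<in> ldom G p. inv\<^bsub>grp G\<^esub> (lpar G p x) \<in> lnbh G ?q}"
    let ?c = "\<lambda>x. lcoord G ?q (inv\<^bsub>grp G\<^esub> (lpar G p x))"
    note E = smooth_map_lcoord[OF M p M q lie_inv_smooth_map[OF G]]
    have E0: "0 \<in> ?E" using zero_ldom[OF M p] lchart(2)[OF M q] by (simp add: lpar_zero[OF M p])
    have "isCont ?c 0"
      using smooth_on_has_derivative[OF E(2,1) E0] has_derivative_continuous by blast
    then have "isCont (\<lambda>x. (?c x, 0::'b)) 0" by (intro continuous_intros)
    from eventually_isCont_open[OF this \<open>open W\<close>]
    have 2: "\<forall>\<^sub>F x in nhds 0. (?c x, 0) \<in> W"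
      using W0 by (simp add: lpar_zero[OF M p] lcoord_self[OF M q])
    have 3: "\<forall>\<^sub>F x in nhds 0. x \<in> ?E" using E(1) E0 by (rule eventually_nhds_in_open)
    have "\<forall>\<^sub>F x in nhds 0. ?q \<otimes>\<^bsub>grp G\<^esub> lpar G p x \<in> N \<and> inv\<^bsub>grp G\<^esub> (lpar G p x) \<otimes>\<^bsub>grp G\<^esub> p \<in> N"
      using 1 2 3
    proof eventually_elim
      case (elim x)
      have "lpar G ?q (?c x) = inv\<^bsub>grp G\<^esub> (lpar G p x)" using elim(3) lpar_lcoord[OF M q] by simp
      then show ?case using WN[OF elim(1)] WN[OF elim(2)] by (simp add: lpar_zero[OF M p] lpar_zero[OF M q])
    qed
    then show ?thesis unfolding eventually_nhds_metric dist_norm diff_zero by blast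
  qed
  have lc: "lpar G p x \<in> carrier G" if "p \<in> carrier G" for p x using lpar_closed[OF M that] .
  have "openin (manifold_topology G) N"
  proof (rule openin_manifoldI[OF M N])
    fix p assume p: "p \<in> N"
    then have pG: "p \<in> carrier G" using N by blast
    have "lpar G p x \<in> N" if "inv\<^bsub>grp G\<^esub> p \<otimes>\<^bsub>grp G\<^esub> lpar G p x \<in> N" for x
      using mult[OF p that] pG lc[OF pG] unfolding C[symmetric] by (simp add: m_assoc[symmetric])
    then show "\<exists>r>0. \<forall>x\<in>model G. norm x < r \<longrightarrow> lpar G p x \<in> N" using near[OF pG] by blast
  qed
  moreover have "openin (manifold_topology G) (carrier G - N)"
  proof (rule openin_manifoldI[OF M])
    fix p assume p: "p \<in> carrier G - N"
    then have pG: "p \<in> carrier G" by blast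
    have "lpar G p x \<in> carrier G - N" if "inv\<^bsub>grp G\<^esub> (lpar G p x) \<otimes>\<^bsub>grp G\<^esub> p \<in> N" for x
    proof -
      have "lpar G p x \<notin> N"
      proof
        assume "lpar G p x \<in> N"
        from mult[OF this that] have "p \<in> N" using pG lc[OF pG] unfolding C[symmetric] by (simp add: m_assoc[symmetric])
        then show False using p by blast
      qed
      then show ?thesis using lc[OF pG] by blast
    qed
    then show "\<exists>r>0. \<forall>x\<in>model G. norm x < r \<longrightarrow> lpar G p x \<in> carrier G - N" using near[OF pG] by blast
  qed blast
  moreover have "(lone G) \<in> N"
    using r(2)[of 0] r(1) subspace_0[OF model[OF M e]] lpar_zero[OF M e] by simp
  ultimately show ?thesis
    using con N unfolding lie_connected_def connected_space_def topspace_manifold[OF M] by blast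
qed

section \<open>Coordinate expressions of the group operations\<close>

definition "lmul G = (\<lambda>(x, y). lcoord G (lone G) (epar G x \<otimes>\<^bsub>grp G\<^esub> epar G y))"
definition "lmul_dom G = {(x, y). x \<in> ldom G (lone G) \<and> y \<in> ldom G (lone G) \<and>
  epar G x \<otimes>\<^bsub>grp G\<^esub> epar G y \<in> lnbh G (lone G)}"
definition "linv G x = lcoord G (lone G) (inv\<^bsub>grp G\<^esub> (epar G x))"
definition "linv_dom G = {x \<in> ldom G (lone G). inv\<^bsub>grp G\<^esub> (epar G x) \<in> lnbh G (lone G)}"

text \<open>The ambient group \<open>K\<close> is a parameter so that a Lie group and its Lie
  subgroup give local groups over one and the same group.\<close>

lemma lie_local_group:
  assumes H: "lie_group H" and K: "group K" "subgroup (carrier H) K" "grp H = K\<lparr>carrier := carrier H\<rparr>"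
  shows "local_group K (model H) (ldom H (lone H)) (epar H)
    (lmul H) (lmul_dom H) (linv H) (linv_dom H)"
proof -
  note M = lie_manifold[OF H] and e = lie_one_closed[OF H]
  interpret group K by (rule K(1))
  interpret H: group "grp H" by (rule lie_grp[OF H])
  have C: "carrier H \<subseteq> carrier K" using K(2) by (rule subgroup.subset)
  have ops: "(lone H) = \<one>\<^bsub>K\<^esub>" "\<And>x y. x \<otimes>\<^bsub>grp H\<^esub> y = x \<otimes>\<^bsub>K\<^esub> y" by (simp_all add: K(3))
  have invs: "inv\<^bsub>grp H\<^esub> x = inv\<^bsub>K\<^esub> x" if "x \<in> carrier H" for x
    using m_inv_consistent[OF K(2) that] by (simp add: K(3))
  note mul = lie_mult_lcoord[OF H e e e] and inv = smooth_map_lcoord[OF M e M e lie_inv_smooth_map[OF H]]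
  show ?thesis
  proof
    show "subspace (model H)" using model[OF M e] .
    show "open (ldom H (lone H))" "0 \<in> ldom H (lone H)" using open_ldom[OF M e] zero_ldom[OF M e] .
    show "epar H x \<in> carrier K" for x using lpar_closed[OF M e] C by blast
    show "epar H 0 = \<one>\<^bsub>K\<^esub>" using lpar_zero[OF M e] ops by simp
    show "x = y" if "x \<in> model H \<inter> ldom H (lone H)" "y \<in> model H \<inter> ldom H (lone H)"
      "epar H x = epar H y" for x y
      using lpar_inj[OF M e that] .
    show "open (lmul_dom H)" "smooth (lmul_dom H) (lmul H)"
      using mul unfolding lmul_dom_def lmul_def by auto
    show "(0, 0) \<in> lmul_dom H"
      using zero_ldom[OF M e] lchart(2)[OF M e] by (simp add: lmul_dom_def lpar_zero[OF M e])
    show "lmul H (x, y) \<in> model H \<inter> ldom H (lone H)" if "(x, y) \<in> lmul_dom H" for x y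
      using that lcoord_in[OF M e] by (simp add: lmul_def lmul_dom_def)
    show "epar H (lmul H (x, y)) = epar H x \<otimes>\<^bsub>K\<^esub> epar H y"
      if "(x, y) \<in> lmul_dom H" for x y
      using that lpar_lcoord[OF M e] ops by (simp add: lmul_def lmul_dom_def)
    show "open (linv_dom H)" "smooth (linv_dom H) (linv H)"
      using inv unfolding linv_dom_def linv_def by auto
    show "0 \<in> linv_dom H"
      using zero_ldom[OF M e] lchart(2)[OF M e] by (simp add: linv_dom_def lpar_zero[OF M e])
    show "linv H x \<in> model H \<inter> ldom H (lone H)" if "x \<in> linv_dom H" for x
      using that lcoord_in[OF M e] by (simp add: linv_def linv_dom_def)
    show "epar H (linv H x) = inv\<^bsub>K\<^esub> epar H x" if "x \<in> linv_dom H" for x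
      using that lpar_lcoord[OF M e] invs[OF lpar_closed[OF M e]] by (simp add: linv_def linv_dom_def)
  qed
qed

subsection \<open>Ideals and normal subgroups\<close>

text \<open>Such functions are the test functions by which tangent vectors, given as derivations of
  global functions, are compared with vectors of the model space.\<close>

lemma ex_linear_smooth_fun:
  fixes M :: "('a, 'e::euclidean_space, 'z) manifold_scheme"
  assumes M: "smooth_manifold M" and p: "p \<in> carrier M"
  obtains f s where "f \<in> smooth_funs M" "s > 0"
    "\<And>q. q \<in> lnbh M p \<Longrightarrow> norm (lcoord M p q) \<le> s \<Longrightarrow> f q = lcoord M p q \<bullet> n"
proof -
  obtain r where r: "r > 0" "ball 0 r \<subseteq> ldom M p"
    using open_ldom[OF M p] zero_ldom[OF M p] open_contains_ball by blast
  have "r / 2 > 0" using r by simp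
  then obtain \<beta> :: "'e \<Rightarrow> real" and s where \<beta>: "smooth UNIV \<beta>" "0 < s" "s < r / 2"
    "\<And>x. norm x \<le> s \<Longrightarrow> \<beta> x = 1" "\<And>x. norm x \<ge> r / 2 \<Longrightarrow> \<beta> x = 0"
    by (rule ex_bump) (rule that)
  have sf: "smooth (ball 0 r) (\<lambda>x. \<beta> x * (x \<bullet> n))"
    by (rule smooth_on_mult[OF smooth_on_subset[OF \<beta>(1)]
          smooth_on_bounded_linear[OF bounded_linear_inner_left smooth_on_ident]]) simp
  have "lextend M p (\<lambda>x. \<beta> x * (x \<bullet> n)) \<in> smooth_funs M"
    by (rule lextend_smooth[OF M p _ r(2) sf, of "r / 2"]) (use r(1) \<beta>(5) in auto)
  moreover have "lextend M p (\<lambda>x. \<beta> x * (x \<bullet> n)) q = lcoord M p q \<bullet> n"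
    if "q \<in> lnbh M p" "norm (lcoord M p q) \<le> s" for q
    using that \<beta>(4) by (simp add: lextend_def)
  ultimately show ?thesis using that \<beta>(2) by blast
qed

text \<open>On a function that is linear near the identity the inner field yields a partial
  derivative of the multiplication, and the outer field differentiates it once more. The bracket is
  thus the antisymmetrised second derivative, without a term from the function.\<close>

lemma lie_bracket_lifield:
  fixes G :: "('a, 'e::euclidean_space, 'z) lie_scheme"
  assumes G: "lie_group G" and f: "f \<in> smooth_funs G" and s: "s > 0"
    and lin: "\<And>q. q \<in> lnbh G (lone G) \<Longrightarrow> norm (lcoord G (lone G) q) \<le> s \<Longrightarrow> f q = lcoord G (lone G) q \<bullet> n"
  shows "lie_bracket (lifield G x) (lifield G y) (lone G) f =
    (\<partial> (\<lambda>p. \<partial> (lmul G) p (0, y)) (0, 0) (x, 0) - \<partial> (\<lambda>p. \<partial> (lmul G) p (0, x)) (0, 0) (y, 0)) \<bullet> n"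
proof -
  note M = lie_manifold[OF G] and e = lie_one_closed[OF G]
  interpret group "grp G" by (rule lie_grp[OF G])
  note C = lie_carrier[OF G]
  have sg: "subgroup (carrier G) (grp G)" using subgroup_self C by simp
  interpret local_group "grp G" "model G" "ldom G (lone G)" "epar G" "lmul G" "lmul_dom G" "linv G" "linv_dom G"
    by (rule lie_local_group[OF G is_group sg]) (simp flip: C)
  let ?\<psi> = "epar G"
  \<comment> \<open>The pairs whose product remains in the ball on which \<open>f\<close> is
    linear.\<close>
  define E where "E = lmul_dom G \<inter> lmul G -` ball 0 s"
  have oE: "open E" unfolding E_def
    by (rule continuous_open_preimage[OF smooth_on_continuous[OF smooth_M] open_DM open_ball])
  have E0: "(0, 0) \<in> E" using zero_DM s by (simp add: E_def M_zero)
  have fE: "f (?\<psi> z \<otimes>\<^bsub>grp G\<^esub> ?\<psi> u) = lmul G (z, u) \<bullet> n" if "(z, u) \<in> E" for z u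
    using that lin[of "?\<psi> z \<otimes>\<^bsub>grp G\<^esub> ?\<psi> u"] by (simp add: E_def lmul_dom_def lmul_def)
  have inner: "lifield G v (?\<psi> z) f = \<partial> (lmul G) (z, 0) (0, v) \<bullet> n" if z: "(z, 0) \<in> E" for z v
  proof -
    have "(z, 0) \<in> lmul_dom G" using z by (simp add: E_def)
    from has_derivative_inner_left[OF M_deriv2[OF this]]
    have "((\<lambda>u. lmul G (z, u) \<bullet> n) has_derivative (\<lambda>v. \<partial> (lmul G) (z, 0) (0, v) \<bullet> n)) (at 0)" .
    moreover have "\<forall>\<^sub>F u in nhds 0. (z, u) \<in> E"
      by (rule eventually_isCont_open[OF isCont_slice2 oE z])
    then have "\<forall>\<^sub>F u in nhds 0. lmul G (z, u) \<bullet> n = f (?\<psi> z \<otimes>\<^bsub>grp G\<^esub> ?\<psi> u)"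
      by eventually_elim (simp add: fE)
    ultimately have "((\<lambda>u. f (?\<psi> z \<otimes>\<^bsub>grp G\<^esub> ?\<psi> u)) has_derivative (\<lambda>v. \<partial> (lmul G) (z, 0) (0, v) \<bullet> n)) (at 0)"
      by (rule fderiv_cong[rotated])
    from fderiv_eqI[OF this] show ?thesis using f lpar_closed[OF M e] by (simp add: lifield_def)
  qed
  have outer: "lifield G x (lone G) (\<lambda>q. lifield G y q f) = \<partial> (\<lambda>p. \<partial> (lmul G) p (0, y)) (0, 0) (x, 0) \<bullet> n" for x y
  proof -
    have "((\<lambda>p. \<partial> (lmul G) p (0, y)) has_derivative \<partial> (\<lambda>p. \<partial> (lmul G) p (0, y)) (0, 0)) (at (0, 0))"
      by (rule smooth_on_has_derivative[OF smooth_on_fderiv[OF smooth_M open_DM] open_DM zero_DM])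
    from has_derivative_inner_left[OF has_derivative_compose[OF deriv_slice1 this]]
    have "((\<lambda>z. \<partial> (lmul G) (z, 0) (0, y) \<bullet> n) has_derivative
        (\<lambda>v. \<partial> (\<lambda>p. \<partial> (lmul G) p (0, y)) (0, 0) (v, 0) \<bullet> n)) (at 0)" .
    moreover have "\<forall>\<^sub>F z in nhds 0. (z, 0) \<in> E"
      by (rule eventually_isCont_open[OF isCont_slice1 oE E0])
    then have "\<forall>\<^sub>F z in nhds 0. \<partial> (lmul G) (z, 0) (0, y) \<bullet> n = lifield G y ((lone G) \<otimes>\<^bsub>grp G\<^esub> ?\<psi> z) f"
      by eventually_elim (simp add: inner \<psi>_closed)
    ultimately have "((\<lambda>z. lifield G y ((lone G) \<otimes>\<^bsub>grp G\<^esub> ?\<psi> z) f) has_derivative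
        (\<lambda>v. \<partial> (\<lambda>p. \<partial> (lmul G) p (0, y)) (0, 0) (v, 0) \<bullet> n)) (at 0)"
      by (rule fderiv_cong[rotated])
    \<comment> \<open>The outer field is a derivative on members of \<open>smooth_funs\<close> only
      and is 0 elsewhere by definition; \<open>lifield_smooth\<close> places the inner function
      there.\<close>
    from fderiv_eqI[OF this] show ?thesis
      using lifield_smooth[OF G f] e by (simp add: lifield_def[of G x])
  qed
  show ?thesis unfolding lie_bracket_def outer by (simp add: inner_diff_left)
qed

lemma lie_subgroup_ops:
  assumes "lie_subgroup H G"
  shows "(lone H) = (lone G)" "x \<otimes>\<^bsub>grp H\<^esub> y = x \<otimes>\<^bsub>grp G\<^esub> y"
proof -
  have "grp H = (grp G)\<lparr>carrier := carrier H\<rparr>" using assms by (simp add: lie_subgroup_def)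
  then show "(lone H) = (lone G)" "x \<otimes>\<^bsub>grp H\<^esub> y = x \<otimes>\<^bsub>grp G\<^esub> y" by simp_all
qed

section \<open>The inclusion of a Lie subgroup in coordinates\<close>

definition "lincl H G u = lcoord G (lone G) (epar H u)"
definition "lincl_dom H G = {u \<in> ldom H (lone H). epar H u \<in> lnbh G (lone G)}"

lemma lincl_smooth:
  assumes HG: "lie_subgroup H G"
  shows "open (lincl_dom H G)" "smooth (lincl_dom H G) (lincl H G)" "0 \<in> lincl_dom H G"
    and "u \<in> lincl_dom H G \<Longrightarrow> lincl H G u \<in> model G \<inter> ldom G (lone G)"
    and "u \<in> lincl_dom H G \<Longrightarrow> epar G (lincl H G u) = epar H u"
    and "\<partial> (lincl H G) 0 (proj (model H) v) = \<partial> (lincl H G) 0 v"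
proof -
  have H: "lie_group H" and G: "lie_group G" and sm: "smooth_map H G (\<lambda>x. x)"
    using HG by (simp_all add: lie_subgroup_def)
  note MH = lie_manifold[OF H] and eH = lie_one_closed[OF H]
  note MG = lie_manifold[OF G] and eG = lie_one_closed[OF G]
  show 1: "open (lincl_dom H G)" and 2: "smooth (lincl_dom H G) (lincl H G)"
    using smooth_map_lcoord[OF MH eH MG eG sm] unfolding lincl_dom_def lincl_def by auto
  show 3: "0 \<in> lincl_dom H G"
    using zero_ldom[OF MH eH] lchart(2)[OF MG eG]
    by (simp add: lincl_dom_def lpar_zero[OF MH eH]) (simp add: lie_subgroup_ops[OF HG])
  show "lincl H G u \<in> model G \<inter> ldom G (lone G)" if "u \<in> lincl_dom H G"
    using that lcoord_in[OF MG eG] by (simp add: lincl_def lincl_dom_def)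
  show "epar G (lincl H G u) = epar H u" if "u \<in> lincl_dom H G"
    using that lpar_lcoord[OF MG eG] by (simp add: lincl_def lincl_dom_def)
  note V = model[OF MH eH]
  have d: "(lincl H G has_derivative \<partial> (lincl H G) 0) (at 0)"
    using smooth_on_has_derivative[OF 2 1 3] .
  have "((\<lambda>u. lincl H G (proj (model H) u)) has_derivative (\<lambda>v. \<partial> (lincl H G) 0 (proj (model H) v))) (at 0)"
    by (rule has_derivative_compose[OF bounded_linear_imp_has_derivative[OF bounded_linear_proj[OF V]]])
       (use d linear_0[OF linear_proj[OF V]] in simp)
  then have "(lincl H G has_derivative (\<lambda>v. \<partial> (lincl H G) 0 (proj (model H) v))) (at 0)"
    by (simp add: lincl_def[abs_def] lpar_proj[OF MH eH])
  from fderiv_eqI[OF this] show "\<partial> (lincl H G) 0 (proj (model H) v) = \<partial> (lincl H G) 0 v" by simp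
qed

text \<open>For \<open>u\<close> near 0 multiplication by \<open>epar H u\<close> in
  \<open>H\<close> is multiplication by \<open>epar G (lincl H G u)\<close> in \<open>G\<close>; the
  chain rule does the rest. This identifies the tangent space in coordinates with the fields that
  make up \<open>Lie_sub\<close>.\<close>

lemma lifield_related:
  assumes HG: "lie_subgroup H G" and p: "p \<in> carrier H"
  shows "differential H G (\<lambda>x. x) (lifield H u p) = lifield G (\<partial> (lincl H G) 0 u) p"
proof
  have H: "lie_group H" and G: "lie_group G" and sm: "smooth_map H G (\<lambda>x. x)"
    using HG by (simp_all add: lie_subgroup_def)
  note MH = lie_manifold[OF H] and eH = lie_one_closed[OF H]
  note L = lincl_smooth[OF HG]
  have pG: "p \<in> carrier G" using smooth_map_in[OF sm p] .
  fix f
  show "differential H G (\<lambda>x. x) (lifield H u p) f = lifield G (\<partial> (lincl H G) 0 u) p f"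
  proof (cases "f \<in> smooth_funs G")
    case True
    let ?h = "\<lambda>x. if x \<in> carrier H then f x else 0"
    have "smooth_fun H f"
      using smooth_fun_compose[OF MH lie_manifold[OF G] sm] True by (simp add: smooth_funs_def)
    then have h: "?h \<in> smooth_funs H" by (rule smooth_funs_restrict[OF MH])
    have "(lincl H G has_derivative \<partial> (lincl H G) 0) (at 0)"
      by (rule smooth_on_has_derivative[OF L(2,1,3)])
    moreover have "lincl H G 0 = 0"
      using lpar_zero[OF MH eH] lie_subgroup_ops[OF HG]
      by (simp add: lincl_def lcoord_self[OF lie_manifold[OF G] lie_one_closed[OF G]])
    ultimately have "((\<lambda>u. f (p \<otimes>\<^bsub>grp G\<^esub> epar G (lincl H G u))) has_derivative
        (\<lambda>u. lifield G (\<partial> (lincl H G) 0 u) p f)) (at 0)"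
      using has_derivative_compose[where g="\<lambda>y. f (p \<otimes>\<^bsub>grp G\<^esub> epar G y)"]
        lifield_has_derivative[OF G pG True] by fastforce
    moreover have "\<forall>\<^sub>F u in nhds 0. f (p \<otimes>\<^bsub>grp G\<^esub> epar G (lincl H G u))
        = ?h (p \<otimes>\<^bsub>grp H\<^esub> epar H u)"
      using eventually_nhds_in_open[OF L(1,3)]
    proof eventually_elim
      case (elim u)
      then show ?case
        using L(5) lie_mult_closed[OF H p lpar_closed[OF MH eH]] lie_subgroup_ops[OF HG] by simp
    qed
    ultimately have "((\<lambda>u. ?h (p \<otimes>\<^bsub>grp H\<^esub> epar H u)) has_derivative
        (\<lambda>u. lifield G (\<partial> (lincl H G) 0 u) p f)) (at 0)"
      by (rule fderiv_cong[rotated])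
    from fderiv_eqI[OF this]
    have "lifield H u p ?h = lifield G (\<partial> (lincl H G) 0 u) p f"
      unfolding lifield_def[of H] using p h by simp
    then show ?thesis using True by (simp add: differential_def)
  qed (simp add: differential_def lifield_def)
qed

text \<open>Evaluated on a function that near the identity is the inner product of the coordinate
  with \<open>u\<close>, the field gives \<open>u \<bullet> u\<close>.\<close>

lemma lifield_eq_zeroD:
  fixes G :: "('a, 'e::euclidean_space, 'z) lie_scheme"
  assumes G: "lie_group G" and u: "u \<in> model G" and z: "lifield G u (lone G) = (\<lambda>f. 0)"
  shows "u = 0"
proof -
  note M = lie_manifold[OF G] and e = lie_one_closed[OF G]
  interpret group "grp G" by (rule lie_grp[OF G])
  note V = model[OF M e]
  obtain f s where f: "f \<in> smooth_funs G" "s > 0"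
    "\<And>q. q \<in> lnbh G (lone G) \<Longrightarrow> norm (lcoord G (lone G) q) \<le> s \<Longrightarrow> f q = lcoord G (lone G) q \<bullet> u"
    using ex_linear_smooth_fun[OF M e, of u] by blast
  have "((\<lambda>y. proj (model G) y \<bullet> u) has_derivative (\<lambda>v. proj (model G) v \<bullet> u)) (at 0)"
    by (intro has_derivative_inner_left bounded_linear_imp_has_derivative[OF bounded_linear_proj[OF V]])
  moreover have "\<forall>\<^sub>F y in nhds 0. proj (model G) y \<bullet> u = f ((lone G) \<otimes>\<^bsub>grp G\<^esub> epar G y)"
  proof -
    have "isCont (proj (model G)) 0" using linear_continuous_at[OF bounded_linear_proj[OF V]] .
    from eventually_isCont_open[OF this open_ball, of 0 s]
    have "\<forall>\<^sub>F y in nhds 0. proj (model G) y \<in> ball 0 s" using f(2) linear_0[OF linear_proj[OF V]] by simp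
    with eventually_nhds_in_open[OF open_ldom[OF M e] zero_ldom[OF M e]] show ?thesis
    proof eventually_elim
      case (elim y)
      then show ?case using f(3)[OF lpar_in[OF M e]] lcoord_lpar[OF M e] lpar_closed[OF M e]
        by (simp add: lie_carrier[OF G])
    qed
  qed
  ultimately have "((\<lambda>y. f ((lone G) \<otimes>\<^bsub>grp G\<^esub> epar G y)) has_derivative (\<lambda>v. proj (model G) v \<bullet> u)) (at 0)"
    by (rule fderiv_cong[rotated])
  from fderiv_eqI[OF this, of u] have "lifield G u (lone G) f = u \<bullet> u"
    using f(1) e u by (simp add: lifield_def proj_id[OF V])
  then show ?thesis using z by simp
qed

text \<open>Only the immersion condition needs an argument: if the derivative of the inclusion kills
  \<open>u\<close>, the fields of \<open>u\<close> and of 0 have the same image under the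
  differential, so they agree at the identity.\<close>

lemma lie_local_subgroup:
  assumes HG: "lie_subgroup H G"
  shows "local_subgroup (grp G)
    (model G) (ldom G (lone G)) (epar G) (lmul G) (lmul_dom G) (linv G) (linv_dom G)
    (model H) (ldom H (lone H)) (epar H) (lmul H) (lmul_dom H) (linv H) (linv_dom H)
    (lincl H G) (lincl_dom H G)"
proof -
  have H: "lie_group H" and G: "lie_group G" and sg: "subgroup (carrier H) (grp G)"
    and gH: "grp H = (grp G)\<lparr>carrier := carrier H\<rparr>"
    and imm: "\<And>p. p \<in> carrier H \<Longrightarrow> inj_on (differential H G (\<lambda>x. x)) (tangent_space H p)"
    using HG unfolding lie_subgroup_def by blast+
  note eH = lie_one_closed[OF H]
  interpret group "grp G" by (rule lie_grp[OF G])
  have sG: "subgroup (carrier G) (grp G)" using subgroup_self lie_carrier[OF G] by simp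
  interpret A: local_group "grp G" "model G" "ldom G (lone G)" "epar G" "lmul G" "lmul_dom G" "linv G" "linv_dom G"
    by (rule lie_local_group[OF G is_group sG]) (simp flip: lie_carrier[OF G])
  interpret B: local_group "grp G" "model H" "ldom H (lone H)" "epar H" "lmul H" "lmul_dom H" "linv H" "linv_dom H"
    by (rule lie_local_group[OF H is_group sg gH])
  note L = lincl_smooth[OF HG]
  show ?thesis
  proof
    show "open (lincl_dom H G)" "0 \<in> lincl_dom H G" "smooth (lincl_dom H G) (lincl H G)" using L by blast+
    show "lincl H G u \<in> model G \<inter> ldom G (lone G)" if "u \<in> lincl_dom H G" for u using L(4)[OF that] .
    show "epar G (lincl H G u) = epar H u" if "u \<in> lincl_dom H G" for u using L(5)[OF that] .
    show "u = 0" if u: "u \<in> model H" "\<partial> (lincl H G) 0 u = 0" for u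
    proof -
      have "linear (\<partial> (lincl H G) 0)"
        using has_derivative_linear[OF smooth_on_has_derivative[OF L(2,1,3)]] .
      then have "differential H G (\<lambda>x. x) (lifield H u (lone H)) = differential H G (\<lambda>x. x) (lifield H 0 (lone H))"
        unfolding lifield_related[OF HG eH] u(2) by (simp add: linear_0)
      then have "lifield H u (lone H) = lifield H 0 (lone H)"
        using inj_onD[OF imm[OF eH]] lifield_tangent[OF H eH] by blast
      also have "\<dots> = (\<lambda>f. 0)"
        using linear_0[OF has_derivative_linear[OF lifield_has_derivative[OF H eH]]]
        by (auto simp: fun_eq_iff lifield_def)
      finally show ?thesis using lifield_eq_zeroD[OF H u(1)] by blast
    qed
  qed
qed

text \<open>Two nested generation arguments. For each small \<open>a\<close> the conjugation is
  extended from small \<open>h\<close> to all of \<open>H\<close>, with a radius depending on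
  \<open>a\<close>; afterwards it is extended from small \<open>a\<close> to all of
  \<open>G\<close>.\<close>

theorem lie_ideal_normal:
  assumes HG: "lie_subgroup H G" and conG: "lie_connected G" and conH: "lie_connected H"
    and ideal: "lie_ideal (Lie_sub H G) G"
    and g: "g \<in> carrier G" and h: "h \<in> carrier H"
  shows "g \<otimes>\<^bsub>grp G\<^esub> h \<otimes>\<^bsub>grp G\<^esub> inv\<^bsub>grp G\<^esub> g \<in> carrier H"
proof -
  have H: "lie_group H" and G: "lie_group G" and sg: "subgroup (carrier H) (grp G)"
    and sm: "smooth_map H G (\<lambda>x. x)"
    using HG unfolding lie_subgroup_def by blast+
  note MH = lie_manifold[OF H] and eH = lie_one_closed[OF H]
  note MG = lie_manifold[OF G] and eG = lie_one_closed[OF G]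
  note one = lie_subgroup_ops[OF HG]
  interpret local_subgroup "grp G"
    "model G" "ldom G (lone G)" "epar G" "lmul G" "lmul_dom G" "linv G" "linv_dom G"
    "model H" "ldom H (lone H)" "epar H" "lmul H" "lmul_dom H" "linv H" "linv_dom H"
    "lincl H G" "lincl_dom H G"
    by (rule lie_local_subgroup[OF HG])
  note C = lie_carrier[OF G]
  have CH: "x \<in> carrier G" if "x \<in> carrier H" for x using smooth_map_in[OF sm that] .
  have mH: "x \<otimes>\<^bsub>grp G\<^esub> y \<in> carrier H" if "x \<in> carrier H" "y \<in> carrier H" for x y
    using subgroup.m_closed[OF sg that] .
  \<comment> \<open>The ideal property of the Lie algebra is turned into the condition of
    \<open>conj_in_subgroup\<close> by evaluating the bracket of two left-invariant fields at the
    identity.\<close>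
  have ideal_loc: "B w v - B v w \<in> L" if w: "w \<in> model G" and v: "v \<in> L" for w v
  proof -
    obtain u where u: "u \<in> model H" "v = j u" using v by (auto simp: L_def)
    have "lifield G v \<in> Lie_sub H G"
      unfolding Lie_sub_def using lifield_Lie[OF G] lifield_Lie[OF H] lifield_related[OF HG] u(2) by blast
    then have "lie_bracket (lifield G w) (lifield G v) \<in> Lie_sub H G"
      using ideal lifield_Lie[OF G] unfolding lie_ideal_def by blast
    then obtain Z where Z: "Z \<in> Lie H"
      "differential H G (\<lambda>x. x) (Z (lone H)) = lie_bracket (lifield G w) (lifield G v) (lone G)"
      unfolding Lie_sub_def using eH one(1) by auto
    then have Zt: "Z (lone H) \<in> tangent_space H (lone H)"
      using eH unfolding Lie_def vector_fields_def by blast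
    define d where "d = B w v - B v w"
    \<comment> \<open>The component of the bracket orthogonal to \<open>L\<close>. A test function
      with gradient \<open>n\<close> is stationary along \<open>H\<close> at the identity, so the
      bracket, being tangent to \<open>H\<close>, annihilates it; but the bracket's value on it is
      \<open>d \<bullet> n = n \<bullet> n\<close>.\<close>
    define n where "n = d - proj L d"
    obtain f s where f: "f \<in> smooth_funs G" "s > 0"
      "\<And>q. q \<in> lnbh G (lone G) \<Longrightarrow> norm (lcoord G (lone G) q) \<le> s \<Longrightarrow> f q = lcoord G (lone G) q \<bullet> n"
      using ex_linear_smooth_fun[OF MG eG, of n] by blast
    let ?h = "\<lambda>x. if x \<in> carrier H then f x else 0"
    have "smooth_fun H f"
      using smooth_fun_compose[OF MH MG sm] f(1) by (simp add: smooth_funs_def)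
    then have h: "?h \<in> smooth_funs H" by (rule smooth_funs_restrict[OF MH])
    have "Z (lone H) ?h = 0"
    proof (rule tangent_eq_zero[OF MH eH Zt h])
      show "?h (lone H) = 0"
        using f(2) f(3)[OF lchart(2)[OF MG eG]] by (simp add: one lcoord_self[OF MG eG])
      fix b
      have "((\<lambda>u. lincl H G u \<bullet> n) has_derivative (\<lambda>b. j b \<bullet> n)) (at 0)"
        by (rule has_derivative_inner_left[OF J_deriv])
      moreover have "\<forall>\<^sub>F u in nhds 0. lincl H G u \<bullet> n = ?h (epar H u)"
      proof -
        have "isCont (lincl H G) 0" using J_deriv has_derivative_continuous by blast
        from eventually_isCont_open[OF this open_ball, of 0 s]
        have "\<forall>\<^sub>F u in nhds 0. lincl H G u \<in> ball 0 s" using f(2) J_zero by simp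
        with ev_DJ show ?thesis
        proof eventually_elim
          case (elim u)
          then show ?case
            using f(3)[of "epar H u"] lpar_closed[OF MH eH] by (simp add: lincl_def lincl_dom_def)
        qed
      qed
      ultimately have "((\<lambda>u. ?h (epar H u)) has_derivative (\<lambda>b. j b \<bullet> n)) (at 0)"
        by (rule fderiv_cong[rotated])
      then have "\<partial> (\<lambda>u. ?h (epar H u)) 0 b = j b \<bullet> n" by (rule fderiv_eqI)
      \<comment> \<open>This is needed for every \<open>b\<close>, also outside
        \<open>model H\<close>: \<open>j\<close> factors through the projection to the model
        space.\<close>
      also have "j b \<in> L"
        using lincl_smooth(6)[OF HG, of b] proj_in[OF H.V] unfolding L_def by (metis image_eqI)
      then have "j b \<bullet> n = 0" using proj_orth[OF subspace_L] by (simp add: n_def inner_commute)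
      finally show "\<partial> (\<lambda>u. ?h (epar H u)) 0 b = 0" .
    qed
    then have "lie_bracket (lifield G w) (lifield G v) (lone G) f = 0"
      using Z(2) f(1) by (simp add: differential_def flip: Z(2))
    then have "d \<bullet> n = 0"
      using lie_bracket_lifield[OF G f] unfolding d_def B_def by simp
    moreover have "proj L d \<bullet> n = 0"
      using proj_orth[OF subspace_L proj_in[OF subspace_L]] by (simp add: n_def inner_commute)
    ultimately have "n \<bullet> n = 0" by (simp add: n_def inner_diff_left)
    then have "d = proj L d" by (simp add: n_def)
    then show ?thesis using proj_in[OF subspace_L] unfolding d_def by metis
  qed
  obtain r where r: "r > 0" "\<And>a. a \<in> model G \<Longrightarrow> norm a < r \<Longrightarrow>
      \<exists>s>0. \<forall>u\<in>model H. norm u < s \<longrightarrow>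
        epar G a \<otimes>\<^bsub>grp G\<^esub> epar H u \<otimes>\<^bsub>grp G\<^esub> inv\<^bsub>grp G\<^esub> (epar G a)
          \<in> range (epar H)"
    using conj_in_subgroup[OF ideal_loc] by blast
  \<comment> \<open>Only the inclusion of the conjugate in \<open>H\<close> is demanded. Closure
    under products is immediate for this set, and this is all that
    \<open>lie_connected_generated\<close> asks.\<close>
  define N where "N = {g \<in> carrier G. \<forall>h\<in>carrier H. g \<otimes>\<^bsub>grp G\<^esub> h \<otimes>\<^bsub>grp G\<^esub> inv\<^bsub>grp G\<^esub> g \<in> carrier H}"
  have "N = carrier G"
  proof (rule lie_connected_generated[OF G conG _ _ r(1)])
    show "N \<subseteq> carrier G" by (auto simp: N_def)
    show "x \<otimes>\<^bsub>grp G\<^esub> y \<in> N" if x: "x \<in> N" and y: "y \<in> N" for x y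
    proof -
      have xy: "x \<in> carrier G" "y \<in> carrier G" using x y by (auto simp: N_def)
      have "x \<otimes>\<^bsub>grp G\<^esub> y \<otimes>\<^bsub>grp G\<^esub> h \<otimes>\<^bsub>grp G\<^esub> inv\<^bsub>grp G\<^esub> (x \<otimes>\<^bsub>grp G\<^esub> y) \<in> carrier H" if h: "h \<in> carrier H" for h
      proof -
        have "x \<otimes>\<^bsub>grp G\<^esub> (y \<otimes>\<^bsub>grp G\<^esub> h \<otimes>\<^bsub>grp G\<^esub> inv\<^bsub>grp G\<^esub> y) \<otimes>\<^bsub>grp G\<^esub> inv\<^bsub>grp G\<^esub> x \<in> carrier H"
          using x y h by (simp add: N_def)
        then show ?thesis using xy CH[OF h] unfolding C[symmetric] by (simp add: inv_mult_group m_assoc)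
      qed
      then show ?thesis using lie_mult_closed[OF G xy] by (simp add: N_def)
    qed
    show "epar G a \<in> N" if a: "a \<in> model G" "norm a < r" for a
    proof -
      let ?a = "epar G a"
      have aG: "?a \<in> carrier G" using lpar_closed[OF MG eG] .
      obtain s where s: "s > 0" "\<And>u. u \<in> model H \<Longrightarrow> norm u < s \<Longrightarrow>
          ?a \<otimes>\<^bsub>grp G\<^esub> epar H u \<otimes>\<^bsub>grp G\<^esub> inv\<^bsub>grp G\<^esub> ?a \<in> range (epar H)"
        using r(2)[OF a] by blast
      have rg: "range (epar H) \<subseteq> carrier H" using lpar_closed[OF MH eH] by blast
      \<comment> \<open>With \<open>a\<close> fixed, conjugation is a homomorphism, so the elements
        of \<open>H\<close> that it keeps in \<open>H\<close> are closed under products.\<close>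
      have "{h \<in> carrier H. ?a \<otimes>\<^bsub>grp G\<^esub> h \<otimes>\<^bsub>grp G\<^esub> inv\<^bsub>grp G\<^esub> ?a \<in> carrier H} = carrier H"
      proof (rule lie_connected_generated[OF H conH _ _ s(1)])
        fix x y
        assume x: "x \<in> {h \<in> carrier H. ?a \<otimes>\<^bsub>grp G\<^esub> h \<otimes>\<^bsub>grp G\<^esub> inv\<^bsub>grp G\<^esub> ?a \<in> carrier H}"
          and y: "y \<in> {h \<in> carrier H. ?a \<otimes>\<^bsub>grp G\<^esub> h \<otimes>\<^bsub>grp G\<^esub> inv\<^bsub>grp G\<^esub> ?a \<in> carrier H}"
        have "(?a \<otimes>\<^bsub>grp G\<^esub> x \<otimes>\<^bsub>grp G\<^esub> inv\<^bsub>grp G\<^esub> ?a) \<otimes>\<^bsub>grp G\<^esub> (?a \<otimes>\<^bsub>grp G\<^esub> y \<otimes>\<^bsub>grp G\<^esub> inv\<^bsub>grp G\<^esub> ?a) \<in> carrier H"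
          using x y mH by blast
        also have "(?a \<otimes>\<^bsub>grp G\<^esub> x \<otimes>\<^bsub>grp G\<^esub> inv\<^bsub>grp G\<^esub> ?a) \<otimes>\<^bsub>grp G\<^esub> (?a \<otimes>\<^bsub>grp G\<^esub> y \<otimes>\<^bsub>grp G\<^esub> inv\<^bsub>grp G\<^esub> ?a)
            = ?a \<otimes>\<^bsub>grp G\<^esub> (x \<otimes>\<^bsub>grp G\<^esub> (inv\<^bsub>grp G\<^esub> ?a \<otimes>\<^bsub>grp G\<^esub> ?a \<otimes>\<^bsub>grp G\<^esub> y)) \<otimes>\<^bsub>grp G\<^esub> inv\<^bsub>grp G\<^esub> ?a"
          using aG CH x y by (simp only: C[symmetric] m_assoc inv_closed m_closed mem_Collect_eq)
        also have "\<dots> = ?a \<otimes>\<^bsub>grp G\<^esub> (x \<otimes>\<^bsub>grp G\<^esub> y) \<otimes>\<^bsub>grp G\<^esub> inv\<^bsub>grp G\<^esub> ?a"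
          using aG CH x y by (simp add: C)
        finally show "x \<otimes>\<^bsub>grp H\<^esub> y \<in> {h \<in> carrier H. ?a \<otimes>\<^bsub>grp G\<^esub> h \<otimes>\<^bsub>grp G\<^esub> inv\<^bsub>grp G\<^esub> ?a \<in> carrier H}"
          using x y mH by (simp add: one)
      next
        fix u assume "u \<in> model H" "norm u < s"
        from s(2)[OF this]
        show "epar H u \<in> {h \<in> carrier H. ?a \<otimes>\<^bsub>grp G\<^esub> h \<otimes>\<^bsub>grp G\<^esub> inv\<^bsub>grp G\<^esub> ?a \<in> carrier H}"
          using rg by blast
      qed blast
      then show ?thesis using aG by (auto simp: N_def)
    qed
  qed
  then show ?thesis using g h by (auto simp: N_def)
qed

theorem lemma2p1:
  fixes M :: "('m, 'e::euclidean_space) riemannian"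
    and G :: "('m \<Rightarrow> 'm, 'g::euclidean_space) lie"
    and S :: "('m \<Rightarrow> 'm, 's::euclidean_space) lie"
    and S' :: "('m \<Rightarrow> 'm, 't::euclidean_space) lie"
    and \<ss>' :: "(('m \<Rightarrow> 'm) \<Rightarrow> ('m \<Rightarrow> 'm) tangent) set"
  assumes "riemannian_manifold M"
    and "isometry_lie_group M G"
    and "lie_subgroup S G" and "lie_connected S"
    and "transitive_action (grp S) (carrier M) (\<lambda>g. g)"
    and "lie_ideal \<ss>' S"
    and "lie_subgroup S' S" and "lie_connected S'" and "Lie_sub S' S = \<ss>'"
  shows "\<forall>p\<in>carrier M. \<forall>q\<in>carrier M.
    isometrically_congruent M (orbit (grp S') (\<lambda>g. g) p) (orbit (grp S') (\<lambda>g. g) q)"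
proof (intro ballI)
  fix p q assume p: "p \<in> carrier M" and q: "q \<in> carrier M"
  interpret transitive_action "grp S" "carrier M" "\<lambda>g. g" by (rule assms(5))
  have S: "lie_group S" and S': "lie_group S'" and sub: "subgroup (carrier S') (grp S)"
    using assms(7) unfolding lie_subgroup_def by blast+
  interpret group "grp S" by (rule lie_grp[OF S])
  note CS = lie_carrier[OF S] and CS' = lie_carrier[OF S']
  have iso: "carrier S \<subseteq> carrier (Isom M)"
    using assms(2,3) lie_carrier unfolding isometry_lie_group_def lie_subgroup_def by (metis subgroup.subset)
  note normal = lie_ideal_normal[OF assms(7,4,8)]
  have ideal: "lie_ideal (Lie_sub S' S) S" using assms(6,9) by simp
  obtain g where g: "g \<in> carrier S" "g p = q" using unique_orbit[OF p q] CS by auto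
  have act: "(x \<otimes>\<^bsub>grp S\<^esub> y) z = x (y z)" if "x \<in> carrier S" "y \<in> carrier S" "z \<in> carrier M" for x y z
    using composition_rule[OF that(3)] that(1,2) CS by simp
  have S'S: "h \<in> carrier S" if "h \<in> carrier S'" for h using subgroup.mem_carrier[OF sub that] CS by simp
  have "g ` orbit (grp S') (\<lambda>g. g) p = orbit (grp S') (\<lambda>g. g) q"
  proof
    show "g ` orbit (grp S') (\<lambda>g. g) p \<subseteq> orbit (grp S') (\<lambda>g. g) q"
    proof
      fix x assume "x \<in> g ` orbit (grp S') (\<lambda>g. g) p"
      then obtain h where h: "h \<in> carrier S'" "x = g (h p)" by (auto simp: orbit_def CS')
      let ?k = "g \<otimes>\<^bsub>grp S\<^esub> h \<otimes>\<^bsub>grp S\<^esub> inv\<^bsub>grp S\<^esub> g"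
      have k: "?k \<in> carrier S'" using normal[OF ideal g(1) h(1)] .
      \<comment> \<open>Moving \<open>g\<close> past \<open>h\<close> replaces \<open>h\<close> by
        its conjugate \<open>?k\<close>, which acts on \<open>q = g p\<close>.\<close>
      have "?k \<otimes>\<^bsub>grp S\<^esub> g = g \<otimes>\<^bsub>grp S\<^esub> h"
        using g(1) S'S[OF h(1)] by (simp add: m_assoc CS[symmetric])
      then have "?k q = x"
        using act[OF S'S[OF k] g(1) p] act[OF g(1) S'S[OF h(1)] p] g(2) h(2) by simp
      then show "x \<in> orbit (grp S') (\<lambda>g. g) q" using k by (auto simp: orbit_def CS')
    qed
    show "orbit (grp S') (\<lambda>g. g) q \<subseteq> g ` orbit (grp S') (\<lambda>g. g) p"
    proof
      fix x assume "x \<in> orbit (grp S') (\<lambda>g. g) q"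
      then obtain h where h: "h \<in> carrier S'" "x = h q" by (auto simp: orbit_def CS')
      have ig: "inv\<^bsub>grp S\<^esub> g \<in> carrier S" using lie_inv_closed[OF S g(1)] .
      \<comment> \<open>The reverse inclusion uses normality for the inverse of
        \<open>g\<close>.\<close>
      let ?k = "inv\<^bsub>grp S\<^esub> g \<otimes>\<^bsub>grp S\<^esub> h \<otimes>\<^bsub>grp S\<^esub> g"
      have k: "?k \<in> carrier S'" using normal[OF ideal ig h(1)] g(1) by (simp add: CS[symmetric])
      have "g \<otimes>\<^bsub>grp S\<^esub> ?k = h \<otimes>\<^bsub>grp S\<^esub> g"
        using g(1) S'S[OF h(1)] by (simp add: m_assoc[symmetric] CS[symmetric])
      then have "g (?k p) = x"
        using act[OF g(1) S'S[OF k] p] act[OF S'S[OF h(1)] g(1) p] g(2) h(2) by simp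
      then show "x \<in> g ` orbit (grp S') (\<lambda>g. g) p" using k by (auto simp: orbit_def CS')
    qed
  qed
  then show "isometrically_congruent M (orbit (grp S') (\<lambda>g. g) p) (orbit (grp S') (\<lambda>g. g) q)"
    unfolding isometrically_congruent_def using iso g(1) by blast
qed

end
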